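(* Fix $T>0$ and $G\in C(\mathbb T,\mathbb R)$. Let $u_1,u_2,v:[0,\infty)\times\mathbb T\to\mathbb R$ be the solutions of the system $$\partial_t u_1(t,r)=-u_1+\tfrac12\left[\tanh(\beta_1 u_1*\phi_1+\beta_1\lambda)+\tanh(\beta_1u_1*\phi_1-\beta_1\lambda)\right]+u_2\,\tfrac12\left[\tanh(\beta_1u_1*\phi_1+\beta_1\lambda)-\tanh(\beta_1u_1*\phi_1-\beta_1\lambda)\right],$$ $$\partial_t u_2(t,r)=-u_2+\tfrac12\left[\tanh(\beta_2 u_2*\phi_2+\beta_2\lambda)+\tanh(\beta_2u_2*\phi_2-\beta_2\lambda)\right]-u_1\,\tfrac12\left[\tanh(\beta_2u_2*\phi_2+\beta_2\lambda)-\tanh(\beta_2u_2*\phi_2-\beta_2\lambda)\right],$$ $$\begin{aligned}\partial_t v(t,r)=-2v&+\tfrac12\left[\tanh(\beta_1u_1*\phi_1+\beta_1\lambda)-\tanh(\beta_1u_1*\phi_1-\beta_1\lambda)\right]-\tfrac12\left[\tanh(\beta_2u_2*\phi_2+\beta_2\lambda)-\tanh(\beta_2u_2*\phi_2-\beta_2\lambda)\right]\\&+\tfrac{u_1}{2}\left[\tanh(\beta_2u_2*\phi_2+\beta_2\lambda)+\tanh(\beta_2u_2*\phi_2-\beta_2\lambda)\right]+\tfrac{u_2}{2}\left[\tanh(\beta_1u_1*\phi_1+\beta_1\lambda)+\tanh(\beta_1u_1*\phi_1-\beta_1\lambda)\right]\end{aligned}$$ with initial condition $u_i(0,\cdot)=\psi_i$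 for $i\in\{1,2\}$ and $v(0,\cdot)=\psi_1(\cdot)\psi_2(\cdot)$, where on the right-hand sides $u_1,u_2,v$ are evaluated at $(t,r)$ and $u_i*\phi_i$ stands for $(u_i(t,\cdot)*\phi_i)(r)$. Then, as $\gamma\to0$, the limits $$\sup_{0\le t\le T}\left|\langle\sigma_{\gamma,i}(t),G\rangle-\langle u_i(t,\cdot),G\rangle\right|\to0\quad(i\in\{1,2\}),\qquad \sup_{0\le t\le T}\left|\langle\eta_\gamma(t),G\rangle-\langle v(t,\cdot),G\rangle\right|\to0$$ hold in $\mathbb P$-probability.
   Context: $\mathbb T$ is the unit torus, identified with $[0,1)$, with metric $d_{\mathbb T}(r,\tilde r)=\min_{a\in\mathbb Z}|r-\tilde r+a|$ (continuity on $\mathbb T$ refers to this metric). $\gamma=1/N$ with $N\in\mathbb N$, and $\gamma\to0$ means $N\to\infty$. $\Lambda_\gamma=(\gamma^{-1}\mathbb T)\cap\mathbb Z=\{0,\dots,N-1\}$. Parameters: $\beta_1,\beta_2>0$, $\lambda>0$. Kernels $\phi_1,\phi_2\in C(\mathbb T\times\mathbb T,[0,\infty))$ are symmetric ($\phi_i(r,\tilde r)=\phi_i(\tilde r,r)$), translation invariant ($\phi_i(r,\tilde r)=\phi_i(0,d_{\mathbb T}(r,\tilde r))$) and satisfy $\int_0^1\phi_i(0,r)\,dr=1$. For $\sigma_\gamma\in\{-1,1\}^{\Lambda_\gamma}$, $(\sigma_\gamma*\phi_i)(x)=\gamma\sum_{y\in\Lambda_\gamma}\sigma_\gamma(y)\phi_i(\gamma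 x,\gamma y)$. For a function $\psi$ on $\mathbb T$, $(\psi*\phi_i)(r)=\int_0^1\psi(\tilde r)\phi_i(\tilde r,r)\,d\tilde r$. For each $\gamma$, $\underline\sigma_\gamma(t)=(\sigma_{\gamma,1}(t),\sigma_{\gamma,2}(t))$, $t\ge0$, is the continuous-time (càdlàg) Markov process on $E_\gamma=\{-1,1\}^{\Lambda_\gamma}\times\{-1,1\}^{\Lambda_\gamma}$, with generator $$(L_\gamma F)(\underline\sigma)=\sum_{x\in\Lambda_\gamma}\left\{R_1(x,\underline\sigma)[F(\sigma_1^x,\sigma_2)-F(\sigma_1,\sigma_2)]+R_2(x,\underline\sigma)[F(\sigma_1,\sigma_2^x)-F(\sigma_1,\sigma_2)]\right\},$$ where $\sigma_i^x$ is $\sigma_i$ with the spin at $x$ flipped, and $$R_1(x,\underline\sigma)=\frac{\exp\{-\beta_1\sigma_1(x)(\sigma_1*\phi_1)(x)\}\exp\{-\beta_1\lambda\sigma_1(x)\sigma_2(x)\}}{2\cosh\{\beta_1(\sigma_1*\phi_1)(x)+\beta_1\lambda\sigma_2(x)\}},$$ $$R_2(x,\underline\sigma)=\frac{\exp\{-\beta_2\sigma_2(x)(\sigma_2*\phi_2)(x)\}\exp\{\beta_2\lambda\sigma_2(x)\sigma_1(x)\}}{2\cosh\{\beta_2(\sigma_2*\phi_2)(x)-\beta_2\lambda\sigma_1(x)\}}.$$ All processes are defined on one probability space $(\Omega,\mathcal F,\mathbb P)$. Initial distribution: given $\psi_1,\psi_2\in C(\mathbb T,[-1,1])$, the variables $\{\sigma_{\gamma,i}(0,x):x\in\Lambda_\gamma,\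 i\in\{1,2\}\}$ are independent with $\mathbb E(\sigma_{\gamma,i}(0,x))=\psi_i(\gamma x)$. The correlation field is $\eta_\gamma(t,x)=\sigma_{\gamma,1}(t,x)\sigma_{\gamma,2}(t,x)$. Pairings: $\langle\sigma_\gamma,G\rangle=\gamma\sum_{x\in\Lambda_\gamma}\sigma_\gamma(x)G(\gamma x)$ for $\sigma_\gamma\in\{-1,1\}^{\Lambda_\gamma}$, and $\langle\psi,G\rangle=\int_0^1\psi(r)G(r)\,dr$ for $\psi\in L^1(\mathbb T)$. The paper takes as standard that the system of equations has a unique solution for the given initial condition (its data being Lipschitz). *)

theory Defs
  imports "HOL-Probability.Probability"
begin

section \<open>The unit torus\<close>

text \<open>The torus is the set \<open>{0..<1}\<close> with the metric below; functions on the torus are functions on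
  \<open>real\<close> of which only the values on \<open>{0..<1}\<close> matter. The infimum is a minimum.\<close>

definition torus_dist :: "real \<Rightarrow> real \<Rightarrow> real" where
  "torus_dist r s = (INF a::int. \<bar>r - s + of_int a\<bar>)"

lemma bdd_below_torus_dist: "bdd_below (range (\<lambda>a::int. \<bar>r - s + of_int a\<bar> :: real))"
  by (rule bdd_belowI[of _ 0]) auto

lemma torus_dist_le: "torus_dist r s \<le> \<bar>r - s + of_int a\<bar>"
  unfolding torus_dist_def by (rule cINF_lower[OF bdd_below_torus_dist]) simp

lemma torus_dist_greatest: "(\<And>a::int. c \<le> \<bar>r - s + of_int a\<bar>) \<Longrightarrow> c \<le> torus_dist r s"
  unfolding torus_dist_def by (rule cINF_greatest) auto

interpretation torus: Metric_space "{0..<1::real}" torus_dist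
proof
  fix x y z :: real
  show "0 \<le> torus_dist x y"
    by (rule torus_dist_greatest) simp
  have le: "torus_dist x y \<le> torus_dist y x" for x y
  proof (rule torus_dist_greatest)
    fix a :: int
    show "torus_dist x y \<le> \<bar>y - x + of_int a\<bar>"
      using torus_dist_le[of x y "- a"] by simp
  qed
  show "torus_dist x y = torus_dist y x"
    using le[of x y] le[of y x] by simp
  show "torus_dist x y = 0 \<longleftrightarrow> x = y" if "x \<in> {0..<1}" "y \<in> {0..<1}"
  proof
    assume "x = y"
    then show "torus_dist x y = 0"
      using torus_dist_le[of x y 0] torus_dist_greatest[of 0 x y] by simp
  next
    assume d: "torus_dist x y = 0"
    have "min \<bar>x - y\<bar> (1 - \<bar>x - y\<bar>) \<le> torus_dist x y"
    proof (rule torus_dist_greatest)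
      fix a :: int
      consider "a = 0" | "1 \<le> \<bar>of_int a :: real\<bar>"
        by (cases "a = 0") (auto simp flip: of_int_abs)
      then show "min \<bar>x - y\<bar> (1 - \<bar>x - y\<bar>) \<le> \<bar>x - y + of_int a\<bar>"
        by cases auto
    qed
    then show "x = y"
      using d that by (auto simp: min_def split: if_splits)
  qed
  show "torus_dist x z \<le> torus_dist x y + torus_dist y z"
  proof -
    have "torus_dist x z - torus_dist x y \<le> torus_dist y z"
    proof (rule torus_dist_greatest)
      fix b :: int
      have "torus_dist x z - \<bar>y - z + of_int b\<bar> \<le> torus_dist x y"
      proof (rule torus_dist_greatest)
        fix a :: int
        show "torus_dist x z - \<bar>y - z + of_int b\<bar> \<le> \<bar>x - y + of_int a\<bar>"
          using torus_dist_le[of x z "a + b"] by simp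
      qed
      then show "torus_dist x z - torus_dist x y \<le> \<bar>y - z + of_int b\<bar>" by simp
    qed
    then show ?thesis by simp
  qed
qed

definition interaction_kernel :: "(real \<Rightarrow> real \<Rightarrow> real) \<Rightarrow> bool" where
  "interaction_kernel \<phi> \<longleftrightarrow>
     continuous_map (prod_topology torus.mtopology torus.mtopology) (top_of_set {0..})
       (\<lambda>(r, s). \<phi> r s) \<and>
     (\<forall>r\<in>{0..<1}. \<forall>s\<in>{0..<1}. \<phi> r s = \<phi> s r) \<and>
     (\<forall>r\<in>{0..<1}. \<forall>s\<in>{0..<1}. \<phi> r s = \<phi> 0 (torus_dist r s)) \<and>
     (LINT r:{0..<1}|lborel. \<phi> 0 r) = 1"

definition torus_conv :: "(real \<Rightarrow> real) \<Rightarrow> (real \<Rightarrow> real \<Rightarrow> real) \<Rightarrow> real \<Rightarrow> real" where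
  "torus_conv \<psi> \<phi> r = (LINT s:{0..<1}|lborel. \<psi> s * \<phi> s r)"

definition torus_pairing :: "(real \<Rightarrow> real) \<Rightarrow> (real \<Rightarrow> real) \<Rightarrow> real" where
  "torus_pairing \<psi> G = (LINT r:{0..<1}|lborel. \<psi> r * G r)"


section \<open>The spin dynamics\<close>

text \<open>The scale is \<open>\<gamma> = 1 / N\<close> and the sites are \<open>{..<N}\<close>. Configurations are extensional, so that
  \<open>states N\<close> is finite.\<close>

type_synonym config = "nat \<Rightarrow> real"

definition configs :: "nat \<Rightarrow> config set" where
  "configs N = {..<N} \<rightarrow>\<^sub>E {-1, 1}"

definition states :: "nat \<Rightarrow> (config \<times> config) set" where
  "states N = configs N \<times> configs N"

definition flip :: "config \<Rightarrow> nat \<Rightarrow> config" where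
  "flip \<sigma> x = \<sigma>(x := - \<sigma> x)"

definition config_conv :: "nat \<Rightarrow> config \<Rightarrow> (real \<Rightarrow> real \<Rightarrow> real) \<Rightarrow> nat \<Rightarrow> real" where
  "config_conv N \<sigma> \<phi> x = 1 / real N * (\<Sum>y<N. \<sigma> y * \<phi> (real x / real N) (real y / real N))"

definition config_pairing :: "nat \<Rightarrow> config \<Rightarrow> (real \<Rightarrow> real) \<Rightarrow> real" where
  "config_pairing N \<sigma> G = 1 / real N * (\<Sum>x<N. \<sigma> x * G (real x / real N))"

definition rate1 ::
  "nat \<Rightarrow> real \<Rightarrow> real \<Rightarrow> (real \<Rightarrow> real \<Rightarrow> real) \<Rightarrow> nat \<Rightarrow> config \<Rightarrow> config \<Rightarrow> real" where
  "rate1 N \<beta>1 lam \<phi>1 x \<sigma>1 \<sigma>2 =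
     exp (- \<beta>1 * \<sigma>1 x * config_conv N \<sigma>1 \<phi>1 x) * exp (- \<beta>1 * lam * \<sigma>1 x * \<sigma>2 x) /
     (2 * cosh (\<beta>1 * config_conv N \<sigma>1 \<phi>1 x + \<beta>1 * lam * \<sigma>2 x))"

definition rate2 ::
  "nat \<Rightarrow> real \<Rightarrow> real \<Rightarrow> (real \<Rightarrow> real \<Rightarrow> real) \<Rightarrow> nat \<Rightarrow> config \<Rightarrow> config \<Rightarrow> real" where
  "rate2 N \<beta>2 lam \<phi>2 x \<sigma>1 \<sigma>2 =
     exp (- \<beta>2 * \<sigma>2 x * config_conv N \<sigma>2 \<phi>2 x) * exp (\<beta>2 * lam * \<sigma>2 x * \<sigma>1 x) /
     (2 * cosh (\<beta>2 * config_conv N \<sigma>2 \<phi>2 x - \<beta>2 * lam * \<sigma>1 x))"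

definition generator ::
  "nat \<Rightarrow> real \<Rightarrow> real \<Rightarrow> real \<Rightarrow> (real \<Rightarrow> real \<Rightarrow> real) \<Rightarrow> (real \<Rightarrow> real \<Rightarrow> real) \<Rightarrow>
   (config \<times> config \<Rightarrow> real) \<Rightarrow> config \<times> config \<Rightarrow> real" where
  "generator N \<beta>1 \<beta>2 lam \<phi>1 \<phi>2 F = (\<lambda>(\<sigma>1, \<sigma>2). \<Sum>x<N.
     rate1 N \<beta>1 lam \<phi>1 x \<sigma>1 \<sigma>2 * (F (flip \<sigma>1 x, \<sigma>2) - F (\<sigma>1, \<sigma>2)) +
     rate2 N \<beta>2 lam \<phi>2 x \<sigma>1 \<sigma>2 * (F (\<sigma>1, flip \<sigma>2 x) - F (\<sigma>1, \<sigma>2)))"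


section \<open>Markov processes on a finite state space\<close>

definition cadlag :: "(real \<Rightarrow> 'b::t2_space) \<Rightarrow> bool" where
  "cadlag f \<longleftrightarrow> (\<forall>t\<ge>0. continuous (at_right t) f) \<and> (\<forall>t>0. \<exists>l. (f \<longlongrightarrow> l) (at_left t))"

text \<open>The semigroup \<open>exp (t L)\<close>; the series converges when \<open>L\<close> is a linear operator on the
  functions on a finite set.\<close>

definition semigroup_of :: "(('s \<Rightarrow> real) \<Rightarrow> 's \<Rightarrow> real) \<Rightarrow> real \<Rightarrow> ('s \<Rightarrow> real) \<Rightarrow> 's \<Rightarrow> real" where
  "semigroup_of L t f x = (\<Sum>n. t ^ n / fact n * (L ^^ n) f x)"

definition natural_filtration ::
  "'w measure \<Rightarrow> 's set \<Rightarrow> (real \<Rightarrow> 'w \<Rightarrow> 's) \<Rightarrow> real \<Rightarrow> 'w measure" where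
  "natural_filtration M S X s =
     sigma (space M) {X r -` A \<inter> space M | r A. 0 \<le> r \<and> r \<le> s \<and> A \<subseteq> S}"

text \<open>\<open>S\<close> is meant to be finite. For the state spaces above the product topology of \<open>config \<times> config\<close>
  induces the discrete topology on \<open>S\<close>, so that \<open>cadlag\<close> has its usual meaning. The last clause is
  the Markov property with transition semigroup \<open>exp (t L)\<close>.\<close>

definition markov_process_with_generator ::
  "'w measure \<Rightarrow> 's::t2_space set \<Rightarrow> (('s \<Rightarrow> real) \<Rightarrow> 's \<Rightarrow> real) \<Rightarrow> (real \<Rightarrow> 'w \<Rightarrow> 's) \<Rightarrow> bool" where
  "markov_process_with_generator M S L X \<longleftrightarrow>
     (\<forall>t\<ge>0. X t \<in> M \<rightarrow>\<^sub>M count_space S) \<and>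
     (\<forall>\<omega>\<in>space M. cadlag (\<lambda>t. X t \<omega>)) \<and>
     (\<forall>f s t. 0 \<le> s \<longrightarrow> s \<le> t \<longrightarrow>
        (AE \<omega> in M. real_cond_exp M (natural_filtration M S X s) (\<lambda>\<omega>. f (X t \<omega>)) \<omega> =
                    semigroup_of L (t - s) f (X s \<omega>)))"

text \<open>The two families of initial spins are indexed jointly by the disjoint sum of the sites with
  themselves.\<close>

definition product_initial ::
  "'w measure \<Rightarrow> nat \<Rightarrow> (real \<Rightarrow> real) \<Rightarrow> (real \<Rightarrow> real) \<Rightarrow> ('w \<Rightarrow> config \<times> config) \<Rightarrow> bool" where
  "product_initial M N \<psi>1 \<psi>2 X0 \<longleftrightarrow>
     prob_space.indep_vars M (\<lambda>_. borel)
       (case_sum (\<lambda>x \<omega>. fst (X0 \<omega>) x) (\<lambda>x \<omega>. snd (X0 \<omega>) x)) ({..<N} <+> {..<N}) \<and>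
     (\<forall>x<N. prob_space.expectation M (\<lambda>\<omega>. fst (X0 \<omega>) x) = \<psi>1 (real x / real N) \<and>
            prob_space.expectation M (\<lambda>\<omega>. snd (X0 \<omega>) x) = \<psi>2 (real x / real N))"


section \<open>The limiting system\<close>

text \<open>Solutions are classical in time (one-sided derivative at time zero). In space only the
  integrability needed for the convolutions and pairings to make sense is required; continuity in
  space is then a consequence.\<close>

definition solves_limit_system ::
  "real \<Rightarrow> real \<Rightarrow> real \<Rightarrow> (real \<Rightarrow> real \<Rightarrow> real) \<Rightarrow> (real \<Rightarrow> real \<Rightarrow> real) \<Rightarrow>
   (real \<Rightarrow> real) \<Rightarrow> (real \<Rightarrow> real) \<Rightarrow>
   (real \<Rightarrow> real \<Rightarrow> real) \<Rightarrow> (real \<Rightarrow> real \<Rightarrow> real) \<Rightarrow> (real \<Rightarrow> real \<Rightarrow> real) \<Rightarrow> bool" where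
  "solves_limit_system \<beta>1 \<beta>2 lam \<phi>1 \<phi>2 \<psi>1 \<psi>2 u1 u2 v \<longleftrightarrow>
     (\<forall>t\<ge>0. set_integrable lborel {0..<1} (u1 t) \<and> set_integrable lborel {0..<1} (u2 t) \<and>
            set_integrable lborel {0..<1} (v t)) \<and>
     (\<forall>r\<in>{0..<1}. u1 0 r = \<psi>1 r \<and> u2 0 r = \<psi>2 r \<and> v 0 r = \<psi>1 r * \<psi>2 r) \<and>
     (\<forall>t\<ge>0. \<forall>r\<in>{0..<1}.
        let p1 = tanh (\<beta>1 * torus_conv (u1 t) \<phi>1 r + \<beta>1 * lam);
            q1 = tanh (\<beta>1 * torus_conv (u1 t) \<phi>1 r - \<beta>1 * lam);
            p2 = tanh (\<beta>2 * torus_conv (u2 t) \<phi>2 r + \<beta>2 * lam);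
            q2 = tanh (\<beta>2 * torus_conv (u2 t) \<phi>2 r - \<beta>2 * lam)
        in ((\<lambda>s. u1 s r) has_real_derivative
              - u1 t r + 1/2 * (p1 + q1) + u2 t r * (1/2) * (p1 - q1)) (at t within {0..}) \<and>
           ((\<lambda>s. u2 s r) has_real_derivative
              - u2 t r + 1/2 * (p2 + q2) - u1 t r * (1/2) * (p2 - q2)) (at t within {0..}) \<and>
           ((\<lambda>s. v s r) has_real_derivative
              - 2 * v t r + 1/2 * (p1 - q1) - 1/2 * (p2 - q2)
              + u1 t r / 2 * (p2 + q2) + u2 t r / 2 * (p1 + q1)) (at t within {0..}))"


section \<open>Convergence in probability\<close>

definition tendsto_in_prob ::
  "'w measure \<Rightarrow> ('i \<Rightarrow> 'w \<Rightarrow> real) \<Rightarrow> ('w \<Rightarrow> real) \<Rightarrow> 'i filter \<Rightarrow> bool" where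
  "tendsto_in_prob M Z Y F \<longleftrightarrow>
     Y \<in> borel_measurable M \<and> (\<forall>\<^sub>F i in F. Z i \<in> borel_measurable M) \<and>
     (\<forall>\<epsilon>>0. ((\<lambda>i. measure M {\<omega>\<in>space M. \<epsilon> < \<bar>Z i \<omega> - Y \<omega>\<bar>}) \<longlongrightarrow> 0) F)"

end

theory Submission
  imports Defs
begin

text \<open>
The spins interact only through the fields \<open>\<sigma>\<^sub>i * \<phi>\<^sub>i\<close>, and these are averages over many sites. As long as all
averages \<open>1/N \<Sum>\<^sub>x (g1 \<sigma>\<^sub>1 + g2 \<sigma>\<^sub>2 + g3 \<sigma>\<^sub>1 \<sigma>\<^sub>2)(x)\<close> with bounded weights are close to their deterministic
counterparts, each site moves almost as if it were driven by the limiting field, and this in turn keeps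
the averages close. The proof turns this circular reasoning into a Gronwall inequality.

\<^emph>\<open>Fixed times.\<close> A spin takes only the values \<open>1\<close> and \<open>-1\<close>, so \<open>tanh (\<beta> c + \<beta> lam s)\<close> is affine in the spin \<open>s\<close>.
Hence the generator maps averages to averages, with coefficients that depend on the configuration only
through the fields (\<open>gen_statistic\<close>). Let \<open>d\<^sub>g(t)\<close> be the average with weights \<open>g\<close> minus the same average of
the solution \<open>(u1, u2, v)\<close> over the grid. The drift of \<open>d\<^sub>g\<close> is \<open>d\<^sub>h\<close> for weights \<open>h\<close> bounded by three times the
bound of \<open>g\<close>, plus a remainder that is controlled by the errors of the fields
(\<open>drift_decomposition\<close>, \<open>nonlinear_remainder_bound\<close>). Up to the error of a Riemann sum, the error of the field at a
site is again a deviation \<open>d\<^sub>p\<close>, with weights \<open>p = \<phi>\<^sub>i(x, -)\<close> (\<open>conv_deviation\<close>). So the class of all bounded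
weights is closed under the dynamics, and the supremum over weights of \<open>E d\<^sub>g(t)\<^sup>2\<close> satisfies a Gronwall
inequality (\<open>mean_square_deviation_gronwall\<close>). Its inhomogeneous terms vanish in the limit: the noise is of order \<open>1/N\<close>
because a flip changes an average by order \<open>1/N\<close>, the initial variance is of order \<open>1/N\<close> by independence
(\<open>initial_statistic_variance\<close>), and the Riemann sums converge uniformly in time because the solution is bounded and
equicontinuous in space (\<open>solution_equicontinuous\<close>).

\<^emph>\<open>Uniformity in time.\<close> Conditionally on the past, the mean square of the increment of an average over a window
of length \<open>\<delta>\<close> is of order \<open>\<delta>\<^sup>2 + \<delta>/N\<close> (\<open>square_increment\<close>). A first-passage argument turns this into a bound of
the same order for the probability that the average oscillates by a fixed amount within the window
(\<open>oscillation\<close>). Summed over \<open>T/\<delta>\<close> windows the bound is of order \<open>\<delta> + 1/N\<close>, and it remains to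
combine it with the convergence at the endpoints of the windows (\<open>prob_sup_deviation_le\<close>). About the
process this uses Dynkin's formula on events of the past (\<open>dynkin_on_event\<close>) and the right-continuity of
paths.
\<close>

section \<open>Differential inequalities\<close>

text \<open>Derivatives are taken within the half-line because the limiting equations are posed for nonnegative times
only; at time zero they are one-sided.\<close>

lemma nonincreasing_from_deriv:
  fixes f f' :: "real \<Rightarrow> real"
  assumes der: "\<And>t. 0 \<le> t \<Longrightarrow> t \<le> \<tau> \<Longrightarrow> (f has_real_derivative f' t) (at t within {0..})"
    and le: "\<And>t. 0 \<le> t \<Longrightarrow> t \<le> \<tau> \<Longrightarrow> f' t \<le> 0"
    and "0 \<le> t" "t \<le> \<tau>"
  shows "f t \<le> f 0"
proof (rule DERIV_nonpos_imp_decreasing_open[OF \<open>0 \<le> t\<close>])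
  show "\<exists>y. DERIV f x :> y \<and> y \<le> 0" if "0 < x" "x < t" for x
  proof -
    have "at x within {0..} = at x"
      using that by (intro at_within_interior) (simp add: interior_real_atLeast)
    then show ?thesis using der[of x] le[of x] that assms(3,4) by auto
  qed
  show "continuous_on {0..t} f"
  proof (rule continuous_on_subset[of "{0..\<tau>}"])
    show "continuous_on {0..\<tau>} f"
      unfolding continuous_on_eq_continuous_within
    proof
      fix x assume "x \<in> {0..\<tau>}"
      then have "continuous (at x within {0..}) f"
        using der[of x] by (auto intro: DERIV_continuous)
      then show "continuous (at x within {0..\<tau>}) f"
        by (rule continuous_within_subset) auto
    qed
  qed (use assms in auto)
qed

lemma increment_le_from_deriv:
  fixes f f' g g' :: "real \<Rightarrow> real"
  assumes "\<And>t. 0 \<le> t \<Longrightarrow> t \<le> \<tau> \<Longrightarrow> (f has_real_derivative f' t) (at t within {0..})"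
    and "\<And>t. 0 \<le> t \<Longrightarrow> t \<le> \<tau> \<Longrightarrow> (g has_real_derivative g' t) (at t within {0..})"
    and "\<And>t. 0 \<le> t \<Longrightarrow> t \<le> \<tau> \<Longrightarrow> f' t \<le> g' t"
    and "0 \<le> t" "t \<le> \<tau>"
  shows "f t - f 0 \<le> g t - g 0"
proof -
  have "f t - g t \<le> f 0 - g 0"
    by (rule nonincreasing_from_deriv[of \<tau> "\<lambda>t. f t - g t" "\<lambda>t. f' t - g' t"])
      (use assms in \<open>auto intro!: derivative_intros\<close>)
  then show ?thesis by simp
qed

text \<open>The function \<open>exp (- K t) (f t + e / K)\<close> has a nonpositive derivative.\<close>

lemma gronwall_differential:
  fixes f f' :: "real \<Rightarrow> real"
  assumes der: "\<And>t. 0 \<le> t \<Longrightarrow> t \<le> \<tau> \<Longrightarrow> (f has_real_derivative f' t) (at t within {0..})"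
    and le: "\<And>t. 0 \<le> t \<Longrightarrow> t \<le> \<tau> \<Longrightarrow> f' t \<le> K * f t + e"
    and "K > 0" "0 \<le> t" "t \<le> \<tau>"
  shows "f t \<le> (f 0 + e / K) * exp (K * t) - e / K"
proof -
  have "exp (- K * t) * (f t + e / K) \<le> exp (- K * 0) * (f 0 + e / K)"
  proof (rule nonincreasing_from_deriv[of \<tau> _ "\<lambda>t. exp (- K * t) * (f' t - (K * f t + e))"])
    fix t assume t: "0 \<le> t" "t \<le> \<tau>"
    show "((\<lambda>t. exp (- K * t) * (f t + e / K)) has_real_derivative
            exp (- K * t) * (f' t - (K * f t + e))) (at t within {0..})"
      using \<open>K > 0\<close> by (auto intro!: derivative_eq_intros der t simp: field_simps)
    show "exp (- K * t) * (f' t - (K * f t + e)) \<le> 0"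
      using le[OF t] by (simp add: mult_le_0_iff)
  qed (use assms in auto)
  then show ?thesis
    by (simp add: exp_minus field_simps)
qed

text \<open>Applied to a solution of the limiting system this gives boundedness, and applied to the difference of its
values at two points it gives continuity in space; \<open>e\<close> is the inhomogeneity. Absolute values are
not differentiable, so the estimate is made for the sum of squares, where
\<open>2 |w| e \<le> w\<^sup>2 + e\<^sup>2\<close> absorbs the inhomogeneity.\<close>

lemma gronwall_triple:
  fixes w1 w2 w3 w1' w2' w3' :: "real \<Rightarrow> real"
  assumes der: "\<And>t. 0 \<le> t \<Longrightarrow> t \<le> \<tau> \<Longrightarrow> (w1 has_real_derivative w1' t) (at t within {0..})"
      "\<And>t. 0 \<le> t \<Longrightarrow> t \<le> \<tau> \<Longrightarrow> (w2 has_real_derivative w2' t) (at t within {0..})"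
      "\<And>t. 0 \<le> t \<Longrightarrow> t \<le> \<tau> \<Longrightarrow> (w3 has_real_derivative w3' t) (at t within {0..})"
    and bd: "\<And>t. 0 \<le> t \<Longrightarrow> t \<le> \<tau> \<Longrightarrow> \<bar>w1' t\<bar> \<le> 2 * (\<bar>w1 t\<bar> + \<bar>w2 t\<bar> + \<bar>w3 t\<bar>) + e"
      "\<And>t. 0 \<le> t \<Longrightarrow> t \<le> \<tau> \<Longrightarrow> \<bar>w2' t\<bar> \<le> 2 * (\<bar>w1 t\<bar> + \<bar>w2 t\<bar> + \<bar>w3 t\<bar>) + e"
      "\<And>t. 0 \<le> t \<Longrightarrow> t \<le> \<tau> \<Longrightarrow> \<bar>w3' t\<bar> \<le> 2 * (\<bar>w1 t\<bar> + \<bar>w2 t\<bar> + \<bar>w3 t\<bar>) + e"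
    and t: "0 \<le> t" "t \<le> \<tau>"
  shows "(w1 t)\<^sup>2 + (w2 t)\<^sup>2 + (w3 t)\<^sup>2
           \<le> ((w1 0)\<^sup>2 + (w2 0)\<^sup>2 + (w3 0)\<^sup>2 + e\<^sup>2) * exp (13 * t)"
proof -
  let ?f = "\<lambda>t. (w1 t)\<^sup>2 + (w2 t)\<^sup>2 + (w3 t)\<^sup>2"
  let ?f' = "\<lambda>t. 2 * w1 t * w1' t + 2 * w2 t * w2' t + 2 * w3 t * w3' t"
  have "?f t \<le> (?f 0 + 3 * e\<^sup>2 / 13) * exp (13 * t) - 3 * e\<^sup>2 / 13"
  proof (rule gronwall_differential[of \<tau> ?f ?f'])
    fix t assume t: "0 \<le> t" "t \<le> \<tau>"
    show "(?f has_real_derivative ?f' t) (at t within {0..})"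
      by (auto intro!: derivative_eq_intros der t)
    define S where "S = \<bar>w1 t\<bar> + \<bar>w2 t\<bar> + \<bar>w3 t\<bar>"
    have one: "2 * w * w' \<le> 4 * \<bar>w\<bar> * S + (e\<^sup>2 + w\<^sup>2)" if "\<bar>w'\<bar> \<le> 2 * S + e" for w w' :: real
    proof -
      have "2 * w * w' \<le> 2 * \<bar>w\<bar> * \<bar>w'\<bar>"
        by (metis abs_ge_self abs_mult abs_numeral)
      also have "\<dots> \<le> 2 * \<bar>w\<bar> * (2 * S + e)"
        using that by (intro mult_left_mono) auto
      also have "\<dots> = 4 * \<bar>w\<bar> * S + 2 * \<bar>w\<bar> * e"
        by (simp add: algebra_simps)
      also have "2 * \<bar>w\<bar> * e \<le> e\<^sup>2 + w\<^sup>2"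
        using sum_squares_bound[of "\<bar>w\<bar>" e] by simp
      finally show ?thesis by simp
    qed
    have "4 * \<bar>w1 t\<bar> * S + 4 * \<bar>w2 t\<bar> * S + 4 * \<bar>w3 t\<bar> * S = 4 * (S * S)"
      by (simp add: S_def algebra_simps)
    then have "?f' t \<le> 4 * (S * S) + 3 * e\<^sup>2 + ?f t"
      using one[where w = "w1 t", OF bd(1)[OF t, folded S_def]]
        one[where w = "w2 t", OF bd(2)[OF t, folded S_def]]
        one[where w = "w3 t", OF bd(3)[OF t, folded S_def]]
      by linarith
    moreover have "S * S \<le> 3 * ?f t"
    proof -
      have "S\<^sup>2 \<le> 3 * (\<bar>w1 t\<bar>\<^sup>2 + \<bar>w2 t\<bar>\<^sup>2 + \<bar>w3 t\<bar>\<^sup>2)"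
        unfolding S_def
        using sum_squares_bound[of "\<bar>w1 t\<bar>" "\<bar>w2 t\<bar>"] sum_squares_bound[of "\<bar>w2 t\<bar>" "\<bar>w3 t\<bar>"]
          sum_squares_bound[of "\<bar>w1 t\<bar>" "\<bar>w3 t\<bar>"]
        by (simp add: power2_eq_square algebra_simps)
      then show ?thesis by (simp add: power2_eq_square)
    qed
    ultimately show "?f' t \<le> 13 * ?f t + 3 * e\<^sup>2"
      by simp
  qed (use t in auto)
  also have "\<dots> \<le> (?f 0 + e\<^sup>2) * exp (13 * t)"
  proof -
    have "(?f 0 + 3 * e\<^sup>2 / 13) * exp (13 * t) \<le> (?f 0 + e\<^sup>2) * exp (13 * t)"
      by (intro mult_right_mono) auto
    moreover have "0 \<le> 3 * e\<^sup>2 / 13" by simp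
    ultimately show ?thesis by linarith
  qed
  finally show ?thesis .
qed

lemma tanh_lipschitz: "\<bar>tanh x - tanh y\<bar> \<le> \<bar>x - y\<bar>" for x y :: real
proof -
  have "(tanh has_field_derivative 1 - (tanh z)\<^sup>2) (at z within UNIV)" for z :: real
    by (auto intro!: derivative_eq_intros)
  moreover have "norm (1 - (tanh z)\<^sup>2) \<le> 1" for z :: real
    using tanh_real_lt_1[of z] tanh_real_gt_neg1[of z] by (simp add: abs_square_le_1)
  ultimately have "norm (tanh x - tanh y) \<le> 1 * norm (x - y)"
    by (intro field_differentiable_bound[where S = UNIV and f' = "\<lambda>z. 1 - (tanh z)\<^sup>2"]) auto
  then show ?thesis by simp
qed

lemma abs_tanh_le_1: "\<bar>tanh x\<bar> \<le> 1" for x :: real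
  using tanh_real_lt_1[of x] tanh_real_gt_neg1[of x] by linarith

section \<open>Continuous functions on the torus\<close>

lemma torus_dist_frac_le: "torus_dist (frac r) (frac s) \<le> \<bar>r - s\<bar>"
  using torus_dist_le[of "frac r" "frac s" "\<lfloor>r\<rfloor> - \<lfloor>s\<rfloor>"] by (simp add: frac_def)

text \<open>Pulled back along \<open>frac\<close>, a continuous function on the torus becomes a continuous function on the line.
Compactness of \<open>{0..1}\<close> can then be used in place of compactness of the torus.\<close>

lemma continuous_map_frac: "continuous_map euclideanreal torus.mtopology frac"
  unfolding torus.continuous_map_to_metric
proof (intro ballI allI impI)
  fix x \<epsilon> :: real assume "0 < \<epsilon>"
  have "frac y \<in> torus.mball (frac x) \<epsilon>" if "y \<in> ball x \<epsilon>" for y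
    using that torus_dist_frac_le[of x y] by (simp add: torus.in_mball frac_lt_1 dist_real_def)
  then show "\<exists>U. openin euclideanreal U \<and> x \<in> U \<and> (\<forall>y\<in>U. frac y \<in> torus.mball (frac x) \<epsilon>)"
    using \<open>0 < \<epsilon>\<close> by (intro exI[of _ "ball x \<epsilon>"]) auto
qed

lemma torus_continuous_imp_continuous_frac:
  assumes "continuous_map torus.mtopology euclideanreal f"
  shows "continuous_on UNIV (f \<circ> frac)"
  using continuous_map_compose[OF continuous_map_frac assms] by simp

lemma torus_continuous_bounded:
  assumes "continuous_map torus.mtopology euclideanreal f"
  shows "\<exists>B\<ge>0. \<forall>r\<in>{0..<1}. \<bar>f r\<bar> \<le> B"
proof -
  have "compact ((f \<circ> frac) ` {0..1})"
    by (intro compact_continuous_image continuous_on_subset[OF torus_continuous_imp_continuous_frac[OF assms]]) auto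
  then obtain B where "\<forall>x\<in>(f \<circ> frac) ` {0..1}. norm x \<le> B"
    unfolding compact_eq_bounded_closed bounded_iff by blast
  then have *: "\<bar>f r\<bar> \<le> B" if "r \<in> {0..<1}" for r
  proof -
    have "norm ((f \<circ> frac) r) \<le> B"
      using that by (intro \<open>\<forall>x\<in>_. norm x \<le> B\<close>[rule_format] imageI) auto
    then show ?thesis using that by simp
  qed
  moreover have "0 \<le> B"
    using *[of 0] by simp
  ultimately show ?thesis by blast
qed

lemma torus_uniformly_continuous:
  assumes "continuous_map torus.mtopology euclideanreal f" "\<epsilon> > 0"
  shows "\<exists>\<delta>>0. \<forall>r\<in>{0..<1}. \<forall>s\<in>{0..<1}. \<bar>r - s\<bar> < \<delta> \<longrightarrow> \<bar>f r - f s\<bar> < \<epsilon>"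
proof -
  have "uniformly_continuous_on {0..1} (f \<circ> frac)"
    by (intro compact_uniformly_continuous continuous_on_subset[OF torus_continuous_imp_continuous_frac[OF assms(1)]]) auto
  then obtain \<delta> where "\<delta> > 0"
    and \<delta>: "\<And>r s. r \<in> {0..1} \<Longrightarrow> s \<in> {0..1} \<Longrightarrow> dist s r < \<delta> \<Longrightarrow> dist ((f \<circ> frac) s) ((f \<circ> frac) r) < \<epsilon>"
    unfolding uniformly_continuous_on_def using \<open>\<epsilon> > 0\<close> by metis
  have "\<bar>f r - f s\<bar> < \<epsilon>" if "r \<in> {0..<1}" "s \<in> {0..<1}" "\<bar>r - s\<bar> < \<delta>" for r s
    using \<delta>[of s r] that by (simp add: dist_real_def)
  then show ?thesis using \<open>\<delta> > 0\<close> by blast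
qed

lemma continuous_on_kernel_frac:
  assumes "interaction_kernel \<phi>"
  shows "continuous_on UNIV (\<lambda>z::real \<times> real. \<phi> (frac (fst z)) (frac (snd z)))"
proof -
  have "continuous_map (prod_topology torus.mtopology torus.mtopology) euclideanreal (\<lambda>(r, s). \<phi> r s)"
    using assms unfolding interaction_kernel_def by (auto dest: continuous_map_into_fulltopology)
  moreover have "continuous_map (prod_topology euclideanreal euclideanreal)
      (prod_topology torus.mtopology torus.mtopology) (\<lambda>z. (frac (fst z), frac (snd z)))"
    using continuous_map_compose[OF continuous_map_fst continuous_map_frac]
      continuous_map_compose[OF continuous_map_snd continuous_map_frac]
    by (intro continuous_map_pairedI) (simp_all only: comp_def)
  ultimately have "continuous_map (prod_topology euclideanreal euclideanreal) euclideanreal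
      ((\<lambda>(r, s). \<phi> r s) \<circ> (\<lambda>z. (frac (fst z), frac (snd z))))"
    by (rule continuous_map_compose[rotated])
  then show ?thesis by (simp add: comp_def euclidean_product_topology)
qed

lemma interaction_kernel_sym:
  assumes "interaction_kernel \<phi>" "r \<in> {0..<1}" "s \<in> {0..<1}"
  shows "\<phi> r s = \<phi> s r"
  using assms unfolding interaction_kernel_def by blast

lemma interaction_kernel_bounded:
  assumes "interaction_kernel \<phi>"
  shows "\<exists>B>0. \<forall>r\<in>{0..<1}. \<forall>s\<in>{0..<1}. \<bar>\<phi> r s\<bar> \<le> B"
proof -
  have "bounded ((\<lambda>z. \<phi> (frac (fst z)) (frac (snd z))) ` ({0..1} \<times> {0..1}))"
    by (intro compact_imp_bounded compact_continuous_image continuous_on_subset[OF continuous_on_kernel_frac[OF assms]]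
        compact_Times) auto
  then obtain B where B: "B > 0"
    "\<forall>x\<in>(\<lambda>z. \<phi> (frac (fst z)) (frac (snd z))) ` ({0..1} \<times> {0..1}). norm x \<le> B"
    unfolding bounded_pos by blast
  have "\<bar>\<phi> r s\<bar> \<le> B" if "r \<in> {0..<1}" "s \<in> {0..<1}" for r s
  proof -
    have "(r, s) \<in> {0..1} \<times> {0..1}" using that by auto
    from B(2)[rule_format, OF imageI[OF this]] show ?thesis
      using that by simp
  qed
  then show ?thesis using B(1) by blast
qed

lemma interaction_kernel_uniformly_continuous:
  assumes "interaction_kernel \<phi>" "\<epsilon> > 0"
  shows "\<exists>\<delta>>0. \<forall>r\<in>{0..<1}. \<forall>r'\<in>{0..<1}. \<forall>s\<in>{0..<1}. \<bar>r - r'\<bar> < \<delta> \<longrightarrow> \<bar>\<phi> s r - \<phi> s r'\<bar> < \<epsilon>"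
proof -
  have "uniformly_continuous_on ({0..1} \<times> {0..1}) (\<lambda>z. \<phi> (frac (fst z)) (frac (snd z)))"
    by (intro compact_uniformly_continuous continuous_on_subset[OF continuous_on_kernel_frac[OF assms(1)]]
        compact_Times) auto
  then obtain \<delta> where "\<delta> > 0"
    and \<delta>: "\<And>z z'. z \<in> {0..1} \<times> {0..1} \<Longrightarrow> z' \<in> {0..1} \<times> {0..1} \<Longrightarrow> dist z' z < \<delta> \<Longrightarrow>
       dist (\<phi> (frac (fst z')) (frac (snd z'))) (\<phi> (frac (fst z)) (frac (snd z))) < \<epsilon>"
    unfolding uniformly_continuous_on_def using \<open>\<epsilon> > 0\<close> by metis
  have "\<bar>\<phi> s r - \<phi> s r'\<bar> < \<epsilon>" if "r \<in> {0..<1}" "r' \<in> {0..<1}" "s \<in> {0..<1}" "\<bar>r - r'\<bar> < \<delta>" for r r' s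
    using \<delta>[of "(s, r')" "(s, r)"] that by (simp add: dist_real_def dist_Pair_Pair)
  then show ?thesis using \<open>\<delta> > 0\<close> by blast
qed

lemma borel_measurable_torus_continuous:
  assumes "continuous_map torus.mtopology euclideanreal f"
  shows "set_borel_measurable borel {0..<1} f"
proof -
  have "set_borel_measurable borel {0..<1} (f \<circ> frac)"
    unfolding set_borel_measurable_def using torus_continuous_imp_continuous_frac[OF assms]
    by (intro borel_measurable_scaleR borel_measurable_indicator borel_measurable_continuous_onI) auto
  then show ?thesis
    unfolding set_borel_measurable_def
    by (rule measurable_cong[THEN iffD1, rotated]) (auto simp: indicator_def)
qed

section \<open>Integrals over the torus and Riemann sums\<close>

text \<open>For convolutions and pairings: of the two factors under these integrals the first is only known
to be integrable, the second is bounded.\<close>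

lemma set_integrable_mult_bounded:
  fixes f w :: "real \<Rightarrow> real"
  assumes f: "set_integrable lborel A f" and "A \<in> sets borel"
    and w: "set_borel_measurable borel A w" and B: "\<And>x. x \<in> A \<Longrightarrow> \<bar>w x\<bar> \<le> B"
  shows "set_integrable lborel A (\<lambda>x. f x * w x)"
proof (rule set_integrable_bound[of _ _ "\<lambda>x. B * f x"])
  show "set_integrable lborel A (\<lambda>x. B * f x)" using f by simp
  have "(\<lambda>x. (indicator A x *\<^sub>R f x) * (indicator A x *\<^sub>R w x)) \<in> borel_measurable lborel"
    using f w unfolding set_integrable_def set_borel_measurable_def
    by (intro borel_measurable_times) (auto dest: borel_measurable_integrable)
  then show "set_borel_measurable lborel A (\<lambda>x. f x * w x)"
    unfolding set_borel_measurable_def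
    by (rule measurable_cong[THEN iffD1, rotated]) (auto simp: indicator_def)
  have "\<bar>f x\<bar> * \<bar>w x\<bar> \<le> \<bar>B\<bar> * \<bar>f x\<bar>" if "x \<in> A" for x
    using B[OF that] by (metis abs_ge_zero abs_ge_self mult.commute mult_right_mono order_trans)
  then show "AE x in lborel. x \<in> A \<longrightarrow> norm (f x * w x) \<le> norm (B * f x)"
    by (auto simp: abs_mult)
qed

lemma abs_set_integral_diff_le:
  fixes f g :: "real \<Rightarrow> real"
  assumes "set_integrable lborel {0..<1} f" "set_integrable lborel {0..<1} g"
    and "\<And>x. x \<in> {0..<1} \<Longrightarrow> \<bar>f x - g x\<bar> \<le> c"
  shows "\<bar>(LINT r:{0..<1}|lborel. f r) - (LINT r:{0..<1}|lborel. g r)\<bar> \<le> c"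
proof -
  have "(LINT r:{0..<1}|lborel. f r) - (LINT r:{0..<1}|lborel. g r) = (LINT r:{0..<1}|lborel. f r - g r)"
    using assms by (simp add: set_integral_diff)
  moreover have "norm (LINT r:{0..<1}|lborel. f r - g r) \<le> (LINT r:{0..<1}|lborel. \<bar>f r - g r\<bar>)"
    using set_integral_norm_bound[of lborel "{0..<1}" "\<lambda>r. f r - g r"] assms by simp
  moreover have "(LINT r:{0..<1}|lborel. \<bar>f r - g r\<bar>) \<le> (LINT r:{0..<1::real}|lborel. c)"
    using assms by (intro set_integral_mono set_integrable_abs set_integral_diff)
      (auto simp: set_integrable_def)
  moreover have "(LINT r:{0..<1::real}|lborel. c) = c"
    by (simp add: set_lebesgue_integral_def)
  ultimately show ?thesis by simp
qed

abbreviation site :: "nat \<Rightarrow> nat \<Rightarrow> real" where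
  "site N x \<equiv> real x / real N"

text \<open>Each of the \<open>N\<close> cells \<open>{k / N..<(k + 1) / N}\<close> contributes an error of at most \<open>\<epsilon> / N\<close>.\<close>

lemma riemann_sum_error:
  fixes h :: "real \<Rightarrow> real"
  assumes int: "set_integrable lborel {0..<1} h" and "N > 0"
    and osc: "\<And>r s. r \<in> {0..<1} \<Longrightarrow> s \<in> {0..<1} \<Longrightarrow> \<bar>r - s\<bar> \<le> 1 / real N \<Longrightarrow> \<bar>h r - h s\<bar> \<le> \<epsilon>"
  shows "\<bar>1 / real N * (\<Sum>x<N. h (site N x)) - (LINT r:{0..<1}|lborel. h r)\<bar> \<le> \<epsilon>"
proof -
  have "\<bar>1 / real N * (\<Sum>x<k. h (site N x)) - (LINT r:{0..<real k / real N}|lborel. h r)\<bar>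
          \<le> \<epsilon> * (real k / real N)" if "k \<le> N" for k
    using that
  proof (induction k)
    case 0
    then show ?case by (simp add: set_lebesgue_integral_def)
  next
    case (Suc k)
    let ?a = "real k / real N" and ?b = "real (Suc k) / real N"
    have ab: "0 \<le> ?a" "?a \<le> ?b" "?b \<le> 1" "?b - ?a = 1 / real N"
      using Suc.prems \<open>N > 0\<close> by (auto simp: field_simps)
    have sub: "{?a..<?b} \<subseteq> {0..<1}" "{0..<?a} \<subseteq> {0..<1}"
      by (intro ivl_subset[THEN iffD2] disjI2 conjI; use ab in linarith)+
    have i: "set_integrable lborel {?a..<?b} h" "set_integrable lborel {0..<?a} h"
      using set_integrable_subset[OF int _ sub(1)] set_integrable_subset[OF int _ sub(2)] by auto
    have c: "set_integrable lborel {?a..<?b} (\<lambda>_. h ?a)"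
      using ab by (auto simp: set_integrable_def)
    have split: "(LINT r:{0..<?b}|lborel. h r) = (LINT r:{0..<?a}|lborel. h r) + (LINT r:{?a..<?b}|lborel. h r)"
    proof -
      have "{0..<?b} = {0..<?a} \<union> {?a..<?b}"
        using ivl_disj_un_two(3)[OF ab(1,2)] by simp
      then show ?thesis using i by (simp add: set_integral_Un)
    qed
    have "(LINT r:{?a..<?b}|lborel. h r) - 1 / real N * h ?a = (LINT r:{?a..<?b}|lborel. h r - h ?a)"
    proof -
      have "(LINT r:{?a..<?b}|lborel. h ?a) = 1 / real N * h ?a"
        using ab by (simp add: set_lebesgue_integral_def)
      then show ?thesis using i c by (simp add: set_integral_diff)
    qed
    also have "norm \<dots> \<le> (LINT r:{?a..<?b}|lborel. \<bar>h r - h ?a\<bar>)"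
      using set_integral_norm_bound[of lborel "{?a..<?b}" "\<lambda>r. h r - h ?a"] i c by simp
    also have "\<dots> \<le> (LINT r:{?a..<?b}|lborel. \<epsilon>)"
    proof (rule set_integral_mono)
      show "set_integrable lborel {?a..<?b} (\<lambda>r. \<bar>h r - h ?a\<bar>)"
        using i c by (intro set_integrable_abs set_integral_diff)
      show "set_integrable lborel {?a..<?b} (\<lambda>_. \<epsilon>)"
        using ab by (auto simp: set_integrable_def)
      fix r assume r: "r \<in> {?a..<?b}"
      moreover have "?a \<in> {?a..<?b}" using r by (simp only: atLeastLessThan_iff) linarith
      ultimately have "r \<in> {0..<1}" "?a \<in> {0..<1}" using sub(1) by blast+
      moreover have "\<bar>r - ?a\<bar> \<le> 1 / real N" using r ab by (simp only: atLeastLessThan_iff) linarith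
      ultimately show "\<bar>h r - h ?a\<bar> \<le> \<epsilon>"
        by (rule osc)
    qed
    also have "\<dots> = \<epsilon> * (1 / real N)"
      using ab by (simp add: set_lebesgue_integral_def)
    finally have "\<bar>(LINT r:{?a..<?b}|lborel. h r) - 1 / real N * h ?a\<bar> \<le> \<epsilon> * (1 / real N)"
      by simp
    moreover have "\<epsilon> * ?b = \<epsilon> * ?a + \<epsilon> * (1 / real N)"
      by (simp add: field_simps add_divide_distrib)
    moreover have "1 / real N * (\<Sum>x<Suc k. h (site N x))
        = 1 / real N * (\<Sum>x<k. h (site N x)) + 1 / real N * h ?a"
      by (simp add: distrib_left)
    ultimately show ?case
      unfolding split using Suc.IH Suc.prems by linarith
  qed
  from this[of N] show ?thesis using \<open>N > 0\<close> by simp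
qed

section \<open>Markov processes on a finite state space\<close>

text \<open>Right-continuity gives rational times to the right of \<open>t\<close>, and there are none in the interval if \<open>t\<close> is its
right endpoint; so the endpoint is added.\<close>

lemma right_continuous_exceeds_on_countable:
  fixes y :: "real \<Rightarrow> real"
  assumes rc: "\<And>t. t \<in> {a..<b} \<Longrightarrow> continuous (at_right t) y"
    and t: "t \<in> {a..b}" "c < y t"
  shows "\<exists>t'\<in>insert b ({a..b} \<inter> \<rat>). c < y t'"
proof (cases "t = b")
  case False
  then have "t < b" "t \<in> {a..<b}" using t by auto
  have "(y \<longlongrightarrow> y t) (at_right t)"
    using rc[OF \<open>t \<in> {a..<b}\<close>] by (simp add: continuous_within)
  then have "\<forall>\<^sub>F x in at_right t. c < y x"
    using t(2) by (rule order_tendstoD)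
  then obtain d where d: "t < d" "\<And>x. t < x \<Longrightarrow> x < d \<Longrightarrow> c < y x"
    using eventually_at_right[of t "t + 1"] by auto
  obtain q where "q \<in> \<rat>" "t < q" "q < min d b"
    using Rats_dense_in_real[of t "min d b"] d \<open>t < b\<close> by auto
  then show ?thesis using d t by (intro bexI[of _ q]) auto
qed (use t in auto)

text \<open>The bound on \<open>L\<close> refers to the supremum norm on \<open>S\<close>. It makes the series for \<open>exp (t L)\<close> converge for
every \<open>t\<close>.\<close>

locale finite_state_markov = prob_space M
  for M :: "'w measure" and S :: "'s::t2_space set" and L :: "('s \<Rightarrow> real) \<Rightarrow> 's \<Rightarrow> real"
    and X :: "real \<Rightarrow> 'w \<Rightarrow> 's" and K :: real +
  assumes finite_S: "finite S"
    and generator_bound: "\<And>f x C. x \<in> S \<Longrightarrow> (\<And>y. y \<in> S \<Longrightarrow> \<bar>f y\<bar> \<le> C) \<Longrightarrow> \<bar>L f x\<bar> \<le> K * C"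
    and markov: "markov_process_with_generator M S L X"
begin

text \<open>The semigroup is a power series in \<open>t\<close> with coefficients \<open>L\<^sup>n f x / n!\<close>, bounded by those of \<open>C exp (|K| t)\<close>;
it may be differentiated term by term.\<close>

lemma semigroup_has_derivative:
  assumes "x \<in> S"
  shows "((\<lambda>t. semigroup_of L t f x) has_real_derivative semigroup_of L t (L f) x) (at t)"
proof -
  obtain C where C: "\<And>y. y \<in> S \<Longrightarrow> \<bar>f y\<bar> \<le> C"
    using finite_S by (meson bdd_above_finite bdd_above.E finite_imageI imageI)
  have iter: "y \<in> S \<Longrightarrow> \<bar>(L ^^ n) f y\<bar> \<le> K ^ n * C" for n y
  proof (induction n arbitrary: y)
    case (Suc n)
    then show ?case using generator_bound[of y "(L ^^ n) f" "K ^ n * C"] by simp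
  qed (use C in auto)
  let ?c = "\<lambda>n. (L ^^ n) f x / fact n"
  have "summable (\<lambda>n. ?c n * y ^ n)" for y
  proof (rule summable_comparison_test')
    show "summable (\<lambda>n. C * (inverse (fact n) * (\<bar>K\<bar> * \<bar>y\<bar>) ^ n))"
      by (intro summable_mult summable_exp)
    fix n
    have "K ^ n * C \<le> \<bar>K\<bar> ^ n * C"
    proof -
      have "0 \<le> C" using C[OF assms] by linarith
      moreover have "K ^ n \<le> \<bar>K\<bar> ^ n" by (metis abs_ge_self power_abs)
      ultimately show ?thesis by (simp add: mult_right_mono)
    qed
    then have "\<bar>(L ^^ n) f x\<bar> \<le> \<bar>K\<bar> ^ n * C"
      using iter[OF assms, of n] by linarith
    then have "\<bar>(L ^^ n) f x\<bar> * (\<bar>y\<bar> ^ n / fact n) \<le> \<bar>K\<bar> ^ n * C * (\<bar>y\<bar> ^ n / fact n)"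
      by (intro mult_right_mono) auto
    then show "norm (?c n * y ^ n) \<le> C * (inverse (fact n) * (\<bar>K\<bar> * \<bar>y\<bar>) ^ n)"
      by (simp add: abs_mult power_abs power_mult_distrib field_simps)
  qed
  then have "((\<lambda>t. \<Sum>n. ?c n * t ^ n) has_field_derivative (\<Sum>n. diffs ?c n * t ^ n)) (at t)"
    by (rule termdiffs_strong_converges_everywhere)
  moreover have "diffs ?c n = (L ^^ n) (L f) x / fact n" for n
    by (simp add: diffs_def funpow_swap1 field_simps del: of_nat_Suc)
  ultimately show ?thesis
    by (simp add: semigroup_of_def mult.commute)
qed

lemma X_measurable: "0 \<le> t \<Longrightarrow> X t \<in> M \<rightarrow>\<^sub>M count_space S"
  using markov unfolding markov_process_with_generator_def by blast

lemma X_in_S: "0 \<le> t \<Longrightarrow> \<omega> \<in> space M \<Longrightarrow> X t \<omega> \<in> S"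
  using measurable_space[OF X_measurable] by auto

lemma borel_measurable_fun_X: "0 \<le> t \<Longrightarrow> (\<lambda>\<omega>. f (X t \<omega>) :: real) \<in> borel_measurable M"
  using measurable_compose[OF X_measurable, of t f borel] by simp

lemma bounded_on_S:
  fixes f :: "'s \<Rightarrow> real"
  obtains B where "\<And>y. y \<in> S \<Longrightarrow> \<bar>f y\<bar> \<le> B" "B \<ge> 0"
proof
  show "\<bar>f y\<bar> \<le> (\<Sum>y\<in>S. \<bar>f y\<bar>)" if "y \<in> S" for y
    using that finite_S by (auto intro!: member_le_sum)
  show "0 \<le> (\<Sum>y\<in>S. \<bar>f y\<bar>)" by (rule sum_nonneg) auto
qed

lemma integrable_fun_X:
  assumes "0 \<le> t" shows "integrable M (\<lambda>\<omega>. f (X t \<omega>) :: real)"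
proof -
  obtain B where "\<And>y. y \<in> S \<Longrightarrow> \<bar>f y\<bar> \<le> B" by (rule bounded_on_S[of f]) blast
  then show ?thesis
    using X_in_S[OF assms] by (intro integrable_const_bound[of _ B] AE_I2 borel_measurable_fun_X assms) auto
qed

lemma integrable_indicator_fun_X:
  assumes "0 \<le> t" "A \<in> sets M" shows "integrable M (\<lambda>\<omega>. indicator A \<omega> * f (X t \<omega>) :: real)"
  using integrable_mult_indicator[OF assms(2) integrable_fun_X[OF assms(1), of f]] by simp

abbreviation past :: "real \<Rightarrow> 'w set set" where
  "past s \<equiv> sets (natural_filtration M S X s)"

lemma past_generators_closed:
  "{X r -` A \<inter> space M | r A. 0 \<le> r \<and> r \<le> s \<and> A \<subseteq> S} \<subseteq> Pow (space M)"
  by auto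

lemma space_past [simp]: "space (natural_filtration M S X s) = space M"
  unfolding natural_filtration_def by (rule space_measure_of) auto

lemma past_subalgebra: "subalgebra M (natural_filtration M S X s)"
proof -
  have "sigma_sets (space M) {X r -` A \<inter> space M | r A. 0 \<le> r \<and> r \<le> s \<and> A \<subseteq> S} \<subseteq> sets M"
  proof (rule sets.sigma_sets_subset, safe)
    fix r :: real and A assume "0 \<le> r" "A \<subseteq> S"
    then show "X r -` A \<inter> space M \<in> sets M"
      using measurable_sets[OF X_measurable] by auto
  qed
  then show ?thesis
    unfolding subalgebra_def natural_filtration_def
    by (simp add: sets_measure_of[OF past_generators_closed] space_measure_of[OF past_generators_closed])
qed

lemma past_subset: "A \<in> past s \<Longrightarrow> A \<in> sets M"
  using past_subalgebra unfolding subalgebra_def by auto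

lemma vimage_in_past:
  assumes "0 \<le> r" "r \<le> s"
  shows "{\<omega> \<in> space M. P (X r \<omega>)} \<in> past s"
proof -
  have "{\<omega> \<in> space M. P (X r \<omega>)} = X r -` {y\<in>S. P y} \<inter> space M"
    using X_in_S[OF assms(1)] by auto
  moreover have "X r -` {y\<in>S. P y} \<inter> space M \<in> past s"
    unfolding natural_filtration_def sets_measure_of[OF past_generators_closed]
    using assms by (intro sigma_sets.Basic CollectI exI[of _ r] exI[of _ "{y\<in>S. P y}"]) auto
  ultimately show ?thesis by simp
qed

lemma vimage2_in_past:
  assumes "0 \<le> r" "r \<le> s" "0 \<le> r'" "r' \<le> s"
  shows "{\<omega> \<in> space M. P (X r \<omega>) (X r' \<omega>)} \<in> past s"
proof -
  have "{\<omega> \<in> space M. P (X r \<omega>) (X r' \<omega>)}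
      = (\<Union>x\<in>S. {\<omega> \<in> space M. X r \<omega> = x} \<inter> {\<omega> \<in> space M. P x (X r' \<omega>)})"
    using X_in_S[OF assms(1)] by auto
  then show ?thesis
    using finite_S assms by (auto intro!: sets.finite_UN sets.Int vimage_in_past)
qed

text \<open>The point of this form of the Markov property is that \<open>h\<close> occurs only in the semigroup, inside a
finite sum, so that the left-hand side can be differentiated in \<open>h\<close>.\<close>

lemma expectation_indicator_semigroup:
  assumes s: "0 \<le> s" and A: "A \<in> past s" and h: "0 \<le> h"
  shows "expectation (\<lambda>\<omega>. indicator A \<omega> * f (X (s + h) \<omega>))
       = (\<Sum>x\<in>S. prob (A \<inter> {\<omega>\<in>space M. X s \<omega> = x}) * semigroup_of L h f x)"
proof -
  interpret F: finite_measure_subalgebra M "natural_filtration M S X s"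
    by unfold_locales (rule past_subalgebra)
  have [measurable]: "A \<in> sets M" using A by (rule past_subset)
  let ?g = "\<lambda>x. semigroup_of L h f x"
  let ?C = "real_cond_exp M (natural_filtration M S X s) (\<lambda>\<omega>. f (X (s + h) \<omega>))"
  have "expectation (\<lambda>\<omega>. indicator A \<omega> * f (X (s + h) \<omega>)) = expectation (\<lambda>\<omega>. indicator A \<omega> * ?C \<omega>)"
    using F.real_cond_exp_intA[OF integrable_fun_X A, of "s + h" f] s h
    by (simp add: set_lebesgue_integral_def)
  also have "\<dots> = expectation (\<lambda>\<omega>. indicator A \<omega> * ?g (X s \<omega>))"
  proof (rule integral_cong_AE)
    have "0 \<le> s \<longrightarrow> s \<le> s + h \<longrightarrow> (AE \<omega> in M. ?C \<omega> = semigroup_of L ((s + h) - s) f (X s \<omega>))"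
      using markov unfolding markov_process_with_generator_def by blast
    then show "AE \<omega> in M. indicator A \<omega> * ?C \<omega> = indicator A \<omega> * ?g (X s \<omega>)"
      using s h by auto
    show "(\<lambda>\<omega>. indicator A \<omega> * ?C \<omega>) \<in> borel_measurable M"
      using borel_measurable_cond_exp2 by measurable
    show "(\<lambda>\<omega>. indicator A \<omega> * ?g (X s \<omega>)) \<in> borel_measurable M"
      using borel_measurable_fun_X[OF s, of ?g] by measurable
  qed
  also have "\<dots> = expectation (\<lambda>\<omega>. \<Sum>x\<in>S. indicator (A \<inter> {\<omega>\<in>space M. X s \<omega> = x}) \<omega> * ?g x)"
  proof (rule Bochner_Integration.integral_cong[OF refl])
    fix \<omega> assume "\<omega> \<in> space M"
    then have "(\<Sum>x\<in>S. indicator (A \<inter> {\<omega>\<in>space M. X s \<omega> = x}) \<omega> * ?g x)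
        = (\<Sum>x\<in>S. if X s \<omega> = x then indicator A \<omega> * ?g x else 0)"
      by (intro sum.cong refl) (auto simp: indicator_def)
    then show "indicator A \<omega> * ?g (X s \<omega>) = (\<Sum>x\<in>S. indicator (A \<inter> {\<omega>\<in>space M. X s \<omega> = x}) \<omega> * ?g x)"
      using X_in_S[OF s \<open>\<omega> \<in> space M\<close>] finite_S by simp
  qed
  also have "\<dots> = (\<Sum>x\<in>S. prob (A \<inter> {\<omega>\<in>space M. X s \<omega> = x}) * ?g x)"
  proof -
    have ev: "A \<inter> {\<omega>\<in>space M. X s \<omega> = x} \<in> sets M" for x
      using past_subset[OF vimage_in_past[OF s order_refl, of "\<lambda>y. y = x"]] by auto
    have "expectation (\<lambda>\<omega>. \<Sum>x\<in>S. indicator (A \<inter> {\<omega>\<in>space M. X s \<omega> = x}) \<omega> * ?g x)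
        = (\<Sum>x\<in>S. expectation (\<lambda>\<omega>. indicator (A \<inter> {\<omega>\<in>space M. X s \<omega> = x}) \<omega> * ?g x))"
      using ev by (intro Bochner_Integration.integral_sum) (auto intro!: integrable_real_indicator simp: emeasure_eq_measure)
    then show ?thesis using ev by simp
  qed
  finally show ?thesis .
qed

text \<open>Dynkin's formula in differential form. The event \<open>A\<close> of the past makes it possible to start the estimates anew
at the time of a first passage.\<close>

lemma dynkin_on_event:
  assumes s: "0 \<le> s" and A: "A \<in> past s" and h: "0 \<le> h"
  shows "((\<lambda>h. expectation (\<lambda>\<omega>. indicator A \<omega> * f (X (s + h) \<omega>))) has_real_derivative
           expectation (\<lambda>\<omega>. indicator A \<omega> * L f (X (s + h) \<omega>))) (at h within {0..})"
proof -
  let ?p = "\<lambda>x. prob (A \<inter> {\<omega>\<in>space M. X s \<omega> = x})"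
  have "((\<lambda>h. \<Sum>x\<in>S. ?p x * semigroup_of L h f x) has_real_derivative
      (\<Sum>x\<in>S. ?p x * semigroup_of L h (L f) x)) (at h within {0..})"
    by (intro DERIV_sum DERIV_cmult has_field_derivative_at_within[OF semigroup_has_derivative])
  then have "((\<lambda>h. expectation (\<lambda>\<omega>. indicator A \<omega> * f (X (s + h) \<omega>))) has_real_derivative
      (\<Sum>x\<in>S. ?p x * semigroup_of L h (L f) x)) (at h within {0..})"
    unfolding has_field_derivative_def
    by (rule has_derivative_transform[rotated 2]) (use h expectation_indicator_semigroup[OF s A] in auto)
  then show ?thesis
    using expectation_indicator_semigroup[OF s A h, of "L f"] by simp
qed

lemma dynkin:
  assumes "0 \<le> t"
  shows "((\<lambda>t. expectation (\<lambda>\<omega>. f (X t \<omega>))) has_real_derivative expectation (\<lambda>\<omega>. L f (X t \<omega>)))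
           (at t within {0..})"
proof -
  have "space M \<in> past 0" using sets.top[of "natural_filtration M S X 0"] by simp
  moreover have "expectation (\<lambda>\<omega>. indicator (space M) \<omega> * g (X t \<omega>)) = expectation (\<lambda>\<omega>. g (X t \<omega>))" for g :: "'s \<Rightarrow> real" and t
    by (rule Bochner_Integration.integral_cong) auto
  ultimately show ?thesis
    using dynkin_on_event[of 0 "space M" t f] assms by simp
qed

lemma chebyshev_on_event:
  assumes "0 \<le> s" "0 \<le> t" "A \<in> sets M" "\<epsilon> > 0"
    and le: "expectation (\<lambda>\<omega>. indicator A \<omega> * (f (X t \<omega>) - f (X s \<omega>))\<^sup>2) \<le> c"
  shows "prob (A \<inter> {\<omega>\<in>space M. \<epsilon> < \<bar>f (X t \<omega>) - f (X s \<omega>)\<bar>}) \<le> c / \<epsilon>\<^sup>2" (is "prob ?E \<le> _")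
proof -
  note [measurable] = borel_measurable_fun_X[OF assms(1), of f] borel_measurable_fun_X[OF assms(2), of f] assms(3)
  obtain B where B: "\<And>y. y \<in> S \<Longrightarrow> \<bar>f y\<bar> \<le> B" by (rule bounded_on_S[of f]) blast
  have E: "?E \<in> sets M" by measurable
  have "prob ?E * \<epsilon>\<^sup>2 = expectation (\<lambda>\<omega>. indicator ?E \<omega> * \<epsilon>\<^sup>2)" using E by simp
  also have "\<dots> \<le> expectation (\<lambda>\<omega>. indicator A \<omega> * (f (X t \<omega>) - f (X s \<omega>))\<^sup>2)"
  proof (rule integral_mono)
    show "integrable M (\<lambda>\<omega>. indicator ?E \<omega> * \<epsilon>\<^sup>2)"
      using E by (auto intro!: integrable_real_indicator simp: emeasure_eq_measure)
    show "integrable M (\<lambda>\<omega>. indicator A \<omega> * (f (X t \<omega>) - f (X s \<omega>))\<^sup>2)"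
    proof (rule integrable_const_bound[of _ "(2 * B)\<^sup>2"])
      have "\<bar>f (X t \<omega>) - f (X s \<omega>)\<bar> \<le> 2 * B" if "\<omega> \<in> space M" for \<omega>
        using B[OF X_in_S[OF assms(1) that]] B[OF X_in_S[OF assms(2) that]] by linarith
      then have "(f (X t \<omega>) - f (X s \<omega>))\<^sup>2 \<le> (2 * B)\<^sup>2" if "\<omega> \<in> space M" for \<omega>
        using that by (metis abs_ge_zero power2_abs power_mono)
      then show "AE \<omega> in M. norm (indicator A \<omega> * (f (X t \<omega>) - f (X s \<omega>))\<^sup>2) \<le> (2 * B)\<^sup>2"
        by (intro AE_I2) (auto simp: indicator_def)
    qed measurable
    show "indicator ?E \<omega> * \<epsilon>\<^sup>2 \<le> indicator A \<omega> * (f (X t \<omega>) - f (X s \<omega>))\<^sup>2" for \<omega>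
    proof (cases "\<omega> \<in> ?E")
      case True
      then have "\<epsilon>\<^sup>2 \<le> \<bar>f (X t \<omega>) - f (X s \<omega>)\<bar>\<^sup>2" using \<open>\<epsilon> > 0\<close> by (intro power_mono) auto
      then show ?thesis using True by simp
    next
      case False
      show ?thesis unfolding indicator_simps(2)[OF False] by simp
    qed
  qed
  finally have "prob ?E * \<epsilon>\<^sup>2 \<le> c" using le by simp
  then show ?thesis using \<open>\<epsilon> > 0\<close> by (simp add: field_simps)
qed

end

text \<open>The difference of the two sides is \<open>(d - a \<delta>)\<^sup>2 / \<delta>\<close>.\<close>

lemma young_with_scale: "0 < \<delta> \<Longrightarrow> 2 * a * d \<le> d\<^sup>2 / \<delta> + a\<^sup>2 * \<delta>" for a d \<delta> :: real
proof -
  assume "0 < \<delta>"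
  then have "d\<^sup>2 / \<delta> + a\<^sup>2 * \<delta> - 2 * a * d = (d - a * \<delta>)\<^sup>2 / \<delta>"
    by (simp add: power2_eq_square field_simps)
  moreover have "0 \<le> (d - a * \<delta>)\<^sup>2 / \<delta>" using \<open>0 < \<delta>\<close> by simp
  ultimately show ?thesis by linarith
qed

text \<open>Here \<open>\<Lambda>\<close> stands for a bound on the drift \<open>L f\<close> and \<open>\<Gamma>\<close> for a bound on the square field
\<open>L f\<^sup>2 - 2 f (L f)\<close>, the rate at which the noise in \<open>f\<close> accumulates variance.\<close>

locale finite_state_markov_increments = finite_state_markov M S L X K
  for M :: "'w measure" and S :: "'s::t2_space set" and L X K +
  fixes f :: "'s \<Rightarrow> real" and \<Lambda> \<Gamma> :: real
  assumes increment_bound: "\<And>x a. x \<in> S \<Longrightarrow> L (\<lambda>y. (f y - a)\<^sup>2) x \<le> 2 * \<Lambda> * \<bar>f x - a\<bar> + \<Gamma>"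
    and nonneg: "0 \<le> \<Lambda>" "0 \<le> \<Gamma>"
begin

text \<open>If the state at time \<open>s\<close> is fixed, the squared increment is a function of the current state and Dynkin's
formula applies to it. The term linear in the increment is split by Young's inequality at the scale \<open>\<delta>\<close> of the
window: the Gronwall factor \<open>exp (h / \<delta>)\<close> then stays bounded, and the drift contributes only at order \<open>\<delta>\<^sup>2\<close>.
A bound of order \<open>\<delta>\<close> would not do, since \<open>T / \<delta>\<close> windows are going to be summed.\<close>

lemma square_increment_from_state:
  assumes s: "0 \<le> s" and A: "A \<in> past s" and x: "\<And>\<omega>. \<omega> \<in> A \<Longrightarrow> X s \<omega> = x"
    and "\<delta> > 0" "0 \<le> h" "h \<le> \<delta>"
  shows "expectation (\<lambda>\<omega>. indicator A \<omega> * (f (X (s + h) \<omega>) - f x)\<^sup>2)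
           \<le> 2 * \<delta> * (\<Lambda>\<^sup>2 * \<delta> + \<Gamma>) * prob A"
proof -
  have A': "A \<in> sets M" using A by (rule past_subset)
  let ?g = "\<lambda>h. expectation (\<lambda>\<omega>. indicator A \<omega> * (f (X (s + h) \<omega>) - f x)\<^sup>2)"
  let ?c = "(\<Lambda>\<^sup>2 * \<delta> + \<Gamma>) * prob A"
  have "?g h \<le> (?g 0 + ?c / (1 / \<delta>)) * exp (1 / \<delta> * h) - ?c / (1 / \<delta>)"
  proof (rule gronwall_differential[of \<delta> ?g "\<lambda>h. expectation (\<lambda>\<omega>. indicator A \<omega> * L (\<lambda>y. (f y - f x)\<^sup>2) (X (s + h) \<omega>))"])
    fix h assume h: "0 \<le> h" "h \<le> \<delta>"
    then show "(?g has_real_derivative expectation (\<lambda>\<omega>. indicator A \<omega> * L (\<lambda>y. (f y - f x)\<^sup>2) (X (s + h) \<omega>)))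
        (at h within {0..})"
      using dynkin_on_event[OF s A, of h "\<lambda>y. (f y - f x)\<^sup>2"] by simp
    have "expectation (\<lambda>\<omega>. indicator A \<omega> * L (\<lambda>y. (f y - f x)\<^sup>2) (X (s + h) \<omega>))
        \<le> expectation (\<lambda>\<omega>. indicator A \<omega> * (1 / \<delta> * (f (X (s + h) \<omega>) - f x)\<^sup>2 + (\<Lambda>\<^sup>2 * \<delta> + \<Gamma>)))"
    proof (rule integral_mono)
      show "integrable M (\<lambda>\<omega>. indicator A \<omega> * L (\<lambda>y. (f y - f x)\<^sup>2) (X (s + h) \<omega>))"
        using s h A' by (intro integrable_indicator_fun_X) auto
      show "integrable M (\<lambda>\<omega>. indicator A \<omega> * (1 / \<delta> * (f (X (s + h) \<omega>) - f x)\<^sup>2 + (\<Lambda>\<^sup>2 * \<delta> + \<Gamma>)))"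
        using integrable_indicator_fun_X[of "s + h" A "\<lambda>y. 1 / \<delta> * (f y - f x)\<^sup>2 + (\<Lambda>\<^sup>2 * \<delta> + \<Gamma>)"] s h A' by simp
      fix \<omega> assume "\<omega> \<in> space M"
      let ?d = "\<bar>f (X (s + h) \<omega>) - f x\<bar>"
      have "L (\<lambda>y. (f y - f x)\<^sup>2) (X (s + h) \<omega>) \<le> 2 * \<Lambda> * ?d + \<Gamma>"
        using increment_bound[OF X_in_S[of "s + h" \<omega>]] s h \<open>\<omega> \<in> space M\<close> by auto
      also have "2 * \<Lambda> * ?d \<le> ?d\<^sup>2 / \<delta> + \<Lambda>\<^sup>2 * \<delta>"
        by (rule young_with_scale[OF \<open>\<delta> > 0\<close>])
      finally have "L (\<lambda>y. (f y - f x)\<^sup>2) (X (s + h) \<omega>) \<le> 1 / \<delta> * (f (X (s + h) \<omega>) - f x)\<^sup>2 + (\<Lambda>\<^sup>2 * \<delta> + \<Gamma>)"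
        by simp
      then show "indicator A \<omega> * L (\<lambda>y. (f y - f x)\<^sup>2) (X (s + h) \<omega>)
          \<le> indicator A \<omega> * (1 / \<delta> * (f (X (s + h) \<omega>) - f x)\<^sup>2 + (\<Lambda>\<^sup>2 * \<delta> + \<Gamma>))"
        by (simp add: mult_left_mono)
    qed
    also have "\<dots> = expectation (\<lambda>\<omega>. 1 / \<delta> * (indicator A \<omega> * (f (X (s + h) \<omega>) - f x)\<^sup>2) + indicator A \<omega> * (\<Lambda>\<^sup>2 * \<delta> + \<Gamma>))"
      by (rule Bochner_Integration.integral_cong) (auto simp: algebra_simps)
    also have "\<dots> = expectation (\<lambda>\<omega>. 1 / \<delta> * (indicator A \<omega> * (f (X (s + h) \<omega>) - f x)\<^sup>2))
        + expectation (\<lambda>\<omega>. indicator A \<omega> * (\<Lambda>\<^sup>2 * \<delta> + \<Gamma>))"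
      using s h A' integrable_indicator_fun_X[of "s + h" A "\<lambda>y. (f y - f x)\<^sup>2"]
        integrable_indicator_fun_X[of "s + h" A "\<lambda>y. (\<Lambda>\<^sup>2 * \<delta> + \<Gamma>)"]
      by (intro Bochner_Integration.integral_add integrable_mult_right) auto
    also have "\<dots> = 1 / \<delta> * ?g h + ?c"
      using A' by (simp add: mult.commute)
    finally show "expectation (\<lambda>\<omega>. indicator A \<omega> * L (\<lambda>y. (f y - f x)\<^sup>2) (X (s + h) \<omega>)) \<le> 1 / \<delta> * ?g h + ?c" .
  qed (use \<open>\<delta> > 0\<close> \<open>0 \<le> h\<close> \<open>h \<le> \<delta>\<close> in simp_all)
  moreover have "?g 0 = 0"
  proof -
    have "?g 0 = expectation (\<lambda>\<omega>. 0)"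
      by (rule Bochner_Integration.integral_cong) (auto simp: indicator_def x)
    then show ?thesis by simp
  qed
  ultimately have "?g h \<le> (?c * \<delta>) * (exp (h / \<delta>) - 1)"
    by (simp add: algebra_simps)
  also have "\<dots> \<le> (?c * \<delta>) * 2"
  proof (rule mult_left_mono)
    have "exp (h / \<delta>) \<le> exp 1" using \<open>h \<le> \<delta>\<close> \<open>\<delta> > 0\<close> by simp
    then show "exp (h / \<delta>) - 1 \<le> 2" using exp_le by linarith
    show "0 \<le> ?c * \<delta>"
      by (intro mult_nonneg_nonneg add_nonneg_nonneg) (use nonneg \<open>\<delta> > 0\<close> in simp_all)
  qed
  finally show ?thesis by (simp add: algebra_simps)
qed

text \<open>The event \<open>A\<close> is decomposed according to the state at time \<open>s\<close>.\<close>

lemma square_increment: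
  assumes s: "0 \<le> s" and A: "A \<in> past s" and \<delta>: "\<delta> > 0" "0 \<le> h" "h \<le> \<delta>"
  shows "expectation (\<lambda>\<omega>. indicator A \<omega> * (f (X (s + h) \<omega>) - f (X s \<omega>))\<^sup>2)
           \<le> 2 * \<delta> * (\<Lambda>\<^sup>2 * \<delta> + \<Gamma>) * prob A"
proof -
  let ?A = "\<lambda>x. A \<inter> {\<omega>\<in>space M. X s \<omega> = x}"
  have past: "?A x \<in> past s" for x
    using A vimage_in_past[OF s order_refl, of "\<lambda>y. y = x"] by auto
  have "A \<subseteq> space M" using sets.sets_into_space[OF past_subset[OF A]] .
  have "expectation (\<lambda>\<omega>. indicator A \<omega> * (f (X (s + h) \<omega>) - f (X s \<omega>))\<^sup>2)
      = expectation (\<lambda>\<omega>. \<Sum>x\<in>S. indicator (?A x) \<omega> * (f (X (s + h) \<omega>) - f x)\<^sup>2)"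
  proof (rule Bochner_Integration.integral_cong[OF refl])
    fix \<omega> assume "\<omega> \<in> space M"
    then have "(\<Sum>x\<in>S. indicator (?A x) \<omega> * (f (X (s + h) \<omega>) - f x)\<^sup>2)
        = (\<Sum>x\<in>S. if X s \<omega> = x then indicator A \<omega> * (f (X (s + h) \<omega>) - f x)\<^sup>2 else 0)"
      by (intro sum.cong refl) (auto simp: indicator_def)
    then show "indicator A \<omega> * (f (X (s + h) \<omega>) - f (X s \<omega>))\<^sup>2
        = (\<Sum>x\<in>S. indicator (?A x) \<omega> * (f (X (s + h) \<omega>) - f x)\<^sup>2)"
      using X_in_S[OF s \<open>\<omega> \<in> space M\<close>] finite_S by simp
  qed
  also have "\<dots> = (\<Sum>x\<in>S. expectation (\<lambda>\<omega>. indicator (?A x) \<omega> * (f (X (s + h) \<omega>) - f x)\<^sup>2))"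
    using s \<delta> past_subset[OF past]
    by (intro Bochner_Integration.integral_sum integrable_indicator_fun_X[where f = "\<lambda>y. (f y - f _)\<^sup>2"]) auto
  also have "\<dots> \<le> (\<Sum>x\<in>S. 2 * \<delta> * (\<Lambda>\<^sup>2 * \<delta> + \<Gamma>) * prob (?A x))"
    by (intro sum_mono square_increment_from_state[OF s past _ \<delta>]) auto
  also have "\<dots> = 2 * \<delta> * (\<Lambda>\<^sup>2 * \<delta> + \<Gamma>) * prob (\<Union>x\<in>S. ?A x)"
    unfolding sum_distrib_left[symmetric]
    using finite_S past_subset[OF past]
    by (subst finite_measure_finite_Union) (auto simp: disjoint_family_on_def)
  also have "(\<Union>x\<in>S. ?A x) = A"
    using X_in_S[OF s] \<open>A \<subseteq> space M\<close> by auto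
  finally show ?thesis .
qed

text \<open>Ottaviani's argument. Let \<open>t\<close> be the first time in \<open>D\<close> at which the process is more than \<open>2 \<epsilon>\<close> away from its value
at time \<open>s\<close>; this is the event \<open>B t\<close>, which belongs to the past of \<open>t\<close>. Then either the process is
still more than \<open>\<epsilon>\<close> away at the end of the window, or it moves by more than \<open>\<epsilon>\<close> between \<open>t\<close> and the end.
Both are unlikely by the bound on increments, the second one conditionally on each of the disjoint
events \<open>B t\<close>.\<close>

lemma oscillation_finite:
  assumes s: "0 \<le> s" and "\<delta> > 0" "\<epsilon> > 0" and D: "finite D" "D \<subseteq> {s..s + \<delta>}"
  shows "prob {\<omega>\<in>space M. \<exists>t\<in>D. 2 * \<epsilon> < \<bar>f (X t \<omega>) - f (X s \<omega>)\<bar>}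
           \<le> 4 * \<delta> * (\<Lambda>\<^sup>2 * \<delta> + \<Gamma>) / \<epsilon>\<^sup>2"
proof -
  define c where "c = 2 * \<delta> * (\<Lambda>\<^sup>2 * \<delta> + \<Gamma>)"
  have "c \<ge> 0" unfolding c_def
    by (intro mult_nonneg_nonneg add_nonneg_nonneg) (use nonneg \<open>\<delta> > 0\<close> in simp_all)
  define Y where "Y t \<omega> = \<bar>f (X t \<omega>) - f (X s \<omega>)\<bar>" for t \<omega>
  define B where "B t = {\<omega>\<in>space M. 2 * \<epsilon> < Y t \<omega>} \<inter> (\<Inter>r\<in>insert t {r\<in>D. r < t}. {\<omega>\<in>space M. r < t \<longrightarrow> Y r \<omega> \<le> 2 * \<epsilon>})" for t
  have Dge: "s \<le> t \<and> t \<le> s + \<delta>" if "t \<in> D" for t using D that by auto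
  have B: "B t \<in> past t" if "t \<in> D" for t
    unfolding B_def Y_def
  proof (intro sets.Int sets.finite_INT)
    show "{\<omega> \<in> space M. 2 * \<epsilon> < \<bar>f (X t \<omega>) - f (X s \<omega>)\<bar>} \<in> past t"
      by (rule vimage2_in_past[where P = "\<lambda>x y. 2 * \<epsilon> < \<bar>f x - f y\<bar>"])
        (use s Dge[OF that] in simp_all)
    show "{\<omega> \<in> space M. r < t \<longrightarrow> \<bar>f (X r \<omega>) - f (X s \<omega>)\<bar> \<le> 2 * \<epsilon>} \<in> past t"
      if "r \<in> insert t {r \<in> D. r < t}" for r
    proof (rule vimage2_in_past[where P = "\<lambda>x y. r < t \<longrightarrow> \<bar>f x - f y\<bar> \<le> 2 * \<epsilon>"])
      show "0 \<le> r" "r \<le> t" using that Dge[of r] Dge[OF \<open>t \<in> D\<close>] s by auto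
    qed (use s Dge[OF \<open>t \<in> D\<close>] in simp_all)
  qed (use D in auto)
  then have B': "B t \<in> sets M" if "t \<in> D" for t using that past_subset by blast
  define G where "G t = {\<omega>\<in>space M. \<epsilon> < \<bar>f (X (s + \<delta>) \<omega>) - f (X t \<omega>)\<bar>}" for t
  have G: "G t \<in> sets M" if "0 \<le> t" for t
  proof -
    have [measurable]: "(\<lambda>\<omega>. f (X t \<omega>)) \<in> borel_measurable M" "(\<lambda>\<omega>. f (X (s + \<delta>) \<omega>)) \<in> borel_measurable M"
      using borel_measurable_fun_X that s \<open>\<delta> > 0\<close> by simp_all
    show ?thesis unfolding G_def by measurable
  qed
  have BG: "B t \<inter> G t \<in> sets M" if "t \<in> D" for t
    using B'[OF that] G[of t] Dge[OF that] s by auto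
  have disj: "disjoint_family_on B D"
    unfolding disjoint_family_on_def
  proof (intro ballI impI)
    fix t t' assume t: "t \<in> D" "t' \<in> D" "t \<noteq> t'"
    have *: "B t \<inter> B t' = {}" if "t < t'" "t \<in> D" for t t'
    proof (rule ccontr)
      assume "B t \<inter> B t' \<noteq> {}"
      then obtain \<omega> where \<omega>: "\<omega> \<in> B t" "\<omega> \<in> B t'" by blast
      have "2 * \<epsilon> < Y t \<omega>" using \<omega>(1) by (simp add: B_def)
      moreover have "Y t \<omega> \<le> 2 * \<epsilon>" using \<omega>(2) that by (simp add: B_def)
      ultimately show False by simp
    qed
    from \<open>t \<noteq> t'\<close> consider "t < t'" | "t' < t" by linarith
    then show "B t \<inter> B t' = {}"
      using *[of t t'] *[of t' t] t by cases auto
  qed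
  have "{\<omega>\<in>space M. \<exists>t\<in>D. 2 * \<epsilon> < Y t \<omega>} \<subseteq> G s \<union> (\<Union>t\<in>D. B t \<inter> G t)"
  proof
    fix \<omega> assume "\<omega> \<in> {\<omega>\<in>space M. \<exists>t\<in>D. 2 * \<epsilon> < Y t \<omega>}"
    then have \<omega>: "\<omega> \<in> space M" and ne: "{t\<in>D. 2 * \<epsilon> < Y t \<omega>} \<noteq> {}" by auto
    define t where "t = Min {t\<in>D. 2 * \<epsilon> < Y t \<omega>}"
    have fin: "finite {t\<in>D. 2 * \<epsilon> < Y t \<omega>}" using D by simp
    have t: "t \<in> D" "2 * \<epsilon> < Y t \<omega>" using Min_in[OF fin ne] by (auto simp: t_def)
    have "Y r \<omega> \<le> 2 * \<epsilon>" if "r \<in> D" "r < t" for r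
      using Min_le[OF fin, of r] that by (fastforce simp: t_def[symmetric])
    then have "\<omega> \<in> B t" using t \<omega> by (auto simp: B_def)
    show "\<omega> \<in> G s \<union> (\<Union>t\<in>D. B t \<inter> G t)"
    proof (cases "\<omega> \<in> G s")
      case False
      then have "\<epsilon> < \<bar>f (X (s + \<delta>) \<omega>) - f (X t \<omega>)\<bar>"
        using t(2) \<omega> by (auto simp: G_def Y_def)
      then show ?thesis using \<open>\<omega> \<in> B t\<close> t(1) \<omega> by (auto simp: G_def)
    qed simp
  qed
  then have "prob {\<omega>\<in>space M. \<exists>t\<in>D. 2 * \<epsilon> < Y t \<omega>} \<le> prob (G s \<union> (\<Union>t\<in>D. B t \<inter> G t))"
    using D BG G[OF s] by (intro finite_measure_mono sets.Un sets.finite_UN) auto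
  also have "\<dots> \<le> prob (G s) + prob (\<Union>t\<in>D. B t \<inter> G t)"
    using D BG G[OF s] by (intro measure_Un_le sets.finite_UN) auto
  also have "prob (\<Union>t\<in>D. B t \<inter> G t) \<le> (\<Sum>t\<in>D. prob (B t \<inter> G t))"
    using D BG by (intro finite_measure_subadditive_finite) auto
  also have "\<dots> \<le> (\<Sum>t\<in>D. c * prob (B t) / \<epsilon>\<^sup>2)"
  proof (rule sum_mono)
    fix t assume t: "t \<in> D"
    then have "0 \<le> t" "0 \<le> s + \<delta> - t" "s + \<delta> - t \<le> \<delta>" using s Dge[OF t] by auto
    then show "prob (B t \<inter> G t) \<le> c * prob (B t) / \<epsilon>\<^sup>2"
      unfolding G_def c_def
      using square_increment[OF _ B[OF t] \<open>\<delta> > 0\<close>, of "s + \<delta> - t"] B'[OF t] s \<open>\<delta> > 0\<close>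
      by (intro chebyshev_on_event \<open>\<epsilon> > 0\<close>) auto
  qed
  also have "\<dots> = c * prob (\<Union>t\<in>D. B t) / \<epsilon>\<^sup>2"
    using D B' disj by (subst finite_measure_finite_Union) (auto simp: sum_distrib_left sum_divide_distrib)
  also have "\<dots> \<le> c * 1 / \<epsilon>\<^sup>2"
    using \<open>c \<ge> 0\<close> by (intro divide_right_mono mult_left_mono) auto
  also have "prob (G s) \<le> c / \<epsilon>\<^sup>2"
  proof -
    have top: "space M \<in> past s" using sets.top[of "natural_filtration M S X s"] by simp
    have "prob (space M \<inter> G s) \<le> c / \<epsilon>\<^sup>2"
      unfolding G_def c_def
      using square_increment[OF s top \<open>\<delta> > 0\<close>, of \<delta>] s \<open>\<delta> > 0\<close>
      by (intro chebyshev_on_event \<open>\<epsilon> > 0\<close>) (auto simp: prob_space)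
    moreover have "space M \<inter> G s = G s" by (auto simp: G_def)
    ultimately show ?thesis by simp
  qed
  finally show ?thesis by (simp add: Y_def c_def)
qed

lemma oscillation_countable:
  assumes s: "0 \<le> s" and "\<delta> > 0" "\<epsilon> > 0" and D: "countable D" "D \<subseteq> {s..s + \<delta>}"
  shows "{\<omega>\<in>space M. \<exists>t\<in>D. 2 * \<epsilon> < \<bar>f (X t \<omega>) - f (X s \<omega>)\<bar>} \<in> sets M"
    and "prob {\<omega>\<in>space M. \<exists>t\<in>D. 2 * \<epsilon> < \<bar>f (X t \<omega>) - f (X s \<omega>)\<bar>}
           \<le> 4 * \<delta> * (\<Lambda>\<^sup>2 * \<delta> + \<Gamma>) / \<epsilon>\<^sup>2"
proof -
  let ?E = "\<lambda>D. {\<omega>\<in>space M. \<exists>t\<in>D. 2 * \<epsilon> < \<bar>f (X t \<omega>) - f (X s \<omega>)\<bar>}"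
  have one: "{\<omega>\<in>space M. 2 * \<epsilon> < \<bar>f (X t \<omega>) - f (X s \<omega>)\<bar>} \<in> sets M" if "t \<in> D" for t
    using borel_measurable_fun_X[of t f] borel_measurable_fun_X[of s f] s D that by auto
  have meas: "?E D' \<in> sets M" if "countable D'" "D' \<subseteq> D" for D'
  proof -
    have "?E D' = (\<Union>t\<in>D'. {\<omega>\<in>space M. 2 * \<epsilon> < \<bar>f (X t \<omega>) - f (X s \<omega>)\<bar>})" by auto
    then show ?thesis using that one by (auto intro!: sets.countable_UN')
  qed
  then show "?E D \<in> sets M" using D by blast
  show "prob (?E D) \<le> 4 * \<delta> * (\<Lambda>\<^sup>2 * \<delta> + \<Gamma>) / \<epsilon>\<^sup>2"
  proof (cases "D = {}")
    case True
    moreover have "0 \<le> 4 * \<delta> * (\<Lambda>\<^sup>2 * \<delta> + \<Gamma>) / \<epsilon>\<^sup>2"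
      by (intro divide_nonneg_nonneg mult_nonneg_nonneg add_nonneg_nonneg) (use nonneg \<open>\<delta> > 0\<close> in simp_all)
    ultimately show ?thesis by simp
  next
    case False
    let ?D = "\<lambda>n. from_nat_into D ` {..n::nat}"
    have sub: "?D n \<subseteq> D" for n using from_nat_into[OF False] by blast
    have "(\<lambda>n. prob (?E (?D n))) \<longlonglongrightarrow> prob (\<Union>n. ?E (?D n))"
    proof (rule finite_Lim_measure_incseq)
      show "range (\<lambda>n. ?E (?D n)) \<subseteq> events"
        using meas[OF _ sub] by (intro image_subsetI) (simp add: countable_finite)
      show "incseq (\<lambda>n. ?E (?D n))"
      proof (rule incseq_SucI, safe)
        fix n \<omega> k assume "k \<le> n" "2 * \<epsilon> < \<bar>f (X (from_nat_into D k) \<omega>) - f (X s \<omega>)\<bar>"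
        then show "\<exists>t\<in>?D (Suc n). 2 * \<epsilon> < \<bar>f (X t \<omega>) - f (X s \<omega>)\<bar>"
          by (intro bexI[of _ "from_nat_into D k"] imageI) auto
      qed
    qed
    moreover have "(\<Union>n. ?E (?D n)) = ?E D"
    proof (rule set_eqI, rule iffI)
      fix \<omega> assume "\<omega> \<in> ?E D"
      then obtain t where t: "\<omega> \<in> space M" "t \<in> D" "2 * \<epsilon> < \<bar>f (X t \<omega>) - f (X s \<omega>)\<bar>" by auto
      obtain n where "t = from_nat_into D n"
        using from_nat_into_surj[OF D(1) t(2)] by auto
      then have "\<omega> \<in> ?E (?D n)" using t by auto
      then show "\<omega> \<in> (\<Union>n. ?E (?D n))" by blast
    next
      fix \<omega> assume "\<omega> \<in> (\<Union>n. ?E (?D n))"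
      then obtain n where "\<omega> \<in> ?E (?D n)" by blast
      then show "\<omega> \<in> ?E D" using sub[of n] by blast
    qed
    ultimately have "(\<lambda>n. prob (?E (?D n))) \<longlonglongrightarrow> prob (?E D)" by simp
    moreover have "prob (?E (?D n)) \<le> 4 * \<delta> * (\<Lambda>\<^sup>2 * \<delta> + \<Gamma>) / \<epsilon>\<^sup>2" for n
      using sub[of n] D by (intro oscillation_finite assms) auto
    ultimately show ?thesis by (intro LIMSEQ_le_const2) auto
  qed
qed

lemma oscillation:
  assumes s: "0 \<le> s" and "\<delta> > 0" "\<epsilon> > 0"
    and rc: "\<And>\<omega> t. \<omega> \<in> space M \<Longrightarrow> 0 \<le> t \<Longrightarrow> continuous (at_right t) (\<lambda>t. f (X t \<omega>))"
  shows "{\<omega>\<in>space M. \<exists>t\<in>{s..s + \<delta>}. 2 * \<epsilon> < \<bar>f (X t \<omega>) - f (X s \<omega>)\<bar>} \<in> sets M"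
    and "prob {\<omega>\<in>space M. \<exists>t\<in>{s..s + \<delta>}. 2 * \<epsilon> < \<bar>f (X t \<omega>) - f (X s \<omega>)\<bar>}
           \<le> 4 * \<delta> * (\<Lambda>\<^sup>2 * \<delta> + \<Gamma>) / \<epsilon>\<^sup>2"
proof -
  let ?D = "insert (s + \<delta>) ({s..s + \<delta>} \<inter> \<rat>)"
  have D: "countable ?D" "?D \<subseteq> {s..s + \<delta>}" using countable_rat \<open>\<delta> > 0\<close> by auto
  have "{\<omega>\<in>space M. \<exists>t\<in>{s..s + \<delta>}. 2 * \<epsilon> < \<bar>f (X t \<omega>) - f (X s \<omega>)\<bar>}
      = {\<omega>\<in>space M. \<exists>t\<in>?D. 2 * \<epsilon> < \<bar>f (X t \<omega>) - f (X s \<omega>)\<bar>}"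
  proof (rule Collect_cong, rule conj_cong[OF refl], rule iffI)
    fix \<omega> assume \<omega>: "\<omega> \<in> space M" and "\<exists>t\<in>{s..s + \<delta>}. 2 * \<epsilon> < \<bar>f (X t \<omega>) - f (X s \<omega>)\<bar>"
    then obtain t where t: "t \<in> {s..s + \<delta>}" "2 * \<epsilon> < \<bar>f (X t \<omega>) - f (X s \<omega>)\<bar>" by blast
    show "\<exists>t\<in>?D. 2 * \<epsilon> < \<bar>f (X t \<omega>) - f (X s \<omega>)\<bar>"
      by (rule right_continuous_exceeds_on_countable[where y = "\<lambda>t. \<bar>f (X t \<omega>) - f (X s \<omega>)\<bar>", OF _ t])
        (use \<omega> s rc in \<open>auto intro!: continuous_intros\<close>)
  qed (use D in blast)
  then show "{\<omega>\<in>space M. \<exists>t\<in>{s..s + \<delta>}. 2 * \<epsilon> < \<bar>f (X t \<omega>) - f (X s \<omega>)\<bar>} \<in> sets M"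
    and "prob {\<omega>\<in>space M. \<exists>t\<in>{s..s + \<delta>}. 2 * \<epsilon> < \<bar>f (X t \<omega>) - f (X s \<omega>)\<bar>}
           \<le> 4 * \<delta> * (\<Lambda>\<^sup>2 * \<delta> + \<Gamma>) / \<epsilon>\<^sup>2"
    using oscillation_countable[OF assms(1-3) D] by simp_all
qed

end

section \<open>The generator of the spin dynamics on linear statistics\<close>

text \<open>Every function of a spin \<open>s\<close> with values \<open>1\<close> and \<open>-1\<close> is affine. The next two functions are the two coefficients of
\<open>tanh (\<beta> c + \<beta> lam s)\<close>; they are also the coefficients of the limiting equations.\<close>

definition tanh_mean :: "real \<Rightarrow> real \<Rightarrow> real \<Rightarrow> real" where
  "tanh_mean \<beta> lam c = (tanh (\<beta> * c + \<beta> * lam) + tanh (\<beta> * c - \<beta> * lam)) / 2"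

definition tanh_half_gap :: "real \<Rightarrow> real \<Rightarrow> real \<Rightarrow> real" where
  "tanh_half_gap \<beta> lam c = (tanh (\<beta> * c + \<beta> * lam) - tanh (\<beta> * c - \<beta> * lam)) / 2"

lemma tanh_spin:
  assumes "s \<in> {-1, 1 :: real}"
  shows "tanh (\<beta> * c + \<beta> * lam * s) = tanh_mean \<beta> lam c + s * tanh_half_gap \<beta> lam c"
    and "tanh (\<beta> * c - \<beta> * lam * s) = tanh_mean \<beta> lam c - s * tanh_half_gap \<beta> lam c"
  using assms by (auto simp: tanh_mean_def tanh_half_gap_def field_simps)

lemma tanh_mean_bound: "\<bar>tanh_mean \<beta> lam c\<bar> \<le> 1"
  using abs_tanh_le_1[of "\<beta> * c + \<beta> * lam"] abs_tanh_le_1[of "\<beta> * c - \<beta> * lam"]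
  unfolding tanh_mean_def abs_le_iff by simp

lemma tanh_half_gap_bound: "\<bar>tanh_half_gap \<beta> lam c\<bar> \<le> 1"
  using abs_tanh_le_1[of "\<beta> * c + \<beta> * lam"] abs_tanh_le_1[of "\<beta> * c - \<beta> * lam"]
  unfolding tanh_half_gap_def abs_le_iff by simp

lemma abs_half_sum_le: "\<bar>a - a'\<bar> \<le> e \<Longrightarrow> \<bar>b - b'\<bar> \<le> e \<Longrightarrow> \<bar>(a + b) / 2 - (a' + b') / 2\<bar> \<le> (e::real)"
  and abs_half_diff_le: "\<bar>a - a'\<bar> \<le> e \<Longrightarrow> \<bar>b - b'\<bar> \<le> e \<Longrightarrow> \<bar>(a - b) / 2 - (a' - b') / 2\<bar> \<le> (e::real)"
  by (simp_all add: abs_le_iff field_simps)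

lemma tanh_mean_lipschitz: "\<bar>tanh_mean \<beta> lam c - tanh_mean \<beta> lam c'\<bar> \<le> \<bar>\<beta>\<bar> * \<bar>c - c'\<bar>"
  and tanh_half_gap_lipschitz: "\<bar>tanh_half_gap \<beta> lam c - tanh_half_gap \<beta> lam c'\<bar> \<le> \<bar>\<beta>\<bar> * \<bar>c - c'\<bar>"
proof -
  have "\<bar>\<beta>\<bar> * \<bar>c - c'\<bar> = \<bar>\<beta> * c - \<beta> * c'\<bar>" by (simp add: abs_mult right_diff_distrib[symmetric])
  moreover have "\<bar>tanh (\<beta> * c + \<beta> * lam) - tanh (\<beta> * c' + \<beta> * lam)\<bar> \<le> \<bar>\<beta> * c - \<beta> * c'\<bar>"
    using tanh_lipschitz[of "\<beta> * c + \<beta> * lam" "\<beta> * c' + \<beta> * lam"] by simp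
  moreover have "\<bar>tanh (\<beta> * c - \<beta> * lam) - tanh (\<beta> * c' - \<beta> * lam)\<bar> \<le> \<bar>\<beta> * c - \<beta> * c'\<bar>"
    using tanh_lipschitz[of "\<beta> * c - \<beta> * lam" "\<beta> * c' - \<beta> * lam"] by simp
  ultimately show "\<bar>tanh_mean \<beta> lam c - tanh_mean \<beta> lam c'\<bar> \<le> \<bar>\<beta>\<bar> * \<bar>c - c'\<bar>"
    and "\<bar>tanh_half_gap \<beta> lam c - tanh_half_gap \<beta> lam c'\<bar> \<le> \<bar>\<beta>\<bar> * \<bar>c - c'\<bar>"
    unfolding tanh_mean_def tanh_half_gap_def using abs_half_sum_le abs_half_diff_le by metis+
qed

text \<open>The three slots are meant for \<open>(\<sigma>\<^sub>1, \<sigma>\<^sub>2, \<sigma>\<^sub>1 \<sigma>\<^sub>2)\<close>, for \<open>(u1, u2, v)\<close>, or for differences of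
the two. Treating them together lets a single estimate cover the coupled equations of all
three fields.\<close>

definition triple_avg :: "nat \<Rightarrow> (nat \<Rightarrow> real) \<Rightarrow> (nat \<Rightarrow> real) \<Rightarrow> (nat \<Rightarrow> real) \<Rightarrow>
    (nat \<Rightarrow> real) \<Rightarrow> (nat \<Rightarrow> real) \<Rightarrow> (nat \<Rightarrow> real) \<Rightarrow> real" where
  "triple_avg N g1 g2 g3 s1 s2 s3 = 1 / real N * (\<Sum>x<N. g1 x * s1 x + g2 x * s2 x + g3 x * s3 x)"

definition statistic :: "nat \<Rightarrow> (nat \<Rightarrow> real) \<Rightarrow> (nat \<Rightarrow> real) \<Rightarrow> (nat \<Rightarrow> real) \<Rightarrow> config \<times> config \<Rightarrow> real" where
  "statistic N g1 g2 g3 \<sigma> = triple_avg N g1 g2 g3 (fst \<sigma>) (snd \<sigma>) (\<lambda>x. fst \<sigma> x * snd \<sigma> x)"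

definition weights_le :: "nat \<Rightarrow> real \<Rightarrow> (nat \<Rightarrow> real) \<Rightarrow> (nat \<Rightarrow> real) \<Rightarrow> (nat \<Rightarrow> real) \<Rightarrow> bool" where
  "weights_le N B g1 g2 g3 \<longleftrightarrow> (\<forall>x<N. \<bar>g1 x\<bar> \<le> B \<and> \<bar>g2 x\<bar> \<le> B \<and> \<bar>g3 x\<bar> \<le> B)"

lemma weights_leD:
  assumes "weights_le N B g1 g2 g3" "x < N"
  shows "\<bar>g1 x\<bar> \<le> B" "\<bar>g2 x\<bar> \<le> B" "\<bar>g3 x\<bar> \<le> B"
  using assms unfolding weights_le_def by blast+

lemma triple_avg_cong:
  assumes "\<And>x. x < N \<Longrightarrow> g1 x * s1 x + g2 x * s2 x + g3 x * s3 x = g1' x * s1' x + g2' x * s2' x + g3' x * s3' x"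
  shows "triple_avg N g1 g2 g3 s1 s2 s3 = triple_avg N g1' g2' g3' s1' s2' s3'"
  using assms unfolding triple_avg_def by (auto intro!: sum.cong)

lemma triple_avg_diff:
  "triple_avg N g1 g2 g3 s1 s2 s3 - triple_avg N g1 g2 g3 s1' s2' s3'
     = triple_avg N g1 g2 g3 (\<lambda>x. s1 x - s1' x) (\<lambda>x. s2 x - s2' x) (\<lambda>x. s3 x - s3' x)"
  unfolding triple_avg_def
  unfolding right_diff_distrib[symmetric] sum_subtractf[symmetric]
  by (rule arg_cong[where f = "\<lambda>s. 1 / real N * s"], rule sum.cong) (simp_all add: algebra_simps)

lemma abs_avg_le:
  assumes "N > 0" "\<And>x. x < N \<Longrightarrow> \<bar>f x\<bar> \<le> c"
  shows "\<bar>1 / real N * (\<Sum>x<N. f x)\<bar> \<le> c"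
proof -
  have "\<bar>\<Sum>x<N. f x\<bar> \<le> (\<Sum>x<N. \<bar>f x\<bar>)" by (rule sum_abs)
  also have "\<dots> \<le> real (card {..<N}) * c" using assms(2) by (intro sum_bounded_above) auto
  finally show ?thesis using \<open>N > 0\<close> by (simp add: abs_mult field_simps)
qed

lemma finite_states: "finite (states N)"
  unfolding states_def configs_def by (intro finite_cartesian_product finite_PiE) auto

lemma spin_values:
  assumes "\<sigma> \<in> states N" "x < N"
  shows "fst \<sigma> x \<in> {-1, 1}" "snd \<sigma> x \<in> {-1, 1}"
proof -
  have "fst \<sigma> \<in> {..<N} \<rightarrow>\<^sub>E {-1, 1}" "snd \<sigma> \<in> {..<N} \<rightarrow>\<^sub>E {-1, 1}"
    using assms(1) unfolding states_def configs_def mem_Times_iff by blast+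
  from this[THEN PiE_mem, of x] show "fst \<sigma> x \<in> {-1, 1}" "snd \<sigma> x \<in> {-1, 1}"
    using assms(2) by blast+
qed

lemma abs_spin:
  assumes "\<sigma> \<in> states N" "x < N"
  shows "\<bar>fst \<sigma> x\<bar> = 1" "\<bar>snd \<sigma> x\<bar> = 1"
  using spin_values[OF assms] by auto

lemma flip_in_configs: "\<sigma> \<in> configs N \<Longrightarrow> x < N \<Longrightarrow> flip \<sigma> x \<in> configs N"
proof -
  assume \<sigma>: "\<sigma> \<in> configs N" and x: "x < N"
  have "\<sigma> y \<in> {-1, 1}" if "y < N" for y
    using PiE_mem[OF \<sigma>[unfolded configs_def], of y] that by simp
  moreover have "\<sigma> y = undefined" if "\<not> y < N" for y
    using PiE_arb[OF \<sigma>[unfolded configs_def], of y] that by simp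
  ultimately show "flip \<sigma> x \<in> configs N"
    unfolding configs_def flip_def using x by (intro PiE_I) (auto split: if_splits)
qed

lemma abs_statistic_le:
  assumes "\<sigma> \<in> states N" "N > 0" "weights_le N B g1 g2 g3"
  shows "\<bar>statistic N g1 g2 g3 \<sigma>\<bar> \<le> 3 * B"
  unfolding statistic_def triple_avg_def
proof (rule abs_avg_le[OF \<open>N > 0\<close>])
  fix x assume x: "x < N"
  have "\<bar>g1 x * fst \<sigma> x + g2 x * snd \<sigma> x + g3 x * (fst \<sigma> x * snd \<sigma> x)\<bar> \<le> \<bar>g1 x\<bar> + \<bar>g2 x\<bar> + \<bar>g3 x\<bar>"
  proof -
    have "\<bar>g1 x * fst \<sigma> x\<bar> = \<bar>g1 x\<bar>" "\<bar>g2 x * snd \<sigma> x\<bar> = \<bar>g2 x\<bar>" "\<bar>g3 x * (fst \<sigma> x * snd \<sigma> x)\<bar> = \<bar>g3 x\<bar>"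
      using abs_spin[OF assms(1) x] by (simp_all add: abs_mult)
    then show ?thesis by linarith
  qed
  then show "\<bar>g1 x * fst \<sigma> x + g2 x * snd \<sigma> x + g3 x * (fst \<sigma> x * snd \<sigma> x)\<bar> \<le> 3 * B"
    using weights_leD[OF assms(3) x] by linarith
qed

text \<open>With \<open>h\<close> the field acting on a spin \<open>s\<close>, this flip rate equals \<open>(1 - s tanh h) / 2\<close>.\<close>

lemma spin_rate_bound:
  assumes "s \<in> {-1, 1 :: real}"
  shows "0 \<le> exp (- s * h) / (2 * cosh h)" "exp (- s * h) / (2 * cosh h) \<le> 1"
    and "exp (- s * h) / (2 * cosh h) * (- 2 * s) = - s + tanh h"
proof -
  have c: "2 * cosh h = exp h + exp (- h)" "2 * sinh h = exp h - exp (- h)" for h :: real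
    by (simp_all add: cosh_def sinh_def)
  have "0 < cosh h" by simp
  then show "0 \<le> exp (- s * h) / (2 * cosh h)" by simp
  have "exp (- s * h) \<le> 2 * cosh h" using assms by (auto simp: c)
  then show "exp (- s * h) / (2 * cosh h) \<le> 1" by simp
  have "exp (- s * h) * (- 2 * s) = 2 * cosh h * (- s) + 2 * sinh h"
    using assms by (auto simp: c)
  then have "exp (- s * h) * (- 2 * s) / (2 * cosh h) = (2 * cosh h * (- s) + 2 * sinh h) / (2 * cosh h)"
    by simp
  also have "\<dots> = - s + tanh h"
    using \<open>0 < cosh h\<close> by (simp add: tanh_def diff_divide_distrib del: cosh_real_pos)
  finally show "exp (- s * h) / (2 * cosh h) * (- 2 * s) = - s + tanh h"
    by simp
qed

lemma rate1_eq: "rate1 N \<beta>1 lam \<phi>1 x \<sigma>1 \<sigma>2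
    = exp (- \<sigma>1 x * (\<beta>1 * config_conv N \<sigma>1 \<phi>1 x + \<beta>1 * lam * \<sigma>2 x)) /
      (2 * cosh (\<beta>1 * config_conv N \<sigma>1 \<phi>1 x + \<beta>1 * lam * \<sigma>2 x))"
  unfolding rate1_def by (simp add: exp_add[symmetric] algebra_simps)

lemma rate2_eq: "rate2 N \<beta>2 lam \<phi>2 x \<sigma>1 \<sigma>2
    = exp (- \<sigma>2 x * (\<beta>2 * config_conv N \<sigma>2 \<phi>2 x - \<beta>2 * lam * \<sigma>1 x)) /
      (2 * cosh (\<beta>2 * config_conv N \<sigma>2 \<phi>2 x - \<beta>2 * lam * \<sigma>1 x))"
  unfolding rate2_def by (simp add: exp_add[symmetric] algebra_simps)

lemma statistic_flip1:
  assumes "x < N"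
  shows "statistic N g1 g2 g3 (flip \<sigma>1 x, \<sigma>2) - statistic N g1 g2 g3 (\<sigma>1, \<sigma>2)
       = 1 / real N * ((g1 x + g3 x * \<sigma>2 x) * (- 2 * \<sigma>1 x))"
proof -
  have "statistic N g1 g2 g3 (flip \<sigma>1 x, \<sigma>2) - statistic N g1 g2 g3 (\<sigma>1, \<sigma>2)
      = 1 / real N * (\<Sum>y<N. if y = x then (g1 x + g3 x * \<sigma>2 x) * (- 2 * \<sigma>1 x) else 0)"
    unfolding statistic_def triple_avg_diff unfolding triple_avg_def
    by (rule arg_cong[where f = "\<lambda>s. 1 / real N * s"], rule sum.cong) (auto simp: flip_def algebra_simps)
  then show ?thesis using assms by simp
qed

lemma statistic_flip2:
  assumes "x < N"
  shows "statistic N g1 g2 g3 (\<sigma>1, flip \<sigma>2 x) - statistic N g1 g2 g3 (\<sigma>1, \<sigma>2)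
       = 1 / real N * ((g2 x + g3 x * \<sigma>1 x) * (- 2 * \<sigma>2 x))"
proof -
  have "statistic N g1 g2 g3 (\<sigma>1, flip \<sigma>2 x) - statistic N g1 g2 g3 (\<sigma>1, \<sigma>2)
      = 1 / real N * (\<Sum>y<N. if y = x then (g2 x + g3 x * \<sigma>1 x) * (- 2 * \<sigma>2 x) else 0)"
    unfolding statistic_def triple_avg_diff unfolding triple_avg_def
    by (rule arg_cong[where f = "\<lambda>s. 1 / real N * s"], rule sum.cong) (auto simp: flip_def algebra_simps)
  then show ?thesis using assms by simp
qed

locale spin_model =
  fixes \<beta>1 \<beta>2 lam :: real and \<phi>1 \<phi>2 :: "real \<Rightarrow> real \<Rightarrow> real"
begin

abbreviation rate1' where "rate1' N x \<sigma> \<equiv> rate1 N \<beta>1 lam \<phi>1 x (fst \<sigma>) (snd \<sigma>)"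
abbreviation rate2' where "rate2' N x \<sigma> \<equiv> rate2 N \<beta>2 lam \<phi>2 x (fst \<sigma>) (snd \<sigma>)"
abbreviation flip1 :: "config \<times> config \<Rightarrow> nat \<Rightarrow> config \<times> config" where "flip1 \<sigma> x \<equiv> (flip (fst \<sigma>) x, snd \<sigma>)"
abbreviation flip2 :: "config \<times> config \<Rightarrow> nat \<Rightarrow> config \<times> config" where "flip2 \<sigma> x \<equiv> (fst \<sigma>, flip (snd \<sigma>) x)"
abbreviation gen where "gen N \<equiv> generator N \<beta>1 \<beta>2 lam \<phi>1 \<phi>2"

lemma gen_apply: "gen N F \<sigma> = (\<Sum>x<N. rate1' N x \<sigma> * (F (flip1 \<sigma> x) - F \<sigma>) + rate2' N x \<sigma> * (F (flip2 \<sigma> x) - F \<sigma>))"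
  unfolding generator_def by (cases \<sigma>) simp

lemma rate_bounds:
  assumes "\<sigma> \<in> states N" "x < N"
  shows "0 \<le> rate1' N x \<sigma>" "rate1' N x \<sigma> \<le> 1" "0 \<le> rate2' N x \<sigma>" "rate2' N x \<sigma> \<le> 1"
  unfolding rate1_eq rate2_eq
  by (rule spin_rate_bound[OF spin_values(1)[OF assms]] spin_rate_bound[OF spin_values(2)[OF assms]])+

lemma flip_in_states:
  assumes "\<sigma> \<in> states N" "x < N"
  shows "flip1 \<sigma> x \<in> states N" "flip2 \<sigma> x \<in> states N"
  using assms flip_in_configs unfolding states_def mem_Times_iff by simp_all

lemma abs_gen_le:
  assumes "\<sigma> \<in> states N"
    and "\<And>x. x < N \<Longrightarrow> \<bar>F (flip1 \<sigma> x) - F \<sigma>\<bar> \<le> C" "\<And>x. x < N \<Longrightarrow> \<bar>F (flip2 \<sigma> x) - F \<sigma>\<bar> \<le> C"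
  shows "\<bar>gen N F \<sigma>\<bar> \<le> real N * (2 * C)"
proof -
  have "\<bar>gen N F \<sigma>\<bar> \<le> (\<Sum>x<N. \<bar>rate1' N x \<sigma> * (F (flip1 \<sigma> x) - F \<sigma>) + rate2' N x \<sigma> * (F (flip2 \<sigma> x) - F \<sigma>)\<bar>)"
    unfolding gen_apply by (rule sum_abs)
  also have "\<dots> \<le> real (card {..<N}) * (2 * C)"
  proof (rule sum_bounded_above)
    fix x assume "x \<in> {..<N}"
    then have x: "x < N" by simp
    have "\<bar>rate1' N x \<sigma> * (F (flip1 \<sigma> x) - F \<sigma>)\<bar> \<le> 1 * C"
      unfolding abs_mult using rate_bounds[OF assms(1) x] assms(2)[OF x] by (intro mult_mono) auto
    moreover have "\<bar>rate2' N x \<sigma> * (F (flip2 \<sigma> x) - F \<sigma>)\<bar> \<le> 1 * C"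
      unfolding abs_mult using rate_bounds[OF assms(1) x] assms(3)[OF x] by (intro mult_mono) auto
    ultimately show "\<bar>rate1' N x \<sigma> * (F (flip1 \<sigma> x) - F \<sigma>) + rate2' N x \<sigma> * (F (flip2 \<sigma> x) - F \<sigma>)\<bar> \<le> 2 * C"
      by linarith
  qed
  finally show ?thesis by simp
qed

lemma gen_bounded:
  assumes "\<sigma> \<in> states N" "\<And>\<sigma>. \<sigma> \<in> states N \<Longrightarrow> \<bar>F \<sigma>\<bar> \<le> C"
  shows "\<bar>gen N F \<sigma>\<bar> \<le> (4 * real N) * C"
proof -
  have "\<bar>F (flip1 \<sigma> x) - F \<sigma>\<bar> \<le> 2 * C" "\<bar>F (flip2 \<sigma> x) - F \<sigma>\<bar> \<le> 2 * C" if "x < N" for x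
    using assms(2)[OF assms(1)] assms(2)[OF flip_in_states(1)[OF assms(1) that]]
      assms(2)[OF flip_in_states(2)[OF assms(1) that]] by linarith+
  from abs_gen_le[OF assms(1) this] show ?thesis by simp
qed

text \<open>The sum on the right is the square field of \<open>F\<close>.\<close>

lemma gen_square_deviation:
  "gen N (\<lambda>\<sigma>. (F \<sigma> - a)\<^sup>2) \<sigma> = 2 * (F \<sigma> - a) * gen N F \<sigma>
     + (\<Sum>x<N. rate1' N x \<sigma> * (F (flip1 \<sigma> x) - F \<sigma>)\<^sup>2 + rate2' N x \<sigma> * (F (flip2 \<sigma> x) - F \<sigma>)\<^sup>2)"
  unfolding gen_apply sum_distrib_left sum.distrib[symmetric]
  by (rule sum.cong) (auto simp: power2_eq_square algebra_simps)

context
  fixes N :: nat and B :: real and g1 g2 g3 :: "nat \<Rightarrow> real"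
  assumes N: "N > 0" and w: "weights_le N B g1 g2 g3"
begin

lemma statistic_jump:
  assumes "\<sigma> \<in> states N" "x < N"
  shows "\<bar>statistic N g1 g2 g3 (flip1 \<sigma> x) - statistic N g1 g2 g3 \<sigma>\<bar> \<le> 4 * B / real N"
    and "\<bar>statistic N g1 g2 g3 (flip2 \<sigma> x) - statistic N g1 g2 g3 \<sigma>\<bar> \<le> 4 * B / real N"
proof -
  have key: "\<bar>1 / real N * ((a + b * s) * (- 2 * s'))\<bar> \<le> 4 * B / real N"
    if "\<bar>a\<bar> \<le> B" "\<bar>b\<bar> \<le> B" "\<bar>s\<bar> = 1" "\<bar>s'\<bar> = 1" for a b s s' :: real
  proof -
    have "\<bar>a + b * s\<bar> \<le> \<bar>a\<bar> + \<bar>b\<bar> * \<bar>s\<bar>" by (metis abs_mult abs_triangle_ineq)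
    then have "\<bar>a + b * s\<bar> \<le> 2 * B" using that by simp
    then have le: "1 / real N * (\<bar>a + b * s\<bar> * 2) \<le> 1 / real N * (2 * B * 2)"
      by (intro mult_left_mono) auto
    have "\<bar>1 / real N * ((a + b * s) * (- 2 * s'))\<bar> = 1 / real N * (\<bar>a + b * s\<bar> * 2)"
      unfolding abs_mult that(4) by simp
    also note le
    also have "1 / real N * (2 * B * 2) = 4 * B / real N" by simp
    finally show ?thesis .
  qed
  have "statistic N g1 g2 g3 (flip1 \<sigma> x) - statistic N g1 g2 g3 \<sigma>
      = 1 / real N * ((g1 x + g3 x * snd \<sigma> x) * (- 2 * fst \<sigma> x))"
    using statistic_flip1[OF assms(2), of g1 g2 g3 "fst \<sigma>" "snd \<sigma>"] by simp
  then show "\<bar>statistic N g1 g2 g3 (flip1 \<sigma> x) - statistic N g1 g2 g3 \<sigma>\<bar> \<le> 4 * B / real N"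
    using key[OF weights_leD(1,3)[OF w] abs_spin(2,1)] assms by simp
  have "statistic N g1 g2 g3 (flip2 \<sigma> x) - statistic N g1 g2 g3 \<sigma>
      = 1 / real N * ((g2 x + g3 x * fst \<sigma> x) * (- 2 * snd \<sigma> x))"
    using statistic_flip2[OF assms(2), of g1 g2 g3 "fst \<sigma>" "snd \<sigma>"] by simp
  then show "\<bar>statistic N g1 g2 g3 (flip2 \<sigma> x) - statistic N g1 g2 g3 \<sigma>\<bar> \<le> 4 * B / real N"
    using key[OF weights_leD(2,3)[OF w] abs_spin(1,2)] assms by simp
qed

lemma abs_gen_statistic_le:
  assumes "\<sigma> \<in> states N"
  shows "\<bar>gen N (statistic N g1 g2 g3) \<sigma>\<bar> \<le> 8 * B"
proof -
  have "\<bar>gen N (statistic N g1 g2 g3) \<sigma>\<bar> \<le> real N * (2 * (4 * B / real N))"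
    by (rule abs_gen_le[OF assms statistic_jump[OF assms]])
  then show ?thesis using N by simp
qed

text \<open>There are \<open>2 N\<close> possible flips, each at rate at most one and each changing the statistic by order \<open>1/N\<close>. So
the square field is of order \<open>1/N\<close>, which is the law of large numbers for the dynamics.\<close>

lemma gen_square_statistic_le:
  assumes "\<sigma> \<in> states N"
  shows "gen N (\<lambda>\<sigma>. (statistic N g1 g2 g3 \<sigma> - a)\<^sup>2) \<sigma>
     \<le> 2 * (statistic N g1 g2 g3 \<sigma> - a) * gen N (statistic N g1 g2 g3) \<sigma> + 32 * B\<^sup>2 / real N"
proof -
  let ?F = "statistic N g1 g2 g3"
  have "(\<Sum>x<N. rate1' N x \<sigma> * (?F (flip1 \<sigma> x) - ?F \<sigma>)\<^sup>2 + rate2' N x \<sigma> * (?F (flip2 \<sigma> x) - ?F \<sigma>)\<^sup>2)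
      \<le> real (card {..<N}) * (2 * (4 * B / real N)\<^sup>2)"
  proof (rule sum_bounded_above)
    fix x assume "x \<in> {..<N}"
    then have x: "x < N" by simp
    have sq: "(?F (flip1 \<sigma> x) - ?F \<sigma>)\<^sup>2 \<le> (4 * B / real N)\<^sup>2" "(?F (flip2 \<sigma> x) - ?F \<sigma>)\<^sup>2 \<le> (4 * B / real N)\<^sup>2"
      using power_mono[OF statistic_jump(1)[OF assms x], of 2] power_mono[OF statistic_jump(2)[OF assms x], of 2] by simp_all
    have "rate1' N x \<sigma> * (?F (flip1 \<sigma> x) - ?F \<sigma>)\<^sup>2 \<le> 1 * (4 * B / real N)\<^sup>2"
      using rate_bounds[OF assms x] sq by (intro mult_mono) auto
    moreover have "rate2' N x \<sigma> * (?F (flip2 \<sigma> x) - ?F \<sigma>)\<^sup>2 \<le> 1 * (4 * B / real N)\<^sup>2"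
      using rate_bounds[OF assms x] sq by (intro mult_mono) auto
    ultimately show "rate1' N x \<sigma> * (?F (flip1 \<sigma> x) - ?F \<sigma>)\<^sup>2 + rate2' N x \<sigma> * (?F (flip2 \<sigma> x) - ?F \<sigma>)\<^sup>2
        \<le> 2 * (4 * B / real N)\<^sup>2" by linarith
  qed
  also have "\<dots> = 32 * B\<^sup>2 / real N" using N by (simp add: power2_eq_square field_simps)
  finally show ?thesis unfolding gen_square_deviation by simp
qed

lemma gen_square_statistic_le':
  assumes "\<sigma> \<in> states N"
  shows "gen N (\<lambda>\<sigma>. (statistic N g1 g2 g3 \<sigma> - a)\<^sup>2) \<sigma>
     \<le> 2 * (8 * B) * \<bar>statistic N g1 g2 g3 \<sigma> - a\<bar> + 32 * B\<^sup>2 / real N"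
proof -
  let ?d = "statistic N g1 g2 g3 \<sigma> - a"
  have "?d * gen N (statistic N g1 g2 g3) \<sigma> \<le> \<bar>?d\<bar> * \<bar>gen N (statistic N g1 g2 g3) \<sigma>\<bar>"
    by (metis abs_ge_self abs_mult)
  also have "\<dots> \<le> \<bar>?d\<bar> * (8 * B)"
    using abs_gen_statistic_le[OF assms] by (rule mult_left_mono) simp
  finally have "2 * (?d * gen N (statistic N g1 g2 g3) \<sigma>) \<le> 2 * (8 * B) * \<bar>?d\<bar>"
    by (simp add: mult.commute)
  then show ?thesis
    using gen_square_statistic_le[OF assms, of a] unfolding mult.assoc[of 2 ?d] by linarith
qed

end

definition site_mean1 where "site_mean1 N \<sigma> x = tanh_mean \<beta>1 lam (config_conv N (fst \<sigma>) \<phi>1 x)"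
definition site_gap1 where "site_gap1 N \<sigma> x = tanh_half_gap \<beta>1 lam (config_conv N (fst \<sigma>) \<phi>1 x)"
definition site_mean2 where "site_mean2 N \<sigma> x = tanh_mean \<beta>2 lam (config_conv N (snd \<sigma>) \<phi>2 x)"
definition site_gap2 where "site_gap2 N \<sigma> x = tanh_half_gap \<beta>2 lam (config_conv N (snd \<sigma>) \<phi>2 x)"

text \<open>Flipping \<open>\<sigma>\<^sub>1(x)\<close> also flips the product \<open>\<sigma>\<^sub>1(x) \<sigma>\<^sub>2(x)\<close>, which produces terms with \<open>\<sigma>\<^sub>2(x)\<^sup>2\<close>.
Since the square of a spin is one, the drift is again affine in \<open>(\<sigma>\<^sub>1, \<sigma>\<^sub>2, \<sigma>\<^sub>1 \<sigma>\<^sub>2)\<close>. It has the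
shape of the limiting equations, with the field of the configuration in the coefficients.\<close>

lemma gen_statistic:
  assumes "\<sigma> \<in> states N"
  shows "gen N (statistic N g1 g2 g3) \<sigma> = triple_avg N g1 g2 g3
     (\<lambda>x. - fst \<sigma> x + site_mean1 N \<sigma> x + snd \<sigma> x * site_gap1 N \<sigma> x)
     (\<lambda>x. - snd \<sigma> x + site_mean2 N \<sigma> x - fst \<sigma> x * site_gap2 N \<sigma> x)
     (\<lambda>x. - 2 * (fst \<sigma> x * snd \<sigma> x) + site_gap1 N \<sigma> x - site_gap2 N \<sigma> x
          + fst \<sigma> x * site_mean2 N \<sigma> x + snd \<sigma> x * site_mean1 N \<sigma> x)"
    (is "_ = triple_avg N g1 g2 g3 ?s1 ?s2 ?s3")
  unfolding triple_avg_def gen_apply sum_distrib_left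
proof (rule sum.cong[OF refl])
  let ?F = "statistic N g1 g2 g3"
  fix x assume "x \<in> {..<N}"
  then have x: "x < N" by simp
  note s = spin_values[OF assms x]
  have r1: "rate1' N x \<sigma> * (- 2 * fst \<sigma> x) = - fst \<sigma> x + (site_mean1 N \<sigma> x + snd \<sigma> x * site_gap1 N \<sigma> x)"
    unfolding rate1_eq spin_rate_bound(3)[OF s(1)] tanh_spin(1)[OF s(2)] site_mean1_def site_gap1_def ..
  have r2: "rate2' N x \<sigma> * (- 2 * snd \<sigma> x) = - snd \<sigma> x + (site_mean2 N \<sigma> x - fst \<sigma> x * site_gap2 N \<sigma> x)"
    unfolding rate2_eq spin_rate_bound(3)[OF s(2)] tanh_spin(2)[OF s(1)] site_mean2_def site_gap2_def ..
  have f1: "?F (flip1 \<sigma> x) - ?F \<sigma>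
      = 1 / real N * ((g1 x + g3 x * snd \<sigma> x) * (- 2 * fst \<sigma> x))"
    using statistic_flip1[OF x, of g1 g2 g3 "fst \<sigma>" "snd \<sigma>"] by simp
  have f2: "?F (flip2 \<sigma> x) - ?F \<sigma>
      = 1 / real N * ((g2 x + g3 x * fst \<sigma> x) * (- 2 * snd \<sigma> x))"
    using statistic_flip2[OF x, of g1 g2 g3 "fst \<sigma>" "snd \<sigma>"] by simp
  have factor: "r * (c * (p * q)) + r' * (c * (p' * q')) = c * (p * (r * q) + p' * (r' * q'))"
    for r r' c p p' q q' :: real by (simp add: algebra_simps)
  let ?p1 = "g1 x + g3 x * snd \<sigma> x" and ?p2 = "g2 x + g3 x * fst \<sigma> x"
  have "rate1' N x \<sigma> * (?F (flip1 \<sigma> x) - ?F \<sigma>)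
      + rate2' N x \<sigma> * (?F (flip2 \<sigma> x) - ?F \<sigma>)
    = 1 / real N * (?p1 * (rate1' N x \<sigma> * (- 2 * fst \<sigma> x))
      + ?p2 * (rate2' N x \<sigma> * (- 2 * snd \<sigma> x)))"
    unfolding f1 f2 by (rule factor)
  also have "?p1 * (rate1' N x \<sigma> * (- 2 * fst \<sigma> x))
      + ?p2 * (rate2' N x \<sigma> * (- 2 * snd \<sigma> x))
    = g1 x * ?s1 x
      + g2 x * ?s2 x
      + g3 x * ?s3 x"
    unfolding r1 r2
  proof -
    have sq: "fst \<sigma> x * fst \<sigma> x = 1" "snd \<sigma> x * snd \<sigma> x = 1" using s by auto
    have "snd \<sigma> x * (snd \<sigma> x * site_gap1 N \<sigma> x) = site_gap1 N \<sigma> x"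
      "fst \<sigma> x * (fst \<sigma> x * site_gap2 N \<sigma> x) = site_gap2 N \<sigma> x"
      unfolding mult.assoc[symmetric] sq by simp_all
    moreover have "?p1 * (- fst \<sigma> x + (site_mean1 N \<sigma> x + snd \<sigma> x * site_gap1 N \<sigma> x))
        + ?p2 * (- snd \<sigma> x + (site_mean2 N \<sigma> x - fst \<sigma> x * site_gap2 N \<sigma> x))
      = g1 x * ?s1 x
      + g2 x * ?s2 x
      + g3 x * (- 2 * (fst \<sigma> x * snd \<sigma> x) + snd \<sigma> x * (snd \<sigma> x * site_gap1 N \<sigma> x) - fst \<sigma> x * (fst \<sigma> x * site_gap2 N \<sigma> x)
          + fst \<sigma> x * site_mean2 N \<sigma> x + snd \<sigma> x * site_mean1 N \<sigma> x)"
      by (simp add: algebra_simps)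
    ultimately show "?p1 * (- fst \<sigma> x + (site_mean1 N \<sigma> x + snd \<sigma> x * site_gap1 N \<sigma> x))
        + ?p2 * (- snd \<sigma> x + (site_mean2 N \<sigma> x - fst \<sigma> x * site_gap2 N \<sigma> x))
      = g1 x * ?s1 x
      + g2 x * ?s2 x
      + g3 x * ?s3 x" by (simp only:)
  qed
  finally show "rate1' N x \<sigma> * (?F (flip1 \<sigma> x) - ?F \<sigma>)
      + rate2' N x \<sigma> * (?F (flip2 \<sigma> x) - ?F \<sigma>)
    = 1 / real N * (g1 x * ?s1 x
      + g2 x * ?s2 x
      + g3 x * ?s3 x)" .
qed

end

lemma isCont_statistic: "isCont (statistic N g1 g2 g3) \<sigma>"
proof -
  have coord: "isCont (\<lambda>\<sigma>::config \<times> config. fst \<sigma> x) \<sigma>" "isCont (\<lambda>\<sigma>::config \<times> config. snd \<sigma> x) \<sigma>" for x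
  proof -
    have c: "isCont (\<lambda>f::config. f x) h" for h
    proof -
      have "continuous_on UNIV (\<lambda>f::config. f x)" by (rule continuous_on_product_coordinates)
      then show ?thesis unfolding continuous_on_eq_continuous_at[OF open_UNIV] by (rule bspec) simp
    qed
    show "isCont (\<lambda>\<sigma>::config \<times> config. fst \<sigma> x) \<sigma>"
      by (rule isCont_o2[OF _ c]) (intro continuous_intros)
    show "isCont (\<lambda>\<sigma>::config \<times> config. snd \<sigma> x) \<sigma>"
      by (rule isCont_o2[OF _ c]) (intro continuous_intros)
  qed
  show ?thesis
    unfolding statistic_def[abs_def] triple_avg_def by (intro continuous_intros coord)
qed

lemma statistic_right_continuous:
  assumes "cadlag Y" "0 \<le> t"
  shows "continuous (at_right t) (\<lambda>t. statistic N g1 g2 g3 (Y t))"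
proof -
  have "(Y \<longlongrightarrow> Y t) (at_right t)"
    using assms unfolding cadlag_def by (auto simp: continuous_within)
  then show ?thesis
    unfolding continuous_within by (rule isCont_tendsto_compose[OF isCont_statistic])
qed

section \<open>The initial distribution\<close>

text \<open>The deviation is an average of terms \<open>Z x\<close> that depend on disjoint pairs of the independent initial spins, so
the covariances of different terms vanish. That the product of the two spins of a site has mean
\<open>\<psi>1 \<psi>2\<close> again comes from independence.\<close>

lemma (in prob_space) initial_statistic_variance:
  assumes init: "product_initial M N \<psi>1 \<psi>2 X0" and N: "N > 0"
    and X0: "\<And>\<omega>. \<omega> \<in> space M \<Longrightarrow> X0 \<omega> \<in> states N"
    and \<psi>: "\<And>r. r \<in> {0..<1} \<Longrightarrow> \<bar>\<psi>1 r\<bar> \<le> 1" "\<And>r. r \<in> {0..<1} \<Longrightarrow> \<bar>\<psi>2 r\<bar> \<le> 1"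
    and w: "weights_le N 1 g1 g2 g3"
  shows "expectation (\<lambda>\<omega>. (statistic N g1 g2 g3 (X0 \<omega>) - triple_avg N g1 g2 g3
      (\<lambda>x. \<psi>1 (site N x)) (\<lambda>x. \<psi>2 (site N x)) (\<lambda>x. \<psi>1 (site N x) * \<psi>2 (site N x)))\<^sup>2)
    \<le> 36 / real N"
proof -
  note g = weights_leD[OF w]
  define F where "F = (case_sum (\<lambda>x \<omega>. fst (X0 \<omega>) x) (\<lambda>x \<omega>. snd (X0 \<omega>) x) :: nat + nat \<Rightarrow> 'a \<Rightarrow> real)"
  define a where "a x = \<psi>1 (site N x)" for x
  define b where "b x = \<psi>2 (site N x)" for x
  define h where "h x p = g1 x * (p (Inl x) - a x) + g2 x * (p (Inr x) - b x) + g3 x * (p (Inl x) * p (Inr x) - a x * b x)"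
    for x :: nat and p :: "nat + nat \<Rightarrow> real"
  define Z where "Z x \<omega> = h x (\<lambda>i. F i \<omega>)" for x \<omega>
  have ind: "indep_vars (\<lambda>_. borel) F ({..<N} <+> {..<N})"
    using init unfolding product_initial_def F_def by blast
  have ab: "\<bar>a x\<bar> \<le> 1" "\<bar>b x\<bar> \<le> 1" if "x < N" for x
    unfolding a_def b_def using that by (auto intro!: \<psi>)
  have mean: "expectation (F (Inl x)) = a x" "expectation (F (Inr x)) = b x" if "x < N" for x
    using init that unfolding product_initial_def F_def a_def b_def by simp_all
  have Fb: "\<bar>F (Inl x) \<omega>\<bar> = 1" "\<bar>F (Inr x) \<omega>\<bar> = 1" if "x < N" "\<omega> \<in> space M" for x \<omega>
    using abs_spin[OF X0[OF that(2)] that(1)] by (simp_all add: F_def)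
  have Fm: "F (Inl x) \<in> borel_measurable M" "F (Inr x) \<in> borel_measurable M" if "x < N" for x
    using ind that unfolding indep_vars_def by auto
  have Fi: "integrable M (F (Inl x))" "integrable M (F (Inr x))" if "x < N" for x
    using Fb[OF that] Fm[OF that] by (auto intro!: integrable_const_bound[of _ 1] AE_I2)
  have FF: "expectation (\<lambda>\<omega>. F (Inl x) \<omega> * F (Inr x) \<omega>) = a x * b x"
    and FFi: "integrable M (\<lambda>\<omega>. F (Inl x) \<omega> * F (Inr x) \<omega>)" if "x < N" for x
  proof -
    have sub: "indep_vars (\<lambda>_. borel) F {Inl x, Inr x}"
      by (rule indep_vars_subset[OF ind]) (use that in auto)
    have "expectation (\<lambda>\<omega>. \<Prod>i\<in>{Inl x, Inr x}. F i \<omega>) = (\<Prod>i\<in>{Inl x, Inr x}. expectation (F i))"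
      by (rule indep_vars_lebesgue_integral[OF _ sub]) (use Fi[OF that] in auto)
    then show "expectation (\<lambda>\<omega>. F (Inl x) \<omega> * F (Inr x) \<omega>) = a x * b x" using mean[OF that] by simp
    have "integrable M (\<lambda>\<omega>. \<Prod>i\<in>{Inl x, Inr x}. F i \<omega>)"
      by (rule indep_vars_integrable[OF _ sub]) (use Fi[OF that] in auto)
    then show "integrable M (\<lambda>\<omega>. F (Inl x) \<omega> * F (Inr x) \<omega>)" by simp
  qed
  have Zi: "integrable M (Z x)" and Z0: "expectation (Z x) = 0" if "x < N" for x
    unfolding Z_def[abs_def] h_def using Fi[OF that] FF[OF that] FFi[OF that] mean[OF that]
    by (simp_all add: prob_space)
  have Zb: "\<bar>Z x \<omega>\<bar> \<le> 6" if "x < N" "\<omega> \<in> space M" for x \<omega>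
  proof -
    have p: "\<bar>c * (d - e)\<bar> \<le> 2" if "\<bar>c\<bar> \<le> 1" "\<bar>d\<bar> = 1" "\<bar>e\<bar> \<le> 1" for c d e :: real
    proof -
      have "\<bar>c\<bar> * \<bar>d - e\<bar> \<le> 1 * 2" using that by (intro mult_mono) auto
      then show ?thesis by (simp add: abs_mult)
    qed
    have e: "\<bar>a x * b x\<bar> \<le> 1"
      using mult_mono[OF ab(1)[OF that(1)] ab(2)[OF that(1)]] by (simp add: abs_mult)
    have d: "\<bar>F (Inl x) \<omega> * F (Inr x) \<omega>\<bar> = 1" using Fb[OF that] by (simp add: abs_mult)
    show ?thesis
      unfolding Z_def h_def
      using p[OF g(1)[OF that(1)] Fb(1)[OF that] ab(1)[OF that(1)]] p[OF g(2)[OF that(1)] Fb(2)[OF that] ab(2)[OF that(1)]]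
        p[OF g(3)[OF that(1)] d e] by linarith
  qed
  have indZ: "indep_vars (\<lambda>_. borel) Z {..<N}"
  proof -
    let ?K = "\<lambda>x. {Inl x, Inr x} :: (nat + nat) set"
    have "indep_vars (\<lambda>x. PiM (?K x) (\<lambda>_. borel)) (\<lambda>x \<omega>. restrict (\<lambda>i. F i \<omega>) (?K x)) {..<N}"
      by (rule indep_vars_restrict[OF ind]) (auto simp: disjoint_family_on_def)
    then have "indep_vars (\<lambda>_. borel) (\<lambda>x \<omega>. h x (restrict (\<lambda>i. F i \<omega>) (?K x))) {..<N}"
    proof (rule indep_vars_compose2)
      fix x
      have [measurable]: "(\<lambda>p. p (Inl x)) \<in> PiM (?K x) (\<lambda>_. borel) \<rightarrow>\<^sub>M (borel :: real measure)"
        "(\<lambda>p. p (Inr x)) \<in> PiM (?K x) (\<lambda>_. borel) \<rightarrow>\<^sub>M (borel :: real measure)"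
        by (auto intro!: measurable_component_singleton)
      show "h x \<in> PiM (?K x) (\<lambda>_. borel) \<rightarrow>\<^sub>M borel"
        unfolding h_def[abs_def] by measurable
    qed
    moreover have "h x (restrict (\<lambda>i. F i \<omega>) (?K x)) = Z x \<omega>" for x \<omega>
      by (simp add: Z_def h_def)
    ultimately show ?thesis by simp
  qed
  have cov: "expectation (\<lambda>\<omega>. Z x \<omega> * Z y \<omega>) \<le> (if x = y then 36 else 0)"
    and covi: "integrable M (\<lambda>\<omega>. Z x \<omega> * Z y \<omega>)" if "x < N" "y < N" for x y
  proof -
    have b: "\<bar>Z x \<omega> * Z y \<omega>\<bar> \<le> 36" if "\<omega> \<in> space M" for \<omega>
      using mult_mono[OF Zb[OF \<open>x < N\<close> that] Zb[OF \<open>y < N\<close> that]] by (simp add: abs_mult)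
    have [measurable]: "Z x \<in> borel_measurable M" "Z y \<in> borel_measurable M"
      using Zi that by auto
    show i: "integrable M (\<lambda>\<omega>. Z x \<omega> * Z y \<omega>)"
      using b by (intro integrable_const_bound[of _ 36] AE_I2) auto
    show "expectation (\<lambda>\<omega>. Z x \<omega> * Z y \<omega>) \<le> (if x = y then 36 else 0)"
    proof (cases "x = y")
      case True
      have "expectation (\<lambda>\<omega>. Z x \<omega> * Z y \<omega>) \<le> expectation (\<lambda>\<omega>. 36)"
        using b i by (intro integral_mono) (auto simp: abs_le_iff)
      then show ?thesis using True by (simp add: prob_space)
    next
      case False
      have sub: "indep_vars (\<lambda>_. borel) Z {x, y}"
        by (rule indep_vars_subset[OF indZ]) (use that in auto)
      have "expectation (\<lambda>\<omega>. \<Prod>i\<in>{x, y}. Z i \<omega>) = (\<Prod>i\<in>{x, y}. expectation (Z i))"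
        by (rule indep_vars_lebesgue_integral[OF _ sub]) (use Zi that in auto)
      then show ?thesis using False Z0 that by simp
    qed
  qed
  have "expectation (\<lambda>\<omega>. (statistic N g1 g2 g3 (X0 \<omega>) - triple_avg N g1 g2 g3 a b (\<lambda>x. a x * b x))\<^sup>2)
      = expectation (\<lambda>\<omega>. (1 / real N)\<^sup>2 * (\<Sum>x<N. \<Sum>y<N. Z x \<omega> * Z y \<omega>))"
  proof (rule Bochner_Integration.integral_cong[OF refl])
    fix \<omega>
    have "statistic N g1 g2 g3 (X0 \<omega>) - triple_avg N g1 g2 g3 a b (\<lambda>x. a x * b x) = 1 / real N * (\<Sum>x<N. Z x \<omega>)"
      unfolding statistic_def triple_avg_diff unfolding triple_avg_def by (simp add: Z_def h_def F_def)
    then show "(statistic N g1 g2 g3 (X0 \<omega>) - triple_avg N g1 g2 g3 a b (\<lambda>x. a x * b x))\<^sup>2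
        = (1 / real N)\<^sup>2 * (\<Sum>x<N. \<Sum>y<N. Z x \<omega> * Z y \<omega>)"
      by (simp only: power_mult_distrib) (simp only: power2_eq_square sum_product)
  qed
  also have "\<dots> = (1 / real N)\<^sup>2 * (\<Sum>x<N. \<Sum>y<N. expectation (\<lambda>\<omega>. Z x \<omega> * Z y \<omega>))"
  proof -
    have "expectation (\<lambda>\<omega>. \<Sum>x<N. \<Sum>y<N. Z x \<omega> * Z y \<omega>) = (\<Sum>x<N. expectation (\<lambda>\<omega>. \<Sum>y<N. Z x \<omega> * Z y \<omega>))"
      by (rule Bochner_Integration.integral_sum) (auto intro!: Bochner_Integration.integrable_sum covi)
    also have "\<dots> = (\<Sum>x<N. \<Sum>y<N. expectation (\<lambda>\<omega>. Z x \<omega> * Z y \<omega>))"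
      by (intro sum.cong refl Bochner_Integration.integral_sum) (auto intro!: covi)
    finally show ?thesis by simp
  qed
  also have "\<dots> \<le> (1 / real N)\<^sup>2 * (\<Sum>x<N. \<Sum>y<N. if x = y then 36 else 0)"
    using cov by (intro mult_left_mono sum_mono) auto
  also have "\<dots> = 36 / real N"
    using N by (simp add: power2_eq_square field_simps)
  finally show ?thesis unfolding a_def b_def .
qed

section \<open>The limiting system\<close>

lemma kernel_slice_measurable:
  assumes "interaction_kernel \<phi>" "r \<in> {0..<1}"
  shows "set_borel_measurable borel {0..<1} (\<lambda>s. \<phi> s r)"
proof -
  have "continuous_on UNIV (\<lambda>s. \<phi> (frac (fst (s, r))) (frac (snd (s, r))))"
    by (rule continuous_on_compose2[OF continuous_on_kernel_frac[OF assms(1)], where f = "\<lambda>s. (s, r)"])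
      (auto intro!: continuous_intros)
  then have "continuous_on UNIV (\<lambda>s. \<phi> (frac s) r)" using assms(2) by simp
  then have "set_borel_measurable borel {0..<1} (\<lambda>s. \<phi> (frac s) r)"
    unfolding set_borel_measurable_def
    by (intro borel_measurable_scaleR borel_measurable_indicator borel_measurable_continuous_onI) auto
  then show ?thesis
    unfolding set_borel_measurable_def
    by (rule measurable_cong[THEN iffD1, rotated]) (auto simp: indicator_def)
qed

lemma set_integrable_mult_kernel:
  assumes "interaction_kernel \<phi>" "r \<in> {0..<1}" "set_integrable lborel {0..<1} w"
  shows "set_integrable lborel {0..<1} (\<lambda>s. w s * \<phi> s r)"
proof -
  obtain B where "\<forall>r\<in>{0..<1}. \<forall>s\<in>{0..<1}. \<bar>\<phi> r s\<bar> \<le> B"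
    using interaction_kernel_bounded[OF assms(1)] by blast
  then show ?thesis
    using assms by (intro set_integrable_mult_bounded[OF assms(3) _ kernel_slice_measurable[OF assms(1,2)], of B]) auto
qed

text \<open>The modulus depends on the kernel alone, so that it can be used for the solution at all times at once.\<close>

lemma torus_conv_modulus:
  assumes "interaction_kernel \<phi>" "\<epsilon> > 0"
  shows "\<exists>\<delta>>0. \<forall>w U r r'. set_integrable lborel {0..<1} w \<longrightarrow> (\<forall>s\<in>{0..<1}. \<bar>w s\<bar> \<le> U) \<longrightarrow> 
    r \<in> {0..<1} \<longrightarrow> r' \<in> {0..<1} \<longrightarrow> \<bar>r - r'\<bar> < \<delta> \<longrightarrow> \<bar>torus_conv w \<phi> r - torus_conv w \<phi> r'\<bar> \<le> U * \<epsilon>"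
proof -
  obtain \<delta> where "\<delta> > 0" and \<delta>: "\<And>r r' s. r \<in> {0..<1} \<Longrightarrow> r' \<in> {0..<1} \<Longrightarrow> s \<in> {0..<1} \<Longrightarrow> \<bar>r - r'\<bar> < \<delta> \<Longrightarrow> \<bar>\<phi> s r - \<phi> s r'\<bar> < \<epsilon>"
    using interaction_kernel_uniformly_continuous[OF assms] by metis
  have "\<bar>torus_conv w \<phi> r - torus_conv w \<phi> r'\<bar> \<le> U * \<epsilon>"
    if w: "set_integrable lborel {0..<1} w" "\<forall>s\<in>{0..<1}. \<bar>w s\<bar> \<le> U" and r: "r \<in> {0..<1}" "r' \<in> {0..<1}" "\<bar>r - r'\<bar> < \<delta>" for w U r r'
    unfolding torus_conv_def
  proof (rule abs_set_integral_diff_le)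
    show "\<bar>w s * \<phi> s r - w s * \<phi> s r'\<bar> \<le> U * \<epsilon>" if "s \<in> {0..<1}" for s
    proof -
      have "\<bar>w s * \<phi> s r - w s * \<phi> s r'\<bar> = \<bar>w s\<bar> * \<bar>\<phi> s r - \<phi> s r'\<bar>"
        by (simp add: abs_mult right_diff_distrib[symmetric])
      also have "\<dots> \<le> U * \<epsilon>"
        using w(2) that \<delta>[OF r(1,2) that r(3)] by (intro mult_mono) auto
      finally show ?thesis .
    qed
  qed (use set_integrable_mult_kernel[OF assms(1)] w r in auto)
  then show ?thesis using \<open>\<delta> > 0\<close> by blast
qed

lemma riemann_sum_error_product:
  assumes "set_integrable lborel {0..<1} (\<lambda>s. w s * h s)" "N > 0"
    and w: "\<And>r. r \<in> {0..<1} \<Longrightarrow> \<bar>w r\<bar> \<le> U" and h: "\<And>r. r \<in> {0..<1} \<Longrightarrow> \<bar>h r\<bar> \<le> B"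
    and dw: "\<And>r s. r \<in> {0..<1} \<Longrightarrow> s \<in> {0..<1} \<Longrightarrow> \<bar>r - s\<bar> \<le> 1 / real N \<Longrightarrow> \<bar>w r - w s\<bar> \<le> e"
    and dh: "\<And>r s. r \<in> {0..<1} \<Longrightarrow> s \<in> {0..<1} \<Longrightarrow> \<bar>r - s\<bar> \<le> 1 / real N \<Longrightarrow> \<bar>h r - h s\<bar> \<le> e'"
  shows "\<bar>1 / real N * (\<Sum>x<N. w (site N x) * h (site N x)) - (LINT r:{0..<1}|lborel. w r * h r)\<bar> \<le> e * B + U * e'"
proof (rule riemann_sum_error[OF assms(1,2)])
  fix r s :: real assume rs: "r \<in> {0..<1}" "s \<in> {0..<1}" "\<bar>r - s\<bar> \<le> 1 / real N"
  have "w r * h r - w s * h s = (w r - w s) * h r + w s * (h r - h s)" by (simp add: algebra_simps)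
  then have "\<bar>w r * h r - w s * h s\<bar> \<le> \<bar>w r - w s\<bar> * \<bar>h r\<bar> + \<bar>w s\<bar> * \<bar>h r - h s\<bar>"
    by (metis abs_mult abs_triangle_ineq)
  also have "\<dots> \<le> e * B + U * e'"
    using dw[OF rs] dh[OF rs] w[OF rs(2)] h[OF rs(1)] by (intro add_mono mult_mono) auto
  finally show "\<bar>w r * h r - w s * h s\<bar> \<le> e * B + U * e'" .
qed

lemma abs_le_of_sum_squares_le:
  fixes a b c :: real
  assumes "a\<^sup>2 + b\<^sup>2 + c\<^sup>2 \<le> e\<^sup>2" "0 \<le> e"
  shows "\<bar>a\<bar> \<le> e" "\<bar>b\<bar> \<le> e" "\<bar>c\<bar> \<le> e"
proof -
  have "a\<^sup>2 \<le> e\<^sup>2" "b\<^sup>2 \<le> e\<^sup>2" "c\<^sup>2 \<le> e\<^sup>2"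
    using assms(1) zero_le_power2[of a] zero_le_power2[of b] zero_le_power2[of c] by linarith+
  then show "\<bar>a\<bar> \<le> e" "\<bar>b\<bar> \<le> e" "\<bar>c\<bar> \<le> e"
    using assms(2) by (auto intro: power2_le_imp_le)
qed

lemma abs_mult_le_left: "\<bar>b\<bar> \<le> 1 \<Longrightarrow> \<bar>a * b\<bar> \<le> \<bar>a\<bar>" for a b :: real
  by (simp add: abs_mult mult_left_le)

lemma abs_product_diff_le:
  fixes a a' b b' :: real
  assumes "\<bar>b\<bar> \<le> 1" "\<bar>a'\<bar> \<le> U" "\<bar>b - b'\<bar> \<le> \<eta>"
  shows "\<bar>a * b - a' * b'\<bar> \<le> \<bar>a - a'\<bar> + U * \<eta>"
proof -
  have "a * b - a' * b' = (a - a') * b + a' * (b - b')" by (simp add: algebra_simps)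
  then have "\<bar>a * b - a' * b'\<bar> \<le> \<bar>(a - a') * b\<bar> + \<bar>a'\<bar> * \<bar>b - b'\<bar>"
    by (metis abs_mult abs_triangle_ineq)
  also have "\<bar>(a - a') * b\<bar> \<le> \<bar>a - a'\<bar>" by (rule abs_mult_le_left[OF assms(1)])
  also have "\<bar>a'\<bar> * \<bar>b - b'\<bar> \<le> U * \<eta>" using assms by (intro mult_mono) auto
  finally show ?thesis by simp
qed

text \<open>For the differences \<open>d1, d2, d3\<close> of the three components of a solution at two points: \<open>x\<close> and \<open>y\<close> are the
differences of the products of a component with a coefficient, \<open>m\<close> and \<open>m'\<close> those of the coefficients.\<close>

lemma linear_drift_bound:
  fixes d1 d2 d3 m w \<eta> x y :: real
  shows "\<bar>x\<bar> \<le> \<bar>d2\<bar> + w \<Longrightarrow> \<bar>m\<bar> \<le> \<eta> \<Longrightarrow> 0 \<le> w \<Longrightarrow> 0 \<le> \<eta> \<Longrightarrow>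
      \<bar>- d1 + m + x\<bar> \<le> 2 * (\<bar>d1\<bar> + \<bar>d2\<bar> + \<bar>d3\<bar>) + (2 * \<eta> + 2 * w)"
    and "\<bar>x\<bar> \<le> \<bar>d1\<bar> + w \<Longrightarrow> \<bar>m\<bar> \<le> \<eta> \<Longrightarrow> 0 \<le> w \<Longrightarrow> 0 \<le> \<eta> \<Longrightarrow>
      \<bar>- d2 + m - x\<bar> \<le> 2 * (\<bar>d1\<bar> + \<bar>d2\<bar> + \<bar>d3\<bar>) + (2 * \<eta> + 2 * w)"
    and "\<bar>x\<bar> \<le> \<bar>d1\<bar> + w \<Longrightarrow> \<bar>y\<bar> \<le> \<bar>d2\<bar> + w \<Longrightarrow> \<bar>m\<bar> \<le> \<eta> \<Longrightarrow> \<bar>m'\<bar> \<le> \<eta> \<Longrightarrow> 0 \<le> w \<Longrightarrow> 0 \<le> \<eta> \<Longrightarrow>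
      \<bar>- 2 * d3 + m - m' + x + y\<bar> \<le> 2 * (\<bar>d1\<bar> + \<bar>d2\<bar> + \<bar>d3\<bar>) + (2 * \<eta> + 2 * w)"
  by argo+

locale limit_system = spin_model \<beta>1 \<beta>2 lam \<phi>1 \<phi>2
  for \<beta>1 \<beta>2 lam :: real and \<phi>1 \<phi>2 :: "real \<Rightarrow> real \<Rightarrow> real" +
  fixes \<psi>1 \<psi>2 :: "real \<Rightarrow> real" and u1 u2 v :: "real \<Rightarrow> real \<Rightarrow> real" and T :: real
  assumes kernel: "interaction_kernel \<phi>1" "interaction_kernel \<phi>2"
    and initial_profile: "continuous_map torus.mtopology (top_of_set {-1..1}) \<psi>1"
      "continuous_map torus.mtopology (top_of_set {-1..1}) \<psi>2"
    and solves: "solves_limit_system \<beta>1 \<beta>2 lam \<phi>1 \<phi>2 \<psi>1 \<psi>2 u1 u2 v"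
    and T: "T > 0"
begin

definition mean1 where "mean1 t r = tanh_mean \<beta>1 lam (torus_conv (u1 t) \<phi>1 r)"
definition gap1 where "gap1 t r = tanh_half_gap \<beta>1 lam (torus_conv (u1 t) \<phi>1 r)"
definition mean2 where "mean2 t r = tanh_mean \<beta>2 lam (torus_conv (u2 t) \<phi>2 r)"
definition gap2 where "gap2 t r = tanh_half_gap \<beta>2 lam (torus_conv (u2 t) \<phi>2 r)"

definition du1 where "du1 t r = - u1 t r + mean1 t r + u2 t r * gap1 t r"
definition du2 where "du2 t r = - u2 t r + mean2 t r - u1 t r * gap2 t r"
definition dv where "dv t r = - 2 * v t r + gap1 t r - gap2 t r + u1 t r * mean2 t r + u2 t r * mean1 t r"

lemma coefficient_bounds: "\<bar>mean1 t r\<bar> \<le> 1" "\<bar>gap1 t r\<bar> \<le> 1" "\<bar>mean2 t r\<bar> \<le> 1" "\<bar>gap2 t r\<bar> \<le> 1"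
  unfolding mean1_def gap1_def mean2_def gap2_def by (rule tanh_mean_bound tanh_half_gap_bound)+

lemma solution_integrable:
  assumes "0 \<le> t"
  shows "set_integrable lborel {0..<1} (u1 t)" "set_integrable lborel {0..<1} (u2 t)" "set_integrable lborel {0..<1} (v t)"
  using solves assms unfolding solves_limit_system_def by blast+

lemma solution_initial:
  assumes "r \<in> {0..<1}"
  shows "u1 0 r = \<psi>1 r" "u2 0 r = \<psi>2 r" "v 0 r = \<psi>1 r * \<psi>2 r"
  using solves assms unfolding solves_limit_system_def by blast+

lemma solution_derivative:
  assumes "0 \<le> t" "r \<in> {0..<1}"
  shows "((\<lambda>s. u1 s r) has_real_derivative du1 t r) (at t within {0..})"
    and "((\<lambda>s. u2 s r) has_real_derivative du2 t r) (at t within {0..})"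
    and "((\<lambda>s. v s r) has_real_derivative dv t r) (at t within {0..})"
proof -
  note eqs = solves[unfolded solves_limit_system_def Let_def, THEN conjunct2, THEN conjunct2, rule_format, OF assms]
  show "((\<lambda>s. u1 s r) has_real_derivative du1 t r) (at t within {0..})"
    using eqs[THEN conjunct1] unfolding du1_def mean1_def gap1_def tanh_mean_def tanh_half_gap_def by simp
  show "((\<lambda>s. u2 s r) has_real_derivative du2 t r) (at t within {0..})"
    using eqs[THEN conjunct2, THEN conjunct1]
    unfolding du2_def mean2_def gap2_def tanh_mean_def tanh_half_gap_def by simp
  show "((\<lambda>s. v s r) has_real_derivative dv t r) (at t within {0..})"
    using eqs[THEN conjunct2, THEN conjunct2]
    unfolding dv_def mean1_def gap1_def mean2_def gap2_def tanh_mean_def tanh_half_gap_def by simp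
qed

lemma initial_profile_bound:
  assumes "r \<in> {0..<1}" shows "\<bar>\<psi>1 r\<bar> \<le> 1" "\<bar>\<psi>2 r\<bar> \<le> 1"
proof -
  have "\<psi>1 r \<in> {-1..1}" "\<psi>2 r \<in> {-1..1}"
    using continuous_map_image_subset_topspace[OF initial_profile(1)] continuous_map_image_subset_topspace[OF initial_profile(2)] assms
    by (auto simp: image_subset_iff)
  then show "\<bar>\<psi>1 r\<bar> \<le> 1" "\<bar>\<psi>2 r\<bar> \<le> 1" by auto
qed

lemma derivative_bounds:
  shows "\<bar>du1 t r\<bar> \<le> \<bar>u1 t r\<bar> + \<bar>u2 t r\<bar> + 1" "\<bar>du2 t r\<bar> \<le> \<bar>u1 t r\<bar> + \<bar>u2 t r\<bar> + 1"
    "\<bar>dv t r\<bar> \<le> 2 * \<bar>v t r\<bar> + \<bar>u1 t r\<bar> + \<bar>u2 t r\<bar> + 2"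
proof -
  note c = coefficient_bounds[of t r]
  note m = abs_mult_le_left[OF c(2), of "u2 t r"] abs_mult_le_left[OF c(4), of "u1 t r"]
    abs_mult_le_left[OF c(1), of "u2 t r"] abs_mult_le_left[OF c(3), of "u1 t r"]
  show "\<bar>du1 t r\<bar> \<le> \<bar>u1 t r\<bar> + \<bar>u2 t r\<bar> + 1"
    unfolding du1_def using c(1) m(1) by linarith
  show "\<bar>du2 t r\<bar> \<le> \<bar>u1 t r\<bar> + \<bar>u2 t r\<bar> + 1"
    unfolding du2_def using c(3) m(2) by linarith
  show "\<bar>dv t r\<bar> \<le> 2 * \<bar>v t r\<bar> + \<bar>u1 t r\<bar> + \<bar>u2 t r\<bar> + 2"
    unfolding dv_def using c(2,4) m(3,4) by linarith
qed

lemma solution_bounded: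
  "\<exists>U\<ge>1. \<forall>t\<in>{0..T}. \<forall>r\<in>{0..<1}. \<bar>u1 t r\<bar> \<le> U \<and> \<bar>u2 t r\<bar> \<le> U \<and> \<bar>v t r\<bar> \<le> U"
proof -
  define U where "U = 7 * exp (13 * T)"
  have "U \<ge> 1" using T by (simp add: U_def order_trans[OF _ mult_mono[of 1 7 1 "exp (13 * T)"]])
  have "\<bar>u1 t r\<bar> \<le> U \<and> \<bar>u2 t r\<bar> \<le> U \<and> \<bar>v t r\<bar> \<le> U" if t: "t \<in> {0..T}" and r: "r \<in> {0..<1}" for t r
  proof -
    have "(u1 t r)\<^sup>2 + (u2 t r)\<^sup>2 + (v t r)\<^sup>2 \<le> ((u1 0 r)\<^sup>2 + (u2 0 r)\<^sup>2 + (v 0 r)\<^sup>2 + 2\<^sup>2) * exp (13 * t)"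
    proof (rule gronwall_triple[of T])
      fix s :: real assume s: "0 \<le> s" "s \<le> T"
      show "((\<lambda>t. u1 t r) has_real_derivative du1 s r) (at s within {0..})"
        "((\<lambda>t. u2 t r) has_real_derivative du2 s r) (at s within {0..})"
        "((\<lambda>t. v t r) has_real_derivative dv s r) (at s within {0..})"
        using solution_derivative[OF s(1) r] by blast+
      show "\<bar>du1 s r\<bar> \<le> 2 * (\<bar>u1 s r\<bar> + \<bar>u2 s r\<bar> + \<bar>v s r\<bar>) + 2"
        unfolding distrib_left using derivative_bounds(1)[of s r] by linarith
      show "\<bar>du2 s r\<bar> \<le> 2 * (\<bar>u1 s r\<bar> + \<bar>u2 s r\<bar> + \<bar>v s r\<bar>) + 2"
        unfolding distrib_left using derivative_bounds(2)[of s r] by linarith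
      show "\<bar>dv s r\<bar> \<le> 2 * (\<bar>u1 s r\<bar> + \<bar>u2 s r\<bar> + \<bar>v s r\<bar>) + 2"
        unfolding distrib_left using derivative_bounds(3)[of s r] by linarith
    qed (use t in auto)
    \<comment> \<open>three initial values in \<open>{-1..1}\<close>, and \<open>4\<close> from the inhomogeneity \<open>2\<close>\<close>
    also have "\<dots> \<le> 7 * exp (13 * T)"
    proof (rule mult_mono)
      have "(u1 0 r)\<^sup>2 \<le> 1" "(u2 0 r)\<^sup>2 \<le> 1"
        using initial_profile_bound[OF r] unfolding solution_initial[OF r] by (simp_all add: abs_square_le_1)
      moreover have "(v 0 r)\<^sup>2 \<le> 1"
        using initial_profile_bound[OF r] mult_mono[of "\<bar>\<psi>1 r\<bar>" 1 "\<bar>\<psi>2 r\<bar>" 1]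
        unfolding solution_initial[OF r] by (simp add: abs_square_le_1 abs_mult)
      ultimately show "(u1 0 r)\<^sup>2 + (u2 0 r)\<^sup>2 + (v 0 r)\<^sup>2 + 2\<^sup>2 \<le> 7" by simp
    qed (use t in auto)
    also have "\<dots> \<le> U\<^sup>2"
      using \<open>U \<ge> 1\<close> unfolding U_def[symmetric] by (rule self_le_power) simp
    finally have "(u1 t r)\<^sup>2 + (u2 t r)\<^sup>2 + (v t r)\<^sup>2 \<le> U\<^sup>2" .
    from abs_le_of_sum_squares_le[OF this] \<open>U \<ge> 1\<close> show ?thesis by simp
  qed
  then show ?thesis using \<open>U \<ge> 1\<close> by blast
qed

text \<open>A bound for the solution up to time \<open>T\<close>, chosen once and for all.\<close>

definition U where "U = (SOME U. U \<ge> 1 \<and> (\<forall>t\<in>{0..T}. \<forall>r\<in>{0..<1}. \<bar>u1 t r\<bar> \<le> U \<and> \<bar>u2 t r\<bar> \<le> U \<and> \<bar>v t r\<bar> \<le> U))"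

lemma U_ge_1: "U \<ge> 1"
  and solution_le_U: "0 \<le> t \<Longrightarrow> t \<le> T \<Longrightarrow> r \<in> {0..<1} \<Longrightarrow> \<bar>u1 t r\<bar> \<le> U \<and> \<bar>u2 t r\<bar> \<le> U \<and> \<bar>v t r\<bar> \<le> U"
proof -
  have *: "U \<ge> 1 \<and> (\<forall>t\<in>{0..T}. \<forall>r\<in>{0..<1}. \<bar>u1 t r\<bar> \<le> U \<and> \<bar>u2 t r\<bar> \<le> U \<and> \<bar>v t r\<bar> \<le> U)"
    unfolding U_def by (rule someI_ex) (rule solution_bounded)
  show "U \<ge> 1" using * by (rule conjunct1)
  show "\<bar>u1 t r\<bar> \<le> U \<and> \<bar>u2 t r\<bar> \<le> U \<and> \<bar>v t r\<bar> \<le> U" if "0 \<le> t" "t \<le> T" "r \<in> {0..<1}"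
    by (rule *[THEN conjunct2, rule_format]) (use that in auto)
qed

lemma solution_lipschitz_in_time:
  assumes t: "t \<in> {0..T}" "s \<in> {0..T}" and r: "r \<in> {0..<1}"
  shows "\<bar>u1 t r - u1 s r\<bar> \<le> 6 * U * \<bar>t - s\<bar>" "\<bar>u2 t r - u2 s r\<bar> \<le> 6 * U * \<bar>t - s\<bar>" "\<bar>v t r - v s r\<bar> \<le> 6 * U * \<bar>t - s\<bar>"
proof -
  have mvt: "\<bar>f t - f s\<bar> \<le> 6 * U * \<bar>t - s\<bar>"
    if der: "\<And>z. 0 \<le> z \<Longrightarrow> (f has_real_derivative f' z) (at z within {0..})" and bd: "\<And>z. z \<in> {0..T} \<Longrightarrow> \<bar>f' z\<bar> \<le> 6 * U" for f f' :: "real \<Rightarrow> real"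
  proof -
    have "norm (f t - f s) \<le> 6 * U * norm (t - s)"
    proof (rule field_differentiable_bound[where S = "{0..T}" and f' = f'])
      show "(f has_field_derivative f' z) (at z within {0..T})" if "z \<in> {0..T}" for z
        by (rule has_field_derivative_subset[OF der]) (use that in auto)
      show "norm (f' z) \<le> 6 * U" if "z \<in> {0..T}" for z using bd[OF that] by simp
    qed (use t in simp_all)
    then show ?thesis by simp
  qed
  have b: "\<bar>du1 z r\<bar> \<le> 6 * U" "\<bar>du2 z r\<bar> \<le> 6 * U" "\<bar>dv z r\<bar> \<le> 6 * U" if "z \<in> {0..T}" for z
    using derivative_bounds[of z r] solution_le_U[of z r] that r U_ge_1 by simp_all
  show "\<bar>u1 t r - u1 s r\<bar> \<le> 6 * U * \<bar>t - s\<bar>"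
    by (rule mvt[of "\<lambda>t. u1 t r" "\<lambda>t. du1 t r"]) (use solution_derivative(1)[OF _ r] b in auto)
  show "\<bar>u2 t r - u2 s r\<bar> \<le> 6 * U * \<bar>t - s\<bar>"
    by (rule mvt[of "\<lambda>t. u2 t r" "\<lambda>t. du2 t r"]) (use solution_derivative(2)[OF _ r] b in auto)
  show "\<bar>v t r - v s r\<bar> \<le> 6 * U * \<bar>t - s\<bar>"
    by (rule mvt[of "\<lambda>t. v t r" "\<lambda>t. dv t r"]) (use solution_derivative(3)[OF _ r] b in auto)
qed

text \<open>The difference of the solution at two points satisfies a linear system whose inhomogeneity consists of the
differences of the coefficients, hence of the convolutions, at the two points.\<close>

lemma solution_spatial_modulus:
  assumes r: "r \<in> {0..<1}" "r' \<in> {0..<1}" and e: "e \<ge> 0"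
    and conv: "\<And>t. 0 \<le> t \<Longrightarrow> t \<le> T \<Longrightarrow> \<bar>torus_conv (u1 t) \<phi>1 r - torus_conv (u1 t) \<phi>1 r'\<bar> \<le> U * e"
      "\<And>t. 0 \<le> t \<Longrightarrow> t \<le> T \<Longrightarrow> \<bar>torus_conv (u2 t) \<phi>2 r - torus_conv (u2 t) \<phi>2 r'\<bar> \<le> U * e"
    and \<psi>: "\<bar>\<psi>1 r - \<psi>1 r'\<bar> \<le> e" "\<bar>\<psi>2 r - \<psi>2 r'\<bar> \<le> e"
    and \<kappa>: "\<kappa> = 2 * (1 + U) * ((\<bar>\<beta>1\<bar> + \<bar>\<beta>2\<bar>) * U)" and t: "0 \<le> t" "t \<le> T"
  shows "(u1 t r - u1 t r')\<^sup>2 + (u2 t r - u2 t r')\<^sup>2 + (v t r - v t r')\<^sup>2 \<le> (6 + \<kappa>\<^sup>2) * exp (13 * T) * e\<^sup>2"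
proof -
  define \<eta> where "\<eta> = (\<bar>\<beta>1\<bar> + \<bar>\<beta>2\<bar>) * U * e"
  have U0: "0 \<le> U" using U_ge_1 by simp
  have \<eta>0: "0 \<le> \<eta>" unfolding \<eta>_def using U0 e by simp
  have "\<bar>\<beta>1\<bar> * (U * e) \<le> \<eta>" "\<bar>\<beta>2\<bar> * (U * e) \<le> \<eta>"
    unfolding \<eta>_def mult.assoc using U0 e by (simp_all add: mult_right_mono)
  then have coef: "\<bar>mean1 s r - mean1 s r'\<bar> \<le> \<eta>" "\<bar>gap1 s r - gap1 s r'\<bar> \<le> \<eta>"
      "\<bar>mean2 s r - mean2 s r'\<bar> \<le> \<eta>" "\<bar>gap2 s r - gap2 s r'\<bar> \<le> \<eta>" if "0 \<le> s" "s \<le> T" for s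
    unfolding mean1_def gap1_def mean2_def gap2_def
    using conv(1)[OF that, THEN mult_left_mono, of "\<bar>\<beta>1\<bar>"] conv(2)[OF that, THEN mult_left_mono, of "\<bar>\<beta>2\<bar>"]
    by (auto intro: order_trans[OF tanh_mean_lipschitz] order_trans[OF tanh_half_gap_lipschitz])
  have "(u1 t r - u1 t r')\<^sup>2 + (u2 t r - u2 t r')\<^sup>2 + (v t r - v t r')\<^sup>2
     \<le> ((u1 0 r - u1 0 r')\<^sup>2 + (u2 0 r - u2 0 r')\<^sup>2 + (v 0 r - v 0 r')\<^sup>2 + (\<kappa> * e)\<^sup>2) * exp (13 * t)"
  proof (rule gronwall_triple[of T])
    fix s :: real assume s: "0 \<le> s" "s \<le> T"
    show "((\<lambda>t. u1 t r - u1 t r') has_real_derivative du1 s r - du1 s r') (at s within {0..})"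
      "((\<lambda>t. u2 t r - u2 t r') has_real_derivative du2 s r - du2 s r') (at s within {0..})"
      "((\<lambda>t. v t r - v t r') has_real_derivative dv s r - dv s r') (at s within {0..})"
      by (intro DERIV_diff solution_derivative s r)+
    have \<kappa>e: "\<kappa> * e = 2 * \<eta> + 2 * (U * \<eta>)" unfolding \<kappa> \<eta>_def by (simp add: algebra_simps)
    have "0 \<le> U * \<eta>" using U0 \<eta>0 by simp
    note U' = solution_le_U[OF s r(2)]
    note u1' = U'[THEN conjunct1] and u2' = U'[THEN conjunct2, THEN conjunct1]
    note p = abs_product_diff_le[where a = "u2 s r", OF coefficient_bounds(1) u2' coef(1)[OF s]]
      abs_product_diff_le[where a = "u2 s r", OF coefficient_bounds(2) u2' coef(2)[OF s]]
      abs_product_diff_le[where a = "u1 s r", OF coefficient_bounds(3) u1' coef(3)[OF s]]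
      abs_product_diff_le[where a = "u1 s r", OF coefficient_bounds(4) u1' coef(4)[OF s]]
    show "\<bar>du1 s r - du1 s r'\<bar> \<le> 2 * (\<bar>u1 s r - u1 s r'\<bar> + \<bar>u2 s r - u2 s r'\<bar> + \<bar>v s r - v s r'\<bar>) + \<kappa> * e"
    proof -
      have "du1 s r - du1 s r' = - (u1 s r - u1 s r') + (mean1 s r - mean1 s r') + (u2 s r * gap1 s r - u2 s r' * gap1 s r')"
        unfolding du1_def by simp
      then show ?thesis
        unfolding \<kappa>e using linear_drift_bound(1)[OF p(2) coef(1)[OF s] \<open>0 \<le> U * \<eta>\<close> \<eta>0] by (simp only:)
    qed
    show "\<bar>du2 s r - du2 s r'\<bar> \<le> 2 * (\<bar>u1 s r - u1 s r'\<bar> + \<bar>u2 s r - u2 s r'\<bar> + \<bar>v s r - v s r'\<bar>) + \<kappa> * e"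
    proof -
      have "du2 s r - du2 s r' = - (u2 s r - u2 s r') + (mean2 s r - mean2 s r') - (u1 s r * gap2 s r - u1 s r' * gap2 s r')"
        unfolding du2_def by simp
      then show ?thesis
        unfolding \<kappa>e using linear_drift_bound(2)[OF p(4) coef(3)[OF s] \<open>0 \<le> U * \<eta>\<close> \<eta>0] by (simp only:)
    qed
    show "\<bar>dv s r - dv s r'\<bar> \<le> 2 * (\<bar>u1 s r - u1 s r'\<bar> + \<bar>u2 s r - u2 s r'\<bar> + \<bar>v s r - v s r'\<bar>) + \<kappa> * e"
    proof -
      have "dv s r - dv s r' = - 2 * (v s r - v s r') + (gap1 s r - gap1 s r') - (gap2 s r - gap2 s r')
          + (u1 s r * mean2 s r - u1 s r' * mean2 s r') + (u2 s r * mean1 s r - u2 s r' * mean1 s r')"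
        unfolding dv_def by simp
      then show ?thesis
        unfolding \<kappa>e using linear_drift_bound(3)[OF p(3) p(1) coef(2)[OF s] coef(4)[OF s] \<open>0 \<le> U * \<eta>\<close> \<eta>0] by (simp only:)
    qed
  qed (use t in auto)
  also have "\<dots> \<le> ((6 + \<kappa>\<^sup>2) * e\<^sup>2) * exp (13 * T)"
  proof (rule mult_mono)
    have "\<bar>v 0 r - v 0 r'\<bar> \<le> \<bar>\<psi>1 r - \<psi>1 r'\<bar> + 1 * e"
      unfolding solution_initial[OF r(1)] solution_initial[OF r(2)]
      using initial_profile_bound[OF r(1)] initial_profile_bound[OF r(2)] \<psi> by (intro abs_product_diff_le)
    then have v: "\<bar>v 0 r - v 0 r'\<bar>\<^sup>2 \<le> (2 * e)\<^sup>2" using \<psi> by (intro power_mono) auto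
    have u: "\<bar>u1 0 r - u1 0 r'\<bar>\<^sup>2 \<le> e\<^sup>2" "\<bar>u2 0 r - u2 0 r'\<bar>\<^sup>2 \<le> e\<^sup>2"
      unfolding solution_initial[OF r(1)] solution_initial[OF r(2)] 
      by (rule power_mono[OF \<psi>(1) abs_ge_zero] power_mono[OF \<psi>(2) abs_ge_zero])+
    show "(u1 0 r - u1 0 r')\<^sup>2 + (u2 0 r - u2 0 r')\<^sup>2 + (v 0 r - v 0 r')\<^sup>2 + (\<kappa> * e)\<^sup>2 \<le> (6 + \<kappa>\<^sup>2) * e\<^sup>2"
      using u v unfolding power2_abs power_mult_distrib distrib_right by simp
  qed (use t in auto)
  finally show ?thesis by (simp add: mult_ac)
qed

text \<open>A convolution with a continuous kernel has a modulus of continuity that depends on the convolved function only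
through its bound. The solution inherits it through its equations, although it is assumed to be merely
integrable in space.\<close>

lemma solution_equicontinuous:
  assumes "\<epsilon> > 0"
  shows "\<exists>\<delta>>0. \<forall>t\<in>{0..T}. \<forall>r\<in>{0..<1}. \<forall>r'\<in>{0..<1}. \<bar>r - r'\<bar> < \<delta> \<longrightarrow>
    \<bar>u1 t r - u1 t r'\<bar> \<le> \<epsilon> \<and> \<bar>u2 t r - u2 t r'\<bar> \<le> \<epsilon> \<and> \<bar>v t r - v t r'\<bar> \<le> \<epsilon>"
proof -
  define \<kappa> where "\<kappa> = 2 * (1 + U) * ((\<bar>\<beta>1\<bar> + \<bar>\<beta>2\<bar>) * U)"
  define C where "C = (6 + \<kappa>\<^sup>2) * exp (13 * T)"
  have "C > 0" unfolding C_def by (intro mult_pos_pos add_pos_nonneg) auto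
  define e where "e = \<epsilon> / (1 + C)"
  have "e > 0" using assms \<open>C > 0\<close> by (simp add: e_def)
  have Ce: "C * e\<^sup>2 \<le> \<epsilon>\<^sup>2"
  proof -
    have "C * e\<^sup>2 \<le> (1 + C)\<^sup>2 * e\<^sup>2"
      using \<open>C > 0\<close> by (intro mult_right_mono) (auto simp: power2_eq_square algebra_simps)
    also have "\<dots> = \<epsilon>\<^sup>2" unfolding power_mult_distrib[symmetric] e_def using \<open>C > 0\<close> by simp
    finally show ?thesis .
  qed
  obtain d1 where d1: "d1 > 0" "\<And>w U r r'. set_integrable lborel {0..<1} w \<Longrightarrow> (\<forall>s\<in>{0..<1}. \<bar>w s\<bar> \<le> U) \<Longrightarrow>
      r \<in> {0..<1} \<Longrightarrow> r' \<in> {0..<1} \<Longrightarrow> \<bar>r - r'\<bar> < d1 \<Longrightarrow> \<bar>torus_conv w \<phi>1 r - torus_conv w \<phi>1 r'\<bar> \<le> U * e"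
    using torus_conv_modulus[OF kernel(1) \<open>e > 0\<close>] by blast
  obtain d2 where d2: "d2 > 0" "\<And>w U r r'. set_integrable lborel {0..<1} w \<Longrightarrow> (\<forall>s\<in>{0..<1}. \<bar>w s\<bar> \<le> U) \<Longrightarrow>
      r \<in> {0..<1} \<Longrightarrow> r' \<in> {0..<1} \<Longrightarrow> \<bar>r - r'\<bar> < d2 \<Longrightarrow> \<bar>torus_conv w \<phi>2 r - torus_conv w \<phi>2 r'\<bar> \<le> U * e"
    using torus_conv_modulus[OF kernel(2) \<open>e > 0\<close>] by blast
  obtain d3 where d3: "d3 > 0" "\<And>r s. r \<in> {0..<1} \<Longrightarrow> s \<in> {0..<1} \<Longrightarrow> \<bar>r - s\<bar> < d3 \<Longrightarrow> \<bar>\<psi>1 r - \<psi>1 s\<bar> < e"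
    using torus_uniformly_continuous[OF continuous_map_into_fulltopology[OF initial_profile(1)] \<open>e > 0\<close>] by blast
  obtain d4 where d4: "d4 > 0" "\<And>r s. r \<in> {0..<1} \<Longrightarrow> s \<in> {0..<1} \<Longrightarrow> \<bar>r - s\<bar> < d4 \<Longrightarrow> \<bar>\<psi>2 r - \<psi>2 s\<bar> < e"
    using torus_uniformly_continuous[OF continuous_map_into_fulltopology[OF initial_profile(2)] \<open>e > 0\<close>] by blast
  define \<delta> where "\<delta> = min (min d1 d2) (min d3 d4)"
  have "\<bar>u1 t r - u1 t r'\<bar> \<le> \<epsilon> \<and> \<bar>u2 t r - u2 t r'\<bar> \<le> \<epsilon> \<and> \<bar>v t r - v t r'\<bar> \<le> \<epsilon>"
    if t: "t \<in> {0..T}" and r: "r \<in> {0..<1}" "r' \<in> {0..<1}" "\<bar>r - r'\<bar> < \<delta>" for t r r'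
  proof -
    have \<delta>': "\<bar>r - r'\<bar> < d1" "\<bar>r - r'\<bar> < d2" "\<bar>r - r'\<bar> < d3" "\<bar>r - r'\<bar> < d4" using r(3) unfolding \<delta>_def by simp_all
    have "(u1 t r - u1 t r')\<^sup>2 + (u2 t r - u2 t r')\<^sup>2 + (v t r - v t r')\<^sup>2 \<le> (6 + \<kappa>\<^sup>2) * exp (13 * T) * e\<^sup>2"
    proof (rule solution_spatial_modulus[OF r(1,2) _ _ _ _ _ \<kappa>_def])
      show "\<bar>torus_conv (u1 s) \<phi>1 r - torus_conv (u1 s) \<phi>1 r'\<bar> \<le> U * e" if "0 \<le> s" "s \<le> T" for s
        using solution_le_U[OF that] by (intro d1(2)[OF solution_integrable(1)[OF that(1)] _ r(1,2) \<delta>'(1)]) blast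
      show "\<bar>torus_conv (u2 s) \<phi>2 r - torus_conv (u2 s) \<phi>2 r'\<bar> \<le> U * e" if "0 \<le> s" "s \<le> T" for s
        using solution_le_U[OF that] by (intro d2(2)[OF solution_integrable(2)[OF that(1)] _ r(1,2) \<delta>'(2)]) blast
      show "\<bar>\<psi>1 r - \<psi>1 r'\<bar> \<le> e" "\<bar>\<psi>2 r - \<psi>2 r'\<bar> \<le> e"
        using d3(2)[OF r(1,2) \<delta>'(3)] d4(2)[OF r(1,2) \<delta>'(4)] by simp_all
    qed (use t \<open>e > 0\<close> in auto)
    also have "\<dots> \<le> \<epsilon>\<^sup>2" using Ce unfolding C_def .
    finally show ?thesis using abs_le_of_sum_squares_le assms by (metis less_imp_le)
  qed
  moreover have "\<delta> > 0" using d1(1) d2(1) d3(1) d4(1) by (simp add: \<delta>_def)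
  ultimately show ?thesis by blast
qed

text \<open>A whole family \<open>H\<close> of weights is admitted because the convolutions have to be approximated uniformly in the
point at which they are evaluated.\<close>

lemma riemann_sums_solution:
  assumes w: "w = u1 \<or> w = u2 \<or> w = v" and "B > 0" and "\<rho> > 0"
    and int: "\<And>h t. h \<in> H \<Longrightarrow> 0 \<le> t \<Longrightarrow> set_integrable lborel {0..<1} (\<lambda>s. w t s * h s)"
    and bound: "\<And>h r. h \<in> H \<Longrightarrow> r \<in> {0..<1} \<Longrightarrow> \<bar>h r\<bar> \<le> B"
    and equicontinuous: "\<And>\<epsilon>. \<epsilon> > 0 \<Longrightarrow> \<exists>\<delta>>0. \<forall>h\<in>H. \<forall>r\<in>{0..<1}. \<forall>s\<in>{0..<1}. \<bar>r - s\<bar> < \<delta> \<longrightarrow> \<bar>h r - h s\<bar> < \<epsilon>"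
  shows "\<exists>N0. \<forall>N\<ge>N0. \<forall>t\<in>{0..T}. \<forall>h\<in>H.
    \<bar>1 / real N * (\<Sum>x<N. w t (site N x) * h (site N x)) - (LINT r:{0..<1}|lborel. w t r * h r)\<bar> \<le> \<rho>"
proof -
  have U: "U > 0" using U_ge_1 by simp
  define e where "e = \<rho> / (2 * B)"
  define e' where "e' = \<rho> / (2 * U)"
  have e: "e > 0" "e' > 0" "e * B + U * e' = \<rho>"
    using \<open>\<rho> > 0\<close> U \<open>B > 0\<close> by (simp_all add: e_def e'_def field_simps)
  obtain d0 where d0: "d0 > 0" "\<And>t r r'. t \<in> {0..T} \<Longrightarrow> r \<in> {0..<1} \<Longrightarrow> r' \<in> {0..<1} \<Longrightarrow> \<bar>r - r'\<bar> < d0 \<Longrightarrow>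
      \<bar>u1 t r - u1 t r'\<bar> \<le> e \<and> \<bar>u2 t r - u2 t r'\<bar> \<le> e \<and> \<bar>v t r - v t r'\<bar> \<le> e"
    using solution_equicontinuous[OF e(1)] by metis
  obtain d1 where d1: "d1 > 0" "\<And>h r s. h \<in> H \<Longrightarrow> r \<in> {0..<1} \<Longrightarrow> s \<in> {0..<1} \<Longrightarrow> \<bar>r - s\<bar> < d1 \<Longrightarrow> \<bar>h r - h s\<bar> < e'"
    using equicontinuous[OF e(2)] by blast
  obtain N0 where N0: "N0 > 0" "1 / real N0 < min d0 d1"
    using d0(1) d1(1) by (metis min_less_iff_conj nat_approx_posE of_nat_Suc zero_less_Suc)
  have "\<bar>1 / real N * (\<Sum>x<N. w t (site N x) * h (site N x)) - (LINT r:{0..<1}|lborel. w t r * h r)\<bar> \<le> \<rho>"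
    if N: "N \<ge> N0" and t: "t \<in> {0..T}" and h: "h \<in> H" for N t h
    unfolding e(3)[symmetric]
  proof (rule riemann_sum_error_product)
    have "1 / real N \<le> 1 / real N0" using N N0(1) by (simp add: frac_le)
    then have small: "1 / real N < d0" "1 / real N < d1" using N0(2) by linarith+
    have t': "0 \<le> t" "t \<le> T" using t by auto
    show "set_integrable lborel {0..<1} (\<lambda>s. w t s * h s)" by (rule int[OF h t'(1)])
    show "N > 0" using N N0 by simp
    show "\<bar>h s\<bar> \<le> B" if "s \<in> {0..<1}" for s by (rule bound[OF h that])
    show "\<bar>w t s\<bar> \<le> U" if "s \<in> {0..<1}" for s using solution_le_U[OF t' that] w by blast
    show "\<bar>w t s - w t s'\<bar> \<le> e" if "s \<in> {0..<1}" "s' \<in> {0..<1}" "\<bar>s - s'\<bar> \<le> 1 / real N" for s s'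
    proof -
      have "\<bar>s - s'\<bar> < d0" using that small by linarith
      from d0(2)[OF t that(1,2) this] show ?thesis using w by blast
    qed
    show "\<bar>h s - h s'\<bar> \<le> e'" if "s \<in> {0..<1}" "s' \<in> {0..<1}" "\<bar>s - s'\<bar> \<le> 1 / real N" for s s'
      using d1(2)[OF h that(1,2)] that(3) small by linarith
  qed
  then show ?thesis by blast
qed

abbreviation conv_error where
  "conv_error w \<phi> N t x \<equiv>
     \<bar>1 / real N * (\<Sum>y<N. w t (site N y) * \<phi> (site N x) (site N y)) - torus_conv (w t) \<phi> (site N x)\<bar>"

lemma riemann_convolution:
  assumes \<phi>: "interaction_kernel \<phi>" and w: "w = u1 \<or> w = u2" and "\<rho> > 0"
  shows "\<exists>N0. \<forall>N\<ge>N0. \<forall>t\<in>{0..T}. \<forall>x<N. conv_error w \<phi> N t x \<le> \<rho>"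
proof -
  obtain B where B: "B > 0" "\<And>r s. r \<in> {0..<1} \<Longrightarrow> s \<in> {0..<1} \<Longrightarrow> \<bar>\<phi> r s\<bar> \<le> B"
    using interaction_kernel_bounded[OF \<phi>] by metis
  let ?H = "(\<lambda>r s. \<phi> s r) ` {0..<1}"
  have "\<exists>N0. \<forall>N\<ge>N0. \<forall>t\<in>{0..T}. \<forall>h\<in>?H.
    \<bar>1 / real N * (\<Sum>x<N. w t (site N x) * h (site N x)) - (LINT r:{0..<1}|lborel. w t r * h r)\<bar> \<le> \<rho>"
  proof (rule riemann_sums_solution[OF _ B(1) \<open>\<rho> > 0\<close>])
    show "set_integrable lborel {0..<1} (\<lambda>s. w t s * h s)" if h: "h \<in> ?H" and t: "0 \<le> t" for h t
      using h w solution_integrable[OF t] by (auto intro!: set_integrable_mult_kernel[OF \<phi>])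
    show "\<exists>\<delta>>0. \<forall>h\<in>?H. \<forall>r\<in>{0..<1}. \<forall>s\<in>{0..<1}. \<bar>r - s\<bar> < \<delta> \<longrightarrow> \<bar>h r - h s\<bar> < \<epsilon>" if \<epsilon>: "\<epsilon> > 0" for \<epsilon>
    proof -
      obtain \<delta> where "\<delta> > 0" and \<delta>: "\<forall>r\<in>{0..<1}. \<forall>r'\<in>{0..<1}. \<forall>s\<in>{0..<1}. \<bar>r - r'\<bar> < \<delta> \<longrightarrow> \<bar>\<phi> s r - \<phi> s r'\<bar> < \<epsilon>"
        using interaction_kernel_uniformly_continuous[OF \<phi> \<epsilon>] by blast
      have "\<bar>\<phi> r q - \<phi> s q\<bar> < \<epsilon>" if "q \<in> {0..<1}" "r \<in> {0..<1}" "s \<in> {0..<1}" "\<bar>r - s\<bar> < \<delta>" for q r s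
        using \<delta>[rule_format, OF that(2,3,1,4)] interaction_kernel_sym[OF \<phi>] that by simp
      then show ?thesis using \<open>\<delta> > 0\<close> by (intro exI[of _ \<delta>]) auto
    qed
  qed (use B(2) w in auto)
  then obtain N0 where N0: "\<forall>N\<ge>N0. \<forall>t\<in>{0..T}. \<forall>h\<in>?H.
    \<bar>1 / real N * (\<Sum>x<N. w t (site N x) * h (site N x)) - (LINT r:{0..<1}|lborel. w t r * h r)\<bar> \<le> \<rho>" by (rule exE)
  have "conv_error w \<phi> N t x \<le> \<rho>" if N: "N \<ge> N0" and t: "t \<in> {0..T}" and x: "x < N" for N t x
  proof -
    have sym: "\<phi> (site N x) (site N y) = \<phi> (site N y) (site N x)" if "y < N" for y
      using that x by (intro interaction_kernel_sym[OF \<phi>]) auto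
    have "\<bar>1 / real N * (\<Sum>y<N. w t (site N y) * \<phi> (site N y) (site N x)) - (LINT r:{0..<1}|lborel. w t r * \<phi> r (site N x))\<bar> \<le> \<rho>"
      using N0[rule_format, OF N t imageI[of "site N x"]] x by simp
    then show ?thesis unfolding torus_conv_def using sym by simp
  qed
  then show ?thesis by blast
qed

lemma set_integrable_mult_torus_continuous:
  assumes "continuous_map torus.mtopology euclideanreal G" "set_integrable lborel {0..<1} w"
  shows "set_integrable lborel {0..<1} (\<lambda>s. w s * G s)"
proof -
  obtain B where "\<forall>r\<in>{0..<1}. \<bar>G r\<bar> \<le> B" using torus_continuous_bounded[OF assms(1)] by blast
  then show ?thesis
    by (intro set_integrable_mult_bounded[OF assms(2) _ borel_measurable_torus_continuous[OF assms(1)], of B]) auto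
qed

lemma riemann_pairing:
  assumes G: "continuous_map torus.mtopology euclideanreal G" and "\<rho> > 0" and w: "w = u1 \<or> w = u2 \<or> w = v"
  shows "\<exists>N0. \<forall>N\<ge>N0. \<forall>t\<in>{0..T}. \<bar>1 / real N * (\<Sum>x<N. w t (site N x) * G (site N x)) - torus_pairing (w t) G\<bar> \<le> \<rho>"
proof -
  obtain B where B: "B \<ge> 0" "\<forall>r\<in>{0..<1}. \<bar>G r\<bar> \<le> B" using torus_continuous_bounded[OF G] by blast
  have "\<exists>N0. \<forall>N\<ge>N0. \<forall>t\<in>{0..T}. \<forall>h\<in>{G}.
    \<bar>1 / real N * (\<Sum>x<N. w t (site N x) * h (site N x)) - (LINT r:{0..<1}|lborel. w t r * h r)\<bar> \<le> \<rho>"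
  proof (rule riemann_sums_solution[OF w _ \<open>\<rho> > 0\<close>])
    show "B + 1 > 0" using B by simp
    show "\<bar>h r\<bar> \<le> B + 1" if "h \<in> {G}" "r \<in> {0..<1}" for h r using B(2) that by force
    show "set_integrable lborel {0..<1} (\<lambda>s. w t s * h s)" if h: "h \<in> {G}" and t: "0 \<le> t" for h t
      using h w solution_integrable[OF t] by (auto intro!: set_integrable_mult_torus_continuous[OF G])
    show "\<exists>\<delta>>0. \<forall>h\<in>{G}. \<forall>r\<in>{0..<1}. \<forall>s\<in>{0..<1}. \<bar>r - s\<bar> < \<delta> \<longrightarrow> \<bar>h r - h s\<bar> < \<epsilon>" if "\<epsilon> > 0" for \<epsilon>
      using torus_uniformly_continuous[OF G that] by simp
  qed
  then show ?thesis unfolding torus_pairing_def by simp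
qed

lemma pairing_lipschitz_in_time:
  assumes G: "continuous_map torus.mtopology euclideanreal G" and B: "\<And>r. r \<in> {0..<1} \<Longrightarrow> \<bar>G r\<bar> \<le> B"
    and w: "w = u1 \<or> w = u2 \<or> w = v" and t: "t \<in> {0..T}" "s \<in> {0..T}"
  shows "\<bar>torus_pairing (w t) G - torus_pairing (w s) G\<bar> \<le> 6 * U * B * \<bar>t - s\<bar>"
  unfolding torus_pairing_def
proof (rule abs_set_integral_diff_le)
  show "set_integrable lborel {0..<1} (\<lambda>r. w t r * G r)" "set_integrable lborel {0..<1} (\<lambda>r. w s r * G r)"
    using w solution_integrable[of t] solution_integrable[of s] t by (auto intro!: set_integrable_mult_torus_continuous[OF G])
  fix r :: real assume r: "r \<in> {0..<1}"
  have "\<bar>w t r * G r - w s r * G r\<bar> = \<bar>w t r - w s r\<bar> * \<bar>G r\<bar>"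
    by (simp add: abs_mult left_diff_distrib[symmetric])
  also have "\<dots> \<le> (6 * U * \<bar>t - s\<bar>) * B"
    using solution_lipschitz_in_time[OF t r] w B[OF r] U_ge_1 by (intro mult_mono) auto
  finally show "\<bar>w t r * G r - w s r * G r\<bar> \<le> 6 * U * B * \<bar>t - s\<bar>" by (simp add: mult_ac)
qed

end

section \<open>Mean square convergence at fixed times\<close>

lemma square_avg_le: "(1 / real N * (\<Sum>x<N. f x))\<^sup>2 \<le> 1 / real N * (\<Sum>x<N. (f x)\<^sup>2)"
proof (cases "N = 0")
  case False
  have "(\<Sum>x<N. f x)\<^sup>2 \<le> real N * (\<Sum>x<N. (f x)\<^sup>2)"
    using sum_squared_le_sum_of_squares[of f "{..<N}"] by (simp add: mult.commute)
  then have "(1 / real N)\<^sup>2 * (\<Sum>x<N. f x)\<^sup>2 \<le> (1 / real N)\<^sup>2 * (real N * (\<Sum>x<N. (f x)\<^sup>2))"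
    by (intro mult_left_mono) auto
  also have "\<dots> = 1 / real N * (\<Sum>x<N. (f x)\<^sup>2)" using False by (simp add: power2_eq_square)
  finally show ?thesis by (simp only: power_mult_distrib)
qed simp

lemma square_sum_le: "(a + b)\<^sup>2 \<le> 2 * a\<^sup>2 + 2 * b\<^sup>2" for a b :: real
  using sum_squares_bound[of a b] by (simp add: power2_sum)

locale spin_process = limit_system \<beta>1 \<beta>2 lam \<phi>1 \<phi>2 \<psi>1 \<psi>2 u1 u2 v T + prob_space M
  for \<beta>1 \<beta>2 lam :: real and \<phi>1 \<phi>2 :: "real \<Rightarrow> real \<Rightarrow> real" and \<psi>1 \<psi>2 :: "real \<Rightarrow> real"
    and u1 u2 v :: "real \<Rightarrow> real \<Rightarrow> real" and T :: real and M :: "'w measure" +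
  fixes X :: "nat \<Rightarrow> real \<Rightarrow> 'w \<Rightarrow> config \<times> config"
  assumes process: "\<And>N. N \<ge> 1 \<Longrightarrow> markov_process_with_generator M (states N) (generator N \<beta>1 \<beta>2 lam \<phi>1 \<phi>2) (X N)"
    and initial: "\<And>N. N \<ge> 1 \<Longrightarrow> product_initial M N \<psi>1 \<psi>2 (X N 0)"
begin

lemma process_finite_state_markov:
  assumes "N \<ge> 1"
  shows "finite_state_markov M (states N) (gen N) (X N) (4 * real N)"
proof
  show "finite (states N)" by (rule finite_states)
  show "\<bar>gen N f x\<bar> \<le> 4 * real N * C" if "x \<in> states N" "\<And>y. y \<in> states N \<Longrightarrow> \<bar>f y\<bar> \<le> C" for f x C
    by (rule gen_bounded) (use that in auto)
  show "markov_process_with_generator M (states N) (gen N) (X N)" by (rule process[OF assms])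
qed

definition limit_avg where
  "limit_avg N g1 g2 g3 t = triple_avg N g1 g2 g3 (\<lambda>x. u1 t (site N x)) (\<lambda>x. u2 t (site N x)) (\<lambda>x. v t (site N x))"

definition limit_avg_deriv where
  "limit_avg_deriv N g1 g2 g3 t = triple_avg N g1 g2 g3 (\<lambda>x. du1 t (site N x)) (\<lambda>x. du2 t (site N x)) (\<lambda>x. dv t (site N x))"

abbreviation deviation where
  "deviation N g1 g2 g3 t \<sigma> \<equiv> statistic N g1 g2 g3 \<sigma> - limit_avg N g1 g2 g3 t"

abbreviation deviation_drift where
  "deviation_drift N g1 g2 g3 t \<sigma> \<equiv> gen N (\<lambda>\<sigma>. (deviation N g1 g2 g3 t \<sigma>)\<^sup>2) \<sigma>
     - 2 * limit_avg_deriv N g1 g2 g3 t * deviation N g1 g2 g3 t \<sigma>"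

definition mean_square_deviation where
  "mean_square_deviation N g1 g2 g3 t = expectation (\<lambda>\<omega>. (deviation N g1 g2 g3 t (X N t \<omega>))\<^sup>2)"

lemma limit_avg_has_derivative:
  assumes "0 \<le> t"
  shows "(limit_avg N g1 g2 g3 has_real_derivative limit_avg_deriv N g1 g2 g3 t) (at t within {0..})"
  unfolding limit_avg_def[abs_def] limit_avg_deriv_def triple_avg_def
  by (intro DERIV_cmult DERIV_sum DERIV_add solution_derivative[OF assms]) auto

text \<open>The remainder in the last two lines collects what comes from replacing the field of the limit by the
field of the configuration in the coefficients. The rest is linear in the deviation, and the transposed linear map
acts on the weights.\<close>

lemma drift_decomposition:
  fixes t :: real
  assumes \<sigma>: "\<sigma> \<in> states N"
  defines "m1 \<equiv> \<lambda>x. site_mean1 N \<sigma> x - mean1 t (site N x)" and "k1 \<equiv> \<lambda>x. site_gap1 N \<sigma> x - gap1 t (site N x)"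
    and "m2 \<equiv> \<lambda>x. site_mean2 N \<sigma> x - mean2 t (site N x)" and "k2 \<equiv> \<lambda>x. site_gap2 N \<sigma> x - gap2 t (site N x)"
  shows "gen N (statistic N g1 g2 g3) \<sigma> - limit_avg_deriv N g1 g2 g3 t
     = deviation N (\<lambda>x. - g1 x - g2 x * gap2 t (site N x) + g3 x * mean2 t (site N x))
         (\<lambda>x. - g2 x + g1 x * gap1 t (site N x) + g3 x * mean1 t (site N x)) (\<lambda>x. - 2 * g3 x) t \<sigma>
       + 1 / real N * (\<Sum>x<N. g1 x * (m1 x + snd \<sigma> x * k1 x) + g2 x * (m2 x - fst \<sigma> x * k2 x)
            + g3 x * (k1 x - k2 x + fst \<sigma> x * m2 x + snd \<sigma> x * m1 x))"
  unfolding gen_statistic[OF \<sigma>] limit_avg_deriv_def statistic_def limit_avg_def triple_avg_diff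
  unfolding triple_avg_def distrib_left[symmetric] sum.distrib[symmetric]
  by (rule arg_cong[where f = "\<lambda>s. 1 / real N * s"], rule sum.cong)
    (simp_all add: du1_def du2_def dv_def m1_def m2_def k1_def k2_def algebra_simps)

text \<open>The field at site \<open>x\<close> is itself a statistic, with weights \<open>\<phi>\<^sub>i(x, -)\<close> in one slot.\<close>

lemma conv_deviation:
  assumes err: "conv_error u1 \<phi>1 N t x \<le> \<rho>"
      "conv_error u2 \<phi>2 N t x \<le> \<rho>"
  shows "(config_conv N (fst \<sigma>) \<phi>1 x - torus_conv (u1 t) \<phi>1 (site N x))\<^sup>2
      \<le> 2 * (deviation N (\<lambda>y. \<phi>1 (site N x) (site N y)) (\<lambda>_. 0) (\<lambda>_. 0) t \<sigma>)\<^sup>2 + 2 * \<rho>\<^sup>2"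
    and "(config_conv N (snd \<sigma>) \<phi>2 x - torus_conv (u2 t) \<phi>2 (site N x))\<^sup>2
      \<le> 2 * (deviation N (\<lambda>_. 0) (\<lambda>y. \<phi>2 (site N x) (site N y)) (\<lambda>_. 0) t \<sigma>)\<^sup>2 + 2 * \<rho>\<^sup>2"
proof -
  have key: "c\<^sup>2 \<le> 2 * d\<^sup>2 + 2 * \<rho>\<^sup>2" if "c = d + e" "\<bar>e\<bar> \<le> \<rho>" for c d e :: real
  proof -
    have "\<bar>e\<bar>\<^sup>2 \<le> \<rho>\<^sup>2" using that(2) by (intro power_mono) auto
    then show ?thesis using square_sum_le[of d e] that(1) by simp
  qed
  show "(config_conv N (fst \<sigma>) \<phi>1 x - torus_conv (u1 t) \<phi>1 (site N x))\<^sup>2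
      \<le> 2 * (deviation N (\<lambda>y. \<phi>1 (site N x) (site N y)) (\<lambda>_. 0) (\<lambda>_. 0) t \<sigma>)\<^sup>2 + 2 * \<rho>\<^sup>2"
    by (rule key[OF _ err(1)]) (simp add: config_conv_def statistic_def limit_avg_def triple_avg_def mult.commute)
  show "(config_conv N (snd \<sigma>) \<phi>2 x - torus_conv (u2 t) \<phi>2 (site N x))\<^sup>2
      \<le> 2 * (deviation N (\<lambda>_. 0) (\<lambda>y. \<phi>2 (site N x) (site N y)) (\<lambda>_. 0) t \<sigma>)\<^sup>2 + 2 * \<rho>\<^sup>2"
    by (rule key[OF _ err(2)]) (simp add: config_conv_def statistic_def limit_avg_def triple_avg_def mult.commute)
qed

lemma nonlinear_remainder_bound:
  fixes t :: real
  assumes \<sigma>: "\<sigma> \<in> states N" and x: "x < N" and g: "\<bar>g1 x\<bar> \<le> 1" "\<bar>g2 x\<bar> \<le> 1" "\<bar>g3 x\<bar> \<le> 1"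
  defines "m1 \<equiv> site_mean1 N \<sigma> x - mean1 t (site N x)" and "k1 \<equiv> site_gap1 N \<sigma> x - gap1 t (site N x)"
    and "m2 \<equiv> site_mean2 N \<sigma> x - mean2 t (site N x)" and "k2 \<equiv> site_gap2 N \<sigma> x - gap2 t (site N x)"
  shows "(g1 x * (m1 + snd \<sigma> x * k1) + g2 x * (m2 - fst \<sigma> x * k2) + g3 x * (k1 - k2 + fst \<sigma> x * m2 + snd \<sigma> x * m1))\<^sup>2
    \<le> 32 * (\<beta>1\<^sup>2 * (config_conv N (fst \<sigma>) \<phi>1 x - torus_conv (u1 t) \<phi>1 (site N x))\<^sup>2
          + \<beta>2\<^sup>2 * (config_conv N (snd \<sigma>) \<phi>2 x - torus_conv (u2 t) \<phi>2 (site N x))\<^sup>2)"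
proof -
  define A1 where "A1 = \<bar>\<beta>1\<bar> * \<bar>config_conv N (fst \<sigma>) \<phi>1 x - torus_conv (u1 t) \<phi>1 (site N x)\<bar>"
  define A2 where "A2 = \<bar>\<beta>2\<bar> * \<bar>config_conv N (snd \<sigma>) \<phi>2 x - torus_conv (u2 t) \<phi>2 (site N x)\<bar>"
  have d: "\<bar>m1\<bar> \<le> A1" "\<bar>k1\<bar> \<le> A1" "\<bar>m2\<bar> \<le> A2" "\<bar>k2\<bar> \<le> A2"
    unfolding m1_def k1_def m2_def k2_def A1_def A2_def site_mean1_def site_gap1_def site_mean2_def site_gap2_def
      mean1_def gap1_def mean2_def gap2_def
    by (rule tanh_mean_lipschitz tanh_half_gap_lipschitz)+
  have s: "\<bar>fst \<sigma> x * y\<bar> = \<bar>y\<bar>" "\<bar>snd \<sigma> x * y\<bar> = \<bar>y\<bar>" for y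
    using abs_spin[OF \<sigma> x] by (simp_all add: abs_mult)
  have w: "\<bar>c * y\<bar> \<le> \<bar>y\<bar>" if "\<bar>c\<bar> \<le> 1" for c y :: real
    using abs_mult_le_left[OF that, of y] by (simp add: mult.commute)
  have "\<bar>m1 + snd \<sigma> x * k1\<bar> \<le> 2 * A1" using s(2)[of k1] d by linarith
  then have 1: "\<bar>g1 x * (m1 + snd \<sigma> x * k1)\<bar> \<le> 2 * A1" using w[OF g(1)] order_trans by blast
  have "\<bar>m2 - fst \<sigma> x * k2\<bar> \<le> 2 * A2" using s(1)[of k2] d by linarith
  then have 2: "\<bar>g2 x * (m2 - fst \<sigma> x * k2)\<bar> \<le> 2 * A2" using w[OF g(2)] order_trans by blast
  have "\<bar>k1 - k2 + fst \<sigma> x * m2 + snd \<sigma> x * m1\<bar> \<le> 2 * A1 + 2 * A2" using s(1)[of m2] s(2)[of m1] d by linarith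
  then have 3: "\<bar>g3 x * (k1 - k2 + fst \<sigma> x * m2 + snd \<sigma> x * m1)\<bar> \<le> 2 * A1 + 2 * A2" using w[OF g(3)] order_trans by blast
  have "\<bar>g1 x * (m1 + snd \<sigma> x * k1) + g2 x * (m2 - fst \<sigma> x * k2) + g3 x * (k1 - k2 + fst \<sigma> x * m2 + snd \<sigma> x * m1)\<bar> \<le> 4 * A1 + 4 * A2"
    using 1 2 3 by linarith
  then have "\<bar>g1 x * (m1 + snd \<sigma> x * k1) + g2 x * (m2 - fst \<sigma> x * k2) + g3 x * (k1 - k2 + fst \<sigma> x * m2 + snd \<sigma> x * m1)\<bar>\<^sup>2 \<le> (4 * A1 + 4 * A2)\<^sup>2"
    by (intro power_mono) auto
  also have "(4 * A1 + 4 * A2)\<^sup>2 = 16 * (A1 + A2)\<^sup>2" unfolding distrib_left[symmetric] power_mult_distrib by simp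
  also have "\<dots> \<le> 16 * (2 * A1\<^sup>2 + 2 * A2\<^sup>2)" using square_sum_le[of A1 A2] by simp
  also have "\<dots> = 32 * (A1\<^sup>2 + A2\<^sup>2)" by simp
  finally show ?thesis unfolding A1_def A2_def power_mult_distrib power2_abs .
qed

text \<open>With \<open>d\<close> the deviation and \<open>G\<close> its drift, the left-hand side is \<open>2 d G\<close> up to the square field of order \<open>1/N\<close>;
then \<open>2 d G \<le> d\<^sup>2 + G\<^sup>2\<close>, and \<open>G\<close> is replaced by its decomposition. Jensen's inequality moves the square inside
the average over sites. The result is a combination of squares of deviations with other weights.\<close>

lemma generator_deviation_bound:
  assumes N: "N \<ge> 1" and \<sigma>: "\<sigma> \<in> states N" and w: "weights_le N 1 g1 g2 g3"
    and err: "\<And>x. x < N \<Longrightarrow> conv_error u1 \<phi>1 N t x \<le> \<rho>"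
      "\<And>x. x < N \<Longrightarrow> conv_error u2 \<phi>2 N t x \<le> \<rho>"
  shows "deviation_drift N g1 g2 g3 t \<sigma>
    \<le> (deviation N g1 g2 g3 t \<sigma>)\<^sup>2
      + 2 * (deviation N (\<lambda>x. - g1 x - g2 x * gap2 t (site N x) + g3 x * mean2 t (site N x))
         (\<lambda>x. - g2 x + g1 x * gap1 t (site N x) + g3 x * mean1 t (site N x)) (\<lambda>x. - 2 * g3 x) t \<sigma>)\<^sup>2
      + 1 / real N * (\<Sum>x<N. 128 * (\<beta>1\<^sup>2 * ((deviation N (\<lambda>y. \<phi>1 (site N x) (site N y)) (\<lambda>_. 0) (\<lambda>_. 0) t \<sigma>)\<^sup>2 + \<rho>\<^sup>2)
          + \<beta>2\<^sup>2 * ((deviation N (\<lambda>_. 0) (\<lambda>y. \<phi>2 (site N x) (site N y)) (\<lambda>_. 0) t \<sigma>)\<^sup>2 + \<rho>\<^sup>2)))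
      + 32 / real N"
    (is "?lhs \<le> ?d\<^sup>2 + 2 * ?l\<^sup>2 + 1 / real N * (\<Sum>x<N. ?s x) + 32 / real N")
proof -
  note g = weights_leD[OF w]
  let ?G = "gen N (statistic N g1 g2 g3) \<sigma> - limit_avg_deriv N g1 g2 g3 t"
  define R where "R x = g1 x * ((site_mean1 N \<sigma> x - mean1 t (site N x)) + snd \<sigma> x * (site_gap1 N \<sigma> x - gap1 t (site N x)))
      + g2 x * ((site_mean2 N \<sigma> x - mean2 t (site N x)) - fst \<sigma> x * (site_gap2 N \<sigma> x - gap2 t (site N x)))
      + g3 x * ((site_gap1 N \<sigma> x - gap1 t (site N x)) - (site_gap2 N \<sigma> x - gap2 t (site N x))
          + fst \<sigma> x * (site_mean2 N \<sigma> x - mean2 t (site N x)) + snd \<sigma> x * (site_mean1 N \<sigma> x - mean1 t (site N x)))" for x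
  have "2 * (R x)\<^sup>2 \<le> ?s x" if x: "x < N" for x
  proof -
    let ?c1 = "(config_conv N (fst \<sigma>) \<phi>1 x - torus_conv (u1 t) \<phi>1 (site N x))\<^sup>2"
    let ?c2 = "(config_conv N (snd \<sigma>) \<phi>2 x - torus_conv (u2 t) \<phi>2 (site N x))\<^sup>2"
    have "(R x)\<^sup>2 \<le> 32 * (\<beta>1\<^sup>2 * ?c1 + \<beta>2\<^sup>2 * ?c2)"
      unfolding R_def by (rule nonlinear_remainder_bound[where ?g1.0 = g1 and ?g2.0 = g2 and ?g3.0 = g3, OF \<sigma> x g(1)[OF x] g(2)[OF x] g(3)[OF x]])
    also have "\<dots> \<le> 32 * (\<beta>1\<^sup>2 * (2 * (deviation N (\<lambda>y. \<phi>1 (site N x) (site N y)) (\<lambda>_. 0) (\<lambda>_. 0) t \<sigma>)\<^sup>2 + 2 * \<rho>\<^sup>2)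
        + \<beta>2\<^sup>2 * (2 * (deviation N (\<lambda>_. 0) (\<lambda>y. \<phi>2 (site N x) (site N y)) (\<lambda>_. 0) t \<sigma>)\<^sup>2 + 2 * \<rho>\<^sup>2))"
      by (intro mult_left_mono add_mono conv_deviation[OF err(1)[OF x] err(2)[OF x]]) auto
    finally show ?thesis by (simp add: algebra_simps)
  qed
  then have "1 / real N * (\<Sum>x<N. 2 * (R x)\<^sup>2) \<le> 1 / real N * (\<Sum>x<N. ?s x)"
    by (intro mult_left_mono sum_mono) auto
  moreover have "1 / real N * (\<Sum>x<N. 2 * (R x)\<^sup>2) = 2 * (1 / real N * (\<Sum>x<N. (R x)\<^sup>2))"
    by (simp add: sum_distrib_left[symmetric])
  moreover have "?G\<^sup>2 \<le> 2 * ?l\<^sup>2 + 2 * (1 / real N * (\<Sum>x<N. R x))\<^sup>2"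
    unfolding drift_decomposition[OF \<sigma>] R_def by (rule square_sum_le)
  moreover have "(1 / real N * (\<Sum>x<N. R x))\<^sup>2 \<le> 1 / real N * (\<Sum>x<N. (R x)\<^sup>2)"
    by (rule square_avg_le)
  ultimately have G: "?G\<^sup>2 \<le> 2 * ?l\<^sup>2 + 1 / real N * (\<Sum>x<N. ?s x)" by linarith
  have "?lhs \<le> 2 * ?d * gen N (statistic N g1 g2 g3) \<sigma> + 32 * 1\<^sup>2 / real N - 2 * limit_avg_deriv N g1 g2 g3 t * ?d"
    using gen_square_statistic_le[OF _ w \<sigma>, of "limit_avg N g1 g2 g3 t"] N by simp
  also have "\<dots> = 2 * ?d * ?G + 32 / real N" by (simp add: algebra_simps)
  also have "2 * ?d * ?G \<le> ?d\<^sup>2 + ?G\<^sup>2" by (rule sum_squares_bound)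
  finally show ?thesis using G by linarith
qed

text \<open>Only the centring depends on time explicitly. Expanding the square reduces the claim to Dynkin's formula
for the statistic and for its square.\<close>

lemma mean_square_deviation_has_derivative:
  assumes N: "N \<ge> 1" and t: "0 \<le> t"
  shows "(mean_square_deviation N g1 g2 g3 has_real_derivative
     expectation (\<lambda>\<omega>. deviation_drift N g1 g2 g3 t (X N t \<omega>))) (at t within {0..})"
proof -
  interpret finite_state_markov M "states N" "gen N" "X N" "4 * real N" by (rule process_finite_state_markov[OF N])
  let ?F = "statistic N g1 g2 g3" and ?a = "limit_avg N g1 g2 g3" and ?a' = "limit_avg_deriv N g1 g2 g3 t"
  let ?E = "\<lambda>f t. expectation (\<lambda>\<omega>. f (X N t \<omega>))"
  have expand: "mean_square_deviation N g1 g2 g3 s = ?E (\<lambda>\<sigma>. (?F \<sigma>)\<^sup>2) s - 2 * ?a s * ?E ?F s + (?a s)\<^sup>2" if s: "0 \<le> s" for s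
  proof -
    have "mean_square_deviation N g1 g2 g3 s = expectation (\<lambda>\<omega>. (?F (X N s \<omega>))\<^sup>2 - 2 * ?a s * ?F (X N s \<omega>) + (?a s)\<^sup>2)"
      unfolding mean_square_deviation_def by (rule Bochner_Integration.integral_cong) (auto simp: power2_diff algebra_simps)
    then show ?thesis
      using integrable_fun_X[OF s, of "\<lambda>\<sigma>. (?F \<sigma>)\<^sup>2"] integrable_fun_X[OF s, of ?F] by (simp add: prob_space)
  qed
  have gen_expand: "gen N (\<lambda>\<sigma>. (?F \<sigma> - a)\<^sup>2) \<sigma> = gen N (\<lambda>\<sigma>. (?F \<sigma>)\<^sup>2) \<sigma> - 2 * a * gen N ?F \<sigma>" for a \<sigma>
    unfolding gen_apply sum_distrib_left sum_subtractf[symmetric]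
    by (rule sum.cong) (auto simp: power2_eq_square algebra_simps)
  have "((\<lambda>s. ?E (\<lambda>\<sigma>. (?F \<sigma>)\<^sup>2) s - 2 * ?a s * ?E ?F s + (?a s)\<^sup>2) has_real_derivative
      ?E (gen N (\<lambda>\<sigma>. (?F \<sigma>)\<^sup>2)) t - (2 * ?a t * ?E (gen N ?F) t + 2 * ?a' * ?E ?F t) + 2 * ?a t * ?a') (at t within {0..})"
    using dynkin[OF t, of "\<lambda>\<sigma>. (?F \<sigma>)\<^sup>2"] dynkin[OF t, of ?F] limit_avg_has_derivative[OF t, of N g1 g2 g3]
    by (auto intro!: derivative_eq_intros)
  then have "(mean_square_deviation N g1 g2 g3 has_real_derivative
      ?E (gen N (\<lambda>\<sigma>. (?F \<sigma>)\<^sup>2)) t - (2 * ?a t * ?E (gen N ?F) t + 2 * ?a' * ?E ?F t) + 2 * ?a t * ?a') (at t within {0..})"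
    unfolding has_field_derivative_def
    by (rule has_derivative_transform[rotated 2]) (use t expand in auto)
  moreover have "expectation (\<lambda>\<omega>. gen N (\<lambda>\<sigma>. (?F \<sigma> - ?a t)\<^sup>2) (X N t \<omega>) - 2 * ?a' * (?F (X N t \<omega>) - ?a t))
      = ?E (gen N (\<lambda>\<sigma>. (?F \<sigma>)\<^sup>2)) t - (2 * ?a t * ?E (gen N ?F) t + 2 * ?a' * ?E ?F t) + 2 * ?a t * ?a'"
  proof -
    have "expectation (\<lambda>\<omega>. gen N (\<lambda>\<sigma>. (?F \<sigma> - ?a t)\<^sup>2) (X N t \<omega>) - 2 * ?a' * (?F (X N t \<omega>) - ?a t))
        = expectation (\<lambda>\<omega>. gen N (\<lambda>\<sigma>. (?F \<sigma>)\<^sup>2) (X N t \<omega>) - 2 * ?a t * gen N ?F (X N t \<omega>) - 2 * ?a' * ?F (X N t \<omega>) + 2 * ?a t * ?a')"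
      unfolding gen_expand by (rule Bochner_Integration.integral_cong) (auto simp: algebra_simps)
    then show ?thesis
      using integrable_fun_X[OF t, of "gen N (\<lambda>\<sigma>. (?F \<sigma>)\<^sup>2)"] integrable_fun_X[OF t, of "gen N ?F"] integrable_fun_X[OF t, of ?F]
      by (simp add: prob_space)
  qed
  ultimately show ?thesis by simp
qed

lemma deviation_scale:
  assumes "B \<noteq> 0"
  shows "deviation N (\<lambda>x. g1 x / B) (\<lambda>x. g2 x / B) (\<lambda>x. g3 x / B) t \<sigma> = deviation N g1 g2 g3 t \<sigma> / B"
  unfolding statistic_def limit_avg_def triple_avg_diff unfolding triple_avg_def
  by (simp add: sum_divide_distrib add_divide_distrib mult.commute)

text \<open>The deviation is linear in the weights.\<close>

lemma mean_square_deviation_scale: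
  assumes W: "\<And>g1 g2 g3. weights_le N 1 g1 g2 g3 \<Longrightarrow> mean_square_deviation N g1 g2 g3 t \<le> W"
    and "B > 0" and w: "weights_le N B g1 g2 g3"
  shows "mean_square_deviation N g1 g2 g3 t \<le> B\<^sup>2 * W"
proof -
  have "mean_square_deviation N (\<lambda>x. g1 x / B) (\<lambda>x. g2 x / B) (\<lambda>x. g3 x / B) t \<le> W"
    using weights_leD[OF w] \<open>B > 0\<close> by (intro W) (auto simp: weights_le_def)
  moreover have "mean_square_deviation N (\<lambda>x. g1 x / B) (\<lambda>x. g2 x / B) (\<lambda>x. g3 x / B) t = mean_square_deviation N g1 g2 g3 t / B\<^sup>2"
  proof -
    have "B \<noteq> 0" using \<open>B > 0\<close> by simp
    show ?thesis unfolding mean_square_deviation_def deviation_scale[OF \<open>B \<noteq> 0\<close>] power_divide by simp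
  qed
  ultimately show ?thesis using \<open>B > 0\<close> by (simp add: pos_divide_le_eq mult.commute)
qed

lemma abs_limit_avg_le:
  assumes "N \<ge> 1" "0 \<le> t" "t \<le> T" and w: "weights_le N 1 g1 g2 g3"
  shows "\<bar>limit_avg N g1 g2 g3 t\<bar> \<le> 3 * U"
  unfolding limit_avg_def triple_avg_def
proof (rule abs_avg_le)
  fix x assume x: "x < N"
  note g = weights_leD[OF w x]
  have u: "\<bar>u1 t (site N x)\<bar> \<le> U" "\<bar>u2 t (site N x)\<bar> \<le> U" "\<bar>v t (site N x)\<bar> \<le> U"
    using solution_le_U[OF assms(2,3), of "site N x"] x by auto
  have p: "\<bar>a * b\<bar> \<le> U" if "\<bar>a\<bar> \<le> 1" "\<bar>b\<bar> \<le> U" for a b :: real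
    using abs_mult_le_left[OF that(1), of b] that(2) by (simp add: mult.commute)
  show "\<bar>g1 x * u1 t (site N x) + g2 x * u2 t (site N x) + g3 x * v t (site N x)\<bar> \<le> 3 * U"
    using p[OF g(1) u(1)] p[OF g(2) u(2)] p[OF g(3) u(3)] by linarith
qed (use assms in auto)

text \<open>This only serves to make the supremum in the Gronwall argument finite.\<close>

lemma mean_square_deviation_crude:
  assumes N: "N \<ge> 1" and t: "0 \<le> t" "t \<le> T" and w: "weights_le N 1 g1 g2 g3"
  shows "mean_square_deviation N g1 g2 g3 t \<le> (3 + 3 * U)\<^sup>2"
proof -
  interpret finite_state_markov M "states N" "gen N" "X N" "4 * real N" by (rule process_finite_state_markov[OF N])
  have b: "(deviation N g1 g2 g3 t (X N t \<omega>))\<^sup>2 \<le> (3 + 3 * U)\<^sup>2" if "\<omega> \<in> space M" for \<omega>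
  proof -
    have "\<bar>statistic N g1 g2 g3 (X N t \<omega>)\<bar> \<le> 3 * 1"
      using N w by (intro abs_statistic_le X_in_S[OF t(1) that]) auto
    then have "\<bar>deviation N g1 g2 g3 t (X N t \<omega>)\<bar> \<le> 3 + 3 * U" using abs_limit_avg_le[OF N t w] by linarith
    then have "\<bar>deviation N g1 g2 g3 t (X N t \<omega>)\<bar>\<^sup>2 \<le> (3 + 3 * U)\<^sup>2" by (intro power_mono) auto
    then show ?thesis by simp
  qed
  have "mean_square_deviation N g1 g2 g3 t \<le> expectation (\<lambda>\<omega>. (3 + 3 * U)\<^sup>2)"
    unfolding mean_square_deviation_def
    using b integrable_fun_X[OF t(1), of "\<lambda>\<sigma>. (deviation N g1 g2 g3 t \<sigma>)\<^sup>2"] by (intro integral_mono) auto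
  then show ?thesis by (simp add: prob_space)
qed

lemma mean_square_deviation_initial:
  assumes N: "N \<ge> 1" and w: "weights_le N 1 g1 g2 g3"
  shows "mean_square_deviation N g1 g2 g3 0 \<le> 36 / real N"
proof -
  interpret finite_state_markov M "states N" "gen N" "X N" "4 * real N" by (rule process_finite_state_markov[OF N])
  have "limit_avg N g1 g2 g3 0 = triple_avg N g1 g2 g3
      (\<lambda>x. \<psi>1 (site N x)) (\<lambda>x. \<psi>2 (site N x)) (\<lambda>x. \<psi>1 (site N x) * \<psi>2 (site N x))"
    unfolding limit_avg_def by (rule triple_avg_cong) (simp add: solution_initial)
  then show ?thesis
    unfolding mean_square_deviation_def
    using initial_statistic_variance[OF initial[OF N] _ X_in_S[OF order_refl] _ _ w] N initial_profile_bound by simp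
qed

text \<open>Every square in the pointwise bound is the square of a deviation, hence at most \<open>W\<close> in expectation after
rescaling its weights. The weights of the drift are bounded by \<open>3\<close>, those of the fields by \<open>B\<close>,
and \<open>19 = 1 + 2 * 3\<^sup>2\<close>.\<close>

lemma mean_square_deviation_derivative_bound:
  assumes N: "N \<ge> 1" and t: "0 \<le> t" "t \<le> T" and w: "weights_le N 1 g1 g2 g3"
    and err: "\<And>x. x < N \<Longrightarrow> conv_error u1 \<phi>1 N t x \<le> \<rho>"
      "\<And>x. x < N \<Longrightarrow> conv_error u2 \<phi>2 N t x \<le> \<rho>"
    and B: "B > 0" "\<And>r s. r \<in> {0..<1} \<Longrightarrow> s \<in> {0..<1} \<Longrightarrow> \<bar>\<phi>1 r s\<bar> \<le> B" "\<And>r s. r \<in> {0..<1} \<Longrightarrow> s \<in> {0..<1} \<Longrightarrow> \<bar>\<phi>2 r s\<bar> \<le> B"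
    and W: "\<And>g1 g2 g3. weights_le N 1 g1 g2 g3 \<Longrightarrow> mean_square_deviation N g1 g2 g3 t \<le> W"
  shows "expectation (\<lambda>\<omega>. deviation_drift N g1 g2 g3 t (X N t \<omega>))
    \<le> (19 + 128 * (\<beta>1\<^sup>2 + \<beta>2\<^sup>2) * B\<^sup>2) * W + (128 * (\<beta>1\<^sup>2 + \<beta>2\<^sup>2) * \<rho>\<^sup>2 + 32 / real N)"
proof -
  interpret finite_state_markov M "states N" "gen N" "X N" "4 * real N" by (rule process_finite_state_markov[OF N])
  define h1 where "h1 x = - g1 x - g2 x * gap2 t (site N x) + g3 x * mean2 t (site N x)" for x
  define h2 where "h2 x = - g2 x + g1 x * gap1 t (site N x) + g3 x * mean1 t (site N x)" for x
  define h3 where "h3 x = - 2 * g3 x" for x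
  define p1 where "p1 x y = \<phi>1 (site N x) (site N y)" for x y :: nat
  define p2 where "p2 x y = \<phi>2 (site N x) (site N y)" for x y :: nat
  define D where "D = (\<lambda>\<sigma>. (deviation N g1 g2 g3 t \<sigma>)\<^sup>2)"
  define L where "L = (\<lambda>\<sigma>. (deviation N h1 h2 h3 t \<sigma>)\<^sup>2)"
  define P1 where "P1 x = (\<lambda>\<sigma>. (deviation N (p1 x) (\<lambda>_. 0) (\<lambda>_. 0) t \<sigma>)\<^sup>2)" for x
  define P2 where "P2 x = (\<lambda>\<sigma>. (deviation N (\<lambda>_. 0) (p2 x) (\<lambda>_. 0) t \<sigma>)\<^sup>2)" for x
  let ?E = "\<lambda>f. expectation (\<lambda>\<omega>. f (X N t \<omega>))"
  note g = weights_leD[OF w]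
  note int = integrable_fun_X[OF t(1)]
  have ED: "?E D \<le> W"
    using W[OF w] unfolding D_def mean_square_deviation_def .
  have EL: "?E L \<le> 3\<^sup>2 * W"
    unfolding L_def mean_square_deviation_def[symmetric]
  proof (rule mean_square_deviation_scale[OF W], assumption, simp, unfold weights_le_def, intro allI impI conjI)
    fix x assume x: "x < N"
    note c = coefficient_bounds[of t "site N x"]
    note m = abs_mult_le_left[OF c(1), of "g3 x"] abs_mult_le_left[OF c(2), of "g1 x"]
      abs_mult_le_left[OF c(3), of "g3 x"] abs_mult_le_left[OF c(4), of "g2 x"]
    show "\<bar>h1 x\<bar> \<le> 3" unfolding h1_def using m(3,4) g[OF x] by linarith
    show "\<bar>h2 x\<bar> \<le> 3" unfolding h2_def using m(1,2) g[OF x] by linarith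
    show "\<bar>h3 x\<bar> \<le> 3" unfolding h3_def using g(3)[OF x] by simp
  qed
  have EP1: "?E (P1 x) \<le> B\<^sup>2 * W" if "x < N" for x
    unfolding P1_def mean_square_deviation_def[symmetric]
    by (rule mean_square_deviation_scale[OF W B(1)]) (use that B in \<open>auto simp: p1_def weights_le_def\<close>)
  have EP2: "?E (P2 x) \<le> B\<^sup>2 * W" if "x < N" for x
    unfolding P2_def mean_square_deviation_def[symmetric]
    by (rule mean_square_deviation_scale[OF W B(1)]) (use that B in \<open>auto simp: p2_def weights_le_def\<close>)
  have "expectation (\<lambda>\<omega>. deviation_drift N g1 g2 g3 t (X N t \<omega>))
     \<le> expectation (\<lambda>\<omega>. D (X N t \<omega>) + 2 * L (X N t \<omega>)
         + 1 / real N * (\<Sum>x<N. 128 * (\<beta>1\<^sup>2 * (P1 x (X N t \<omega>) + \<rho>\<^sup>2) + \<beta>2\<^sup>2 * (P2 x (X N t \<omega>) + \<rho>\<^sup>2))) + 32 / real N)"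
  proof (rule integral_mono)
    show "integrable M (\<lambda>\<omega>. deviation_drift N g1 g2 g3 t (X N t \<omega>))"
      by (rule int[of "\<lambda>\<sigma>. deviation_drift N g1 g2 g3 t \<sigma>"])
    show "integrable M (\<lambda>\<omega>. D (X N t \<omega>) + 2 * L (X N t \<omega>)
         + 1 / real N * (\<Sum>x<N. 128 * (\<beta>1\<^sup>2 * (P1 x (X N t \<omega>) + \<rho>\<^sup>2) + \<beta>2\<^sup>2 * (P2 x (X N t \<omega>) + \<rho>\<^sup>2))) + 32 / real N)"
      by (rule int[of "\<lambda>\<sigma>. D \<sigma> + 2 * L \<sigma> + 1 / real N * (\<Sum>x<N. 128 * (\<beta>1\<^sup>2 * (P1 x \<sigma> + \<rho>\<^sup>2) + \<beta>2\<^sup>2 * (P2 x \<sigma> + \<rho>\<^sup>2))) + 32 / real N"])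
    show "deviation_drift N g1 g2 g3 t (X N t \<omega>)
      \<le> D (X N t \<omega>) + 2 * L (X N t \<omega>)
         + 1 / real N * (\<Sum>x<N. 128 * (\<beta>1\<^sup>2 * (P1 x (X N t \<omega>) + \<rho>\<^sup>2) + \<beta>2\<^sup>2 * (P2 x (X N t \<omega>) + \<rho>\<^sup>2))) + 32 / real N"
      if "\<omega> \<in> space M" for \<omega>
      unfolding D_def L_def P1_def P2_def p1_def p2_def h1_def h2_def h3_def
      by (rule generator_deviation_bound[OF N X_in_S[OF t(1) that] w err])
  qed
  also have "\<dots> = ?E D + 2 * ?E L
         + 1 / real N * (\<Sum>x<N. 128 * (\<beta>1\<^sup>2 * (?E (P1 x) + \<rho>\<^sup>2) + \<beta>2\<^sup>2 * (?E (P2 x) + \<rho>\<^sup>2))) + 32 / real N"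
    using int[of D] int[of L] int[of "P1 _"] int[of "P2 _"] by (simp add: prob_space)
  also have "\<dots> \<le> W + 2 * (3\<^sup>2 * W)
         + 1 / real N * (\<Sum>x<N. 128 * (\<beta>1\<^sup>2 * (B\<^sup>2 * W + \<rho>\<^sup>2) + \<beta>2\<^sup>2 * (B\<^sup>2 * W + \<rho>\<^sup>2))) + 32 / real N"
    using ED EL EP1 EP2 by (intro add_mono mult_left_mono sum_mono) auto
  also have "\<dots> = (19 + 128 * (\<beta>1\<^sup>2 + \<beta>2\<^sup>2) * B\<^sup>2) * W + (128 * (\<beta>1\<^sup>2 + \<beta>2\<^sup>2) * \<rho>\<^sup>2 + 32 / real N)"
    using N by (simp add: field_simps)
  finally show ?thesis .
qed

text \<open>A Gronwall argument for a supremum over weights, without integrating this supremum over time. Let \<open>W\<close>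
be the supremum of \<open>exp (- 2 C t) E d\<^sub>g(t)\<^sup>2\<close> over all times and weights. The derivative of \<open>E d\<^sub>g(t)\<^sup>2\<close> is at most
\<open>C exp (2 C t) W + \<epsilon>\<close>. The integral of the first term is at most \<open>exp (2 C t) W / 2\<close>, so \<open>W\<close> is bounded by half of
itself plus the initial variance and \<open>\<epsilon> T\<close>.\<close>

lemma mean_square_deviation_gronwall:
  assumes N: "N \<ge> 1"
    and err: "\<And>t x. 0 \<le> t \<Longrightarrow> t \<le> T \<Longrightarrow> x < N \<Longrightarrow> conv_error u1 \<phi>1 N t x \<le> \<rho>"
      "\<And>t x. 0 \<le> t \<Longrightarrow> t \<le> T \<Longrightarrow> x < N \<Longrightarrow> conv_error u2 \<phi>2 N t x \<le> \<rho>"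
    and B: "B > 0" "\<And>r s. r \<in> {0..<1} \<Longrightarrow> s \<in> {0..<1} \<Longrightarrow> \<bar>\<phi>1 r s\<bar> \<le> B" "\<And>r s. r \<in> {0..<1} \<Longrightarrow> s \<in> {0..<1} \<Longrightarrow> \<bar>\<phi>2 r s\<bar> \<le> B"
    and C: "C = 19 + 128 * (\<beta>1\<^sup>2 + \<beta>2\<^sup>2) * B\<^sup>2" and \<epsilon>: "\<epsilon> = 128 * (\<beta>1\<^sup>2 + \<beta>2\<^sup>2) * \<rho>\<^sup>2 + 32 / real N"
    and t: "0 \<le> t" "t \<le> T" and w: "weights_le N 1 g1 g2 g3"
  shows "mean_square_deviation N g1 g2 g3 t \<le> exp (2 * C * T) * (72 / real N + 2 * (\<epsilon> * T))"
proof -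
  define admissible where "admissible t g1 g2 g3 \<longleftrightarrow> 0 \<le> t \<and> t \<le> T \<and> weights_le N 1 g1 g2 g3"
    for t :: real and g1 g2 g3 :: "nat \<Rightarrow> real"
  define S where "S = {exp (- 2 * C * t) * mean_square_deviation N g1 g2 g3 t | t g1 g2 g3. admissible t g1 g2 g3}"
  define W where "W = Sup S"
  have "C > 0" unfolding C by (intro add_pos_nonneg) auto
  have "\<epsilon> \<ge> 0" unfolding \<epsilon> by (intro add_nonneg_nonneg mult_nonneg_nonneg) auto
  have bdd: "bdd_above S"
  proof (rule bdd_aboveI[of _ "1 * (3 + 3 * U)\<^sup>2"])
    fix y assume "y \<in> S"
    then obtain t g1 g2 g3 where y: "y = exp (- 2 * C * t) * mean_square_deviation N g1 g2 g3 t" and a: "admissible t g1 g2 g3"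
      unfolding S_def by blast
    have "0 \<le> mean_square_deviation N g1 g2 g3 t" unfolding mean_square_deviation_def by simp
    then show "y \<le> 1 * (3 + 3 * U)\<^sup>2"
      unfolding y using a \<open>C > 0\<close> by (intro mult_mono mean_square_deviation_crude[OF N]) (auto simp: admissible_def)
  qed
  have le_W: "mean_square_deviation N g1 g2 g3 t \<le> exp (2 * C * t) * W" if "admissible t g1 g2 g3" for t g1 g2 g3
  proof -
    have "exp (- 2 * C * t) * mean_square_deviation N g1 g2 g3 t \<le> W"
      unfolding W_def using that by (intro cSup_upper bdd) (auto simp: S_def)
    then have "exp (2 * C * t) * (exp (- 2 * C * t) * mean_square_deviation N g1 g2 g3 t) \<le> exp (2 * C * t) * W"
      by (intro mult_left_mono) auto
    then show ?thesis by (simp add: mult.assoc[symmetric] exp_add[symmetric])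
  qed
  have "0 \<le> mean_square_deviation N (\<lambda>_. 0) (\<lambda>_. 0) (\<lambda>_. 0) 0" unfolding mean_square_deviation_def by simp
  moreover have "admissible 0 (\<lambda>_. 0) (\<lambda>_. 0) (\<lambda>_. 0)" using T by (simp add: admissible_def weights_le_def)
  ultimately have "W \<ge> 0" and "S \<noteq> {}" using le_W[of 0 "\<lambda>_. 0" "\<lambda>_. 0" "\<lambda>_. 0"] unfolding S_def by auto
  have step: "mean_square_deviation N g1 g2 g3 t \<le> 36 / real N + exp (2 * C * t) * (W / 2) + \<epsilon> * T" if a: "admissible t g1 g2 g3" for t g1 g2 g3
  proof -
    have t: "0 \<le> t" "t \<le> T" and w: "weights_le N 1 g1 g2 g3"
      using a by (auto simp: admissible_def)
    have "mean_square_deviation N g1 g2 g3 t - mean_square_deviation N g1 g2 g3 0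
        \<le> (exp (2 * C * t) * (W / 2) + \<epsilon> * t) - (exp (2 * C * 0) * (W / 2) + \<epsilon> * 0)"
    proof (rule increment_le_from_deriv[where \<tau> = T and g' = "\<lambda>t. C * (exp (2 * C * t) * W) + \<epsilon>"])
      fix s assume s: "0 \<le> s" "s \<le> T"
      show "(mean_square_deviation N g1 g2 g3 has_real_derivative
         expectation (\<lambda>\<omega>. deviation_drift N g1 g2 g3 s (X N s \<omega>))) (at s within {0..})"
        by (rule mean_square_deviation_has_derivative[OF N s(1)])
      show "((\<lambda>t. exp (2 * C * t) * (W / 2) + \<epsilon> * t) has_real_derivative C * (exp (2 * C * s) * W) + \<epsilon>) (at s within {0..})"
        by (auto intro!: derivative_eq_intros)
      show "expectation (\<lambda>\<omega>. deviation_drift N g1 g2 g3 s (X N s \<omega>)) \<le> C * (exp (2 * C * s) * W) + \<epsilon>"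
        unfolding C \<epsilon>
      proof (rule mean_square_deviation_derivative_bound[OF N s w err(1)[OF s] err(2)[OF s] B])
        fix g1 g2 g3 :: "nat \<Rightarrow> real"
        assume "weights_le N 1 g1 g2 g3"
        then show "mean_square_deviation N g1 g2 g3 s \<le> exp (2 * (19 + 128 * (\<beta>1\<^sup>2 + \<beta>2\<^sup>2) * B\<^sup>2) * s) * W"
          using s unfolding C[symmetric] by (intro le_W) (simp add: admissible_def)
      qed
    qed (use t in auto)
    moreover have "mean_square_deviation N g1 g2 g3 0 \<le> 36 / real N" by (rule mean_square_deviation_initial[OF N w])
    moreover have "\<epsilon> * t \<le> \<epsilon> * T" using \<open>\<epsilon> \<ge> 0\<close> t by (intro mult_left_mono)
    ultimately show ?thesis using \<open>W \<ge> 0\<close> by simp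
  qed
  have nn: "0 \<le> 36 / real N + \<epsilon> * T" using \<open>\<epsilon> \<ge> 0\<close> T by simp
  have "W \<le> (36 / real N + \<epsilon> * T) + W / 2"
    unfolding W_def
  proof (rule cSup_least[OF \<open>S \<noteq> {}\<close>])
    fix y assume "y \<in> S"
    then obtain t g1 g2 g3 where y: "y = exp (- 2 * C * t) * mean_square_deviation N g1 g2 g3 t" and a: "admissible t g1 g2 g3"
      unfolding S_def by blast
    have "y \<le> exp (- 2 * C * t) * (36 / real N + exp (2 * C * t) * (W / 2) + \<epsilon> * T)"
      unfolding y using step[OF a] by (intro mult_left_mono) auto
    also have "\<dots> = exp (- 2 * C * t) * (36 / real N + \<epsilon> * T) + W / 2"
      by (simp add: algebra_simps exp_minus)
    also have "exp (- 2 * C * t) * (36 / real N + \<epsilon> * T) \<le> 1 * (36 / real N + \<epsilon> * T)"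
      using a \<open>C > 0\<close> nn by (intro mult_right_mono) (auto simp: admissible_def)
    finally show "y \<le> (36 / real N + \<epsilon> * T) + Sup S / 2" by (simp add: W_def)
  qed
  then have W: "W \<le> 72 / real N + 2 * (\<epsilon> * T)" by simp
  have "mean_square_deviation N g1 g2 g3 t \<le> exp (2 * C * t) * W"
    using t w by (intro le_W) (auto simp: admissible_def)
  also have "\<dots> \<le> exp (2 * C * T) * (72 / real N + 2 * (\<epsilon> * T))"
    using W t \<open>C > 0\<close> \<open>W \<ge> 0\<close> by (intro mult_mono) auto
  finally show ?thesis .
qed

lemma mean_square_convergence:
  assumes "\<eta> > 0"
  shows "\<exists>N0\<ge>1. \<forall>N\<ge>N0. \<forall>t\<in>{0..T}. \<forall>g1 g2 g3. weights_le N 1 g1 g2 g3 \<longrightarrow> mean_square_deviation N g1 g2 g3 t \<le> \<eta>"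
proof -
  obtain B1 B2 where B12: "B1 > 0" "B2 > 0" "\<And>r s. r \<in> {0..<1} \<Longrightarrow> s \<in> {0..<1} \<Longrightarrow> \<bar>\<phi>1 r s\<bar> \<le> B1"
      "\<And>r s. r \<in> {0..<1} \<Longrightarrow> s \<in> {0..<1} \<Longrightarrow> \<bar>\<phi>2 r s\<bar> \<le> B2"
    using interaction_kernel_bounded[OF kernel(1)] interaction_kernel_bounded[OF kernel(2)] by metis
  define B where "B = max B1 B2"
  have B: "B > 0" "\<And>r s. r \<in> {0..<1} \<Longrightarrow> s \<in> {0..<1} \<Longrightarrow> \<bar>\<phi>1 r s\<bar> \<le> B" "\<And>r s. r \<in> {0..<1} \<Longrightarrow> s \<in> {0..<1} \<Longrightarrow> \<bar>\<phi>2 r s\<bar> \<le> B"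
    using B12(1) order_trans[OF B12(3) max.cobounded1] order_trans[OF B12(4) max.cobounded2] unfolding B_def by auto
  define b where "b = \<beta>1\<^sup>2 + \<beta>2\<^sup>2"
  have "b \<ge> 0" by (simp add: b_def)
  define C where "C = 19 + 128 * (\<beta>1\<^sup>2 + \<beta>2\<^sup>2) * B\<^sup>2"
  define E where "E = exp (2 * C * T)"
  have "E > 0" by (simp add: E_def)
  define A where "A = E * (256 * T * b) + 1"
  have "A > 0" unfolding A_def using \<open>E > 0\<close> \<open>b \<ge> 0\<close> T by (intro add_nonneg_pos mult_nonneg_nonneg) auto
  \<comment> \<open>the tolerance for the Riemann sums that makes their share of the Gronwall bound at most \<open>\<eta> / 2\<close>\<close>
  define \<rho> where "\<rho> = sqrt (\<eta> / (2 * A))"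
  have "\<rho> > 0" and \<rho>2: "\<rho>\<^sup>2 = \<eta> / (2 * A)" using assms \<open>A > 0\<close> by (auto simp: \<rho>_def)
  have part1: "E * (256 * T * b) * \<rho>\<^sup>2 \<le> \<eta> / 2"
  proof -
    have "E * (256 * T * b) * \<rho>\<^sup>2 \<le> A * \<rho>\<^sup>2" unfolding A_def by (intro mult_right_mono) auto
    also have "\<dots> = \<eta> / 2" unfolding \<rho>2 using \<open>A > 0\<close> by simp
    finally show ?thesis .
  qed
  obtain N1 N1' where N1: "\<forall>N\<ge>N1. \<forall>t\<in>{0..T}. \<forall>x<N. conv_error u1 \<phi>1 N t x \<le> \<rho>"
      "\<forall>N\<ge>N1'. \<forall>t\<in>{0..T}. \<forall>x<N. conv_error u2 \<phi>2 N t x \<le> \<rho>"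
    using riemann_convolution[OF kernel(1) _ \<open>\<rho> > 0\<close>, of u1] riemann_convolution[OF kernel(2) _ \<open>\<rho> > 0\<close>, of u2] by blast
  obtain N2 where N2: "real N2 > E * (72 + 64 * T) * 2 / \<eta>" using reals_Archimedean2 by blast
  have "mean_square_deviation N g1 g2 g3 t \<le> \<eta>"
    if N: "N \<ge> max 1 (max (max N1 N1') N2)" and t: "t \<in> {0..T}" and w: "weights_le N 1 g1 g2 g3" for N t g1 g2 g3
  proof -
    have N': "N \<ge> 1" "N \<ge> N1" "real N \<ge> real N2" "N \<ge> N1'" using N by auto
    have "mean_square_deviation N g1 g2 g3 t \<le> E * (72 / real N + 2 * ((128 * (\<beta>1\<^sup>2 + \<beta>2\<^sup>2) * \<rho>\<^sup>2 + 32 / real N) * T))"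
      unfolding E_def
      by (rule mean_square_deviation_gronwall[OF N'(1) _ _ B C_def refl]) (use N1(1)[rule_format, OF N'(2)] N1(2)[rule_format, OF N'(4)] t w in auto)
    also have "\<dots> = E * (256 * T * b) * \<rho>\<^sup>2 + E * (72 + 64 * T) / real N"
      unfolding b_def by (simp add: algebra_simps add_divide_distrib)
    also have "E * (72 + 64 * T) / real N \<le> \<eta> / 2"
    proof -
      have "E * (72 + 64 * T) * 2 / \<eta> \<le> real N" using N2 N'(3) by linarith
      then have "E * (72 + 64 * T) * 2 \<le> real N * \<eta>" using assms by (simp add: pos_divide_le_eq)
      then show ?thesis using N'(1) by (simp add: field_simps)
    qed
    finally show ?thesis using part1 by linarith
  qed
  then show ?thesis by (intro exI[of _ "max 1 (max (max N1 N1') N2)"]) auto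
qed

end

section \<open>Convergence uniformly in time\<close>

lemma SUP_right_continuous:
  fixes y :: "real \<Rightarrow> real"
  assumes "a \<le> b" and rc: "\<And>t. t \<in> {a..<b} \<Longrightarrow> continuous (at_right t) y" and bdd: "bdd_above (y ` {a..b})"
  shows "(SUP t\<in>{a..b}. y t) = (SUP t\<in>insert b ({a..b} \<inter> \<rat>). y t)"
proof (rule antisym)
  let ?D = "insert b ({a..b} \<inter> \<rat>)"
  have D: "?D \<subseteq> {a..b}" using \<open>a \<le> b\<close> by auto
  have bdd': "bdd_above (y ` ?D)" using bdd_above_mono[OF bdd image_mono[OF D]] .
  show "(SUP t\<in>{a..b}. y t) \<le> (SUP t\<in>?D. y t)"
  proof (rule cSUP_least)
    fix t assume t: "t \<in> {a..b}"
    show "y t \<le> (SUP t\<in>?D. y t)"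
    proof (rule ccontr)
      assume "\<not> y t \<le> (SUP t\<in>?D. y t)"
      then have "(SUP t\<in>?D. y t) < y t" by simp
      then obtain t' where t': "t' \<in> ?D" "(SUP t\<in>?D. y t) < y t'"
        using right_continuous_exceeds_on_countable[OF rc t] by blast
      then show False using cSUP_upper[OF t'(1) bdd'] by simp
    qed
  qed (use \<open>a \<le> b\<close> in auto)
  show "(SUP t\<in>?D. y t) \<le> (SUP t\<in>{a..b}. y t)"
    using D by (intro cSUP_subset_mono bdd) auto
qed

lemma (in prob_space) prob_gt_le_second_moment:
  assumes [measurable]: "Z \<in> borel_measurable M" and int: "integrable M (\<lambda>\<omega>. (Z \<omega>)\<^sup>2)" and "\<epsilon> > 0"
  shows "prob {\<omega>\<in>space M. \<epsilon> < \<bar>Z \<omega>\<bar>} \<le> expectation (\<lambda>\<omega>. (Z \<omega>)\<^sup>2) / \<epsilon>\<^sup>2"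
proof -
  have "prob {\<omega>\<in>space M. \<epsilon> < \<bar>Z \<omega>\<bar>} \<le> prob {\<omega>\<in>space M. \<epsilon>\<^sup>2 \<le> (Z \<omega>)\<^sup>2}"
  proof (rule finite_measure_mono)
    show "{\<omega>\<in>space M. \<epsilon> < \<bar>Z \<omega>\<bar>} \<subseteq> {\<omega>\<in>space M. \<epsilon>\<^sup>2 \<le> (Z \<omega>)\<^sup>2}"
    proof safe
      fix \<omega> assume "\<epsilon> < \<bar>Z \<omega>\<bar>"
      then have "\<epsilon>\<^sup>2 \<le> \<bar>Z \<omega>\<bar>\<^sup>2" using \<open>\<epsilon> > 0\<close> by (intro power_mono) auto
      then show "\<epsilon>\<^sup>2 \<le> (Z \<omega>)\<^sup>2" by simp
    qed
  qed measurable
  also have "\<dots> \<le> expectation (\<lambda>\<omega>. (Z \<omega>)\<^sup>2) / \<epsilon>\<^sup>2"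
    using integral_Markov_inequality_measure[OF int, of "{}" "\<epsilon>\<^sup>2"] \<open>\<epsilon> > 0\<close> by simp
  finally show ?thesis .
qed

lemma grid_cell:
  assumes "m > 0" "t \<in> {0..T}" "T > 0" "\<delta> = T / real m"
  shows "\<exists>k<m. t \<in> {real k * \<delta>..real k * \<delta> + \<delta>}"
proof (cases "t = T")
  case True
  have "real (m - 1) * \<delta> + \<delta> = T" using assms by (simp add: of_nat_diff field_simps)
  moreover have "\<delta> > 0" using assms by simp
  ultimately show ?thesis using True assms(1) by (intro exI[of _ "m - 1"]) auto
next
  case False
  have "\<delta> > 0" using assms by simp
  define k where "k = nat \<lfloor>t / \<delta>\<rfloor>"
  have nn: "0 \<le> t / \<delta>" using assms \<open>\<delta> > 0\<close> by simp
  have k: "real k \<le> t / \<delta>" "t / \<delta> < real k + 1"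
    using nn unfolding k_def by linarith+
  have "t / \<delta> < real m" using False assms \<open>\<delta> > 0\<close> by (simp add: field_simps)
  then have "k < m" using k(1) by linarith
  moreover have "real k * \<delta> \<le> t" "t \<le> real k * \<delta> + \<delta>"
    using k \<open>\<delta> > 0\<close> by (simp_all add: field_simps)
  ultimately show ?thesis by auto
qed

context spin_process
begin

definition limit_pairing where
  "limit_pairing G1 G2 G3 t = torus_pairing (u1 t) G1 + torus_pairing (u2 t) G2 + torus_pairing (v t) G3"

lemma process_cadlag: "N \<ge> 1 \<Longrightarrow> \<omega> \<in> space M \<Longrightarrow> cadlag (\<lambda>t. X N t \<omega>)"
  using process unfolding markov_process_with_generator_def by blast

lemma statistic_increments:
  assumes N: "N \<ge> 1" and w: "weights_le N B g1 g2 g3" and "B \<ge> 0"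
  shows "finite_state_markov_increments M (states N) (gen N) (X N) (4 * real N) (statistic N g1 g2 g3) (8 * B) (32 * B\<^sup>2 / real N)"
proof -
  interpret finite_state_markov M "states N" "gen N" "X N" "4 * real N" by (rule process_finite_state_markov[OF N])
  show ?thesis
  proof
    show "gen N (\<lambda>y. (statistic N g1 g2 g3 y - a)\<^sup>2) x \<le> 2 * (8 * B) * \<bar>statistic N g1 g2 g3 x - a\<bar> + 32 * B\<^sup>2 / real N"
      if "x \<in> states N" for x a
      by (rule gen_square_statistic_le') (use N w that in auto)
  qed (use \<open>B \<ge> 0\<close> in auto)
qed

context
  fixes G1 G2 G3 :: "real \<Rightarrow> real" and B :: real
  assumes G: "continuous_map torus.mtopology euclideanreal G1" "continuous_map torus.mtopology euclideanreal G2"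
      "continuous_map torus.mtopology euclideanreal G3"
    and B: "B > 0" "\<And>r. r \<in> {0..<1} \<Longrightarrow> \<bar>G1 r\<bar> \<le> B" "\<And>r. r \<in> {0..<1} \<Longrightarrow> \<bar>G2 r\<bar> \<le> B" "\<And>r. r \<in> {0..<1} \<Longrightarrow> \<bar>G3 r\<bar> \<le> B"
begin

abbreviation F where
  "F N \<equiv> statistic N (\<lambda>x. G1 (site N x)) (\<lambda>x. G2 (site N x)) (\<lambda>x. G3 (site N x))"

abbreviation F_avg where
  "F_avg N \<equiv> limit_avg N (\<lambda>x. G1 (site N x)) (\<lambda>x. G2 (site N x)) (\<lambda>x. G3 (site N x))"

abbreviation P where "P \<equiv> limit_pairing G1 G2 G3"

lemma G_weights_le: "weights_le N B (\<lambda>x. G1 (site N x)) (\<lambda>x. G2 (site N x)) (\<lambda>x. G3 (site N x))"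
  by (simp add: weights_le_def B)

lemma P_lipschitz:
  assumes "t \<in> {0..T}" "s \<in> {0..T}" shows "\<bar>P t - P s\<bar> \<le> 18 * U * B * \<bar>t - s\<bar>"
proof -
  have "\<bar>torus_pairing (u1 t) G1 - torus_pairing (u1 s) G1\<bar> \<le> 6 * U * B * \<bar>t - s\<bar>"
    "\<bar>torus_pairing (u2 t) G2 - torus_pairing (u2 s) G2\<bar> \<le> 6 * U * B * \<bar>t - s\<bar>"
    "\<bar>torus_pairing (v t) G3 - torus_pairing (v s) G3\<bar> \<le> 6 * U * B * \<bar>t - s\<bar>"
    by (rule pairing_lipschitz_in_time[OF G(1) B(2) _ assms] pairing_lipschitz_in_time[OF G(2) B(3) _ assms]
        pairing_lipschitz_in_time[OF G(3) B(4) _ assms]; simp)+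
  moreover have "18 * U * B * \<bar>t - s\<bar> = 3 * (6 * U * B * \<bar>t - s\<bar>)" by simp
  ultimately show ?thesis unfolding limit_pairing_def by argo
qed

lemma deviation_right_continuous:
  assumes "N \<ge> 1" "\<omega> \<in> space M" "t \<in> {0..<T}"
  shows "continuous (at_right t) (\<lambda>t. \<bar>F N (X N t \<omega>) - P t\<bar>)"
proof -
  have "(P \<longlongrightarrow> P t) (at_right t)"
  proof (rule tendstoI)
    fix e :: real assume "e > 0"
    define K where "K = 18 * U * B + 1"
    have "K > 0" unfolding K_def using U_ge_1 B(1) by (intro add_nonneg_pos) auto
    have "dist (P s) (P t) < e" if "t < s" "s < min T (t + e / K)" for s
    proof -
      have "\<bar>P s - P t\<bar> \<le> 18 * U * B * \<bar>s - t\<bar>" using assms that by (intro P_lipschitz) auto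
      also have "\<dots> \<le> K * (s - t)" using that by (simp add: K_def algebra_simps)
      also have "\<dots> < K * (e / K)" using that \<open>K > 0\<close> by (intro mult_strict_left_mono) auto
      finally show ?thesis using \<open>K > 0\<close> by (simp add: dist_real_def)
    qed
    moreover have "t < min T (t + e / K)" using assms \<open>e > 0\<close> \<open>K > 0\<close> by simp
    ultimately show "\<forall>\<^sub>F s in at_right t. dist (P s) (P t) < e"
      unfolding eventually_at_right[OF \<open>t < min T (t + e / K)\<close>] by blast
  qed
  then have "continuous (at_right t) P" by (simp add: continuous_within)
  then show ?thesis
    using statistic_right_continuous[OF process_cadlag[OF assms(1,2)]] assms(3) by (intro continuous_intros) auto
qed

lemma deviation_bounded:
  assumes "N \<ge> 1" "\<omega> \<in> space M"
  shows "bdd_above ((\<lambda>t. \<bar>F N (X N t \<omega>) - P t\<bar>) ` {0..T})"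
proof (rule bdd_aboveI2)
  interpret finite_state_markov M "states N" "gen N" "X N" "4 * real N" by (rule process_finite_state_markov[OF assms(1)])
  fix t assume t: "t \<in> {0..T}"
  have "\<bar>F N (X N t \<omega>)\<bar> \<le> 3 * B"
    using t assms by (intro abs_statistic_le X_in_S G_weights_le) auto
  moreover have "\<bar>P t - P 0\<bar> \<le> 18 * U * B * T"
  proof -
    have "\<bar>P t - P 0\<bar> \<le> 18 * U * B * \<bar>t - 0\<bar>" using t T by (intro P_lipschitz) auto
    also have "\<dots> \<le> 18 * U * B * T" using t U_ge_1 B(1) by (intro mult_left_mono) auto
    finally show ?thesis .
  qed
  ultimately show "\<bar>F N (X N t \<omega>) - P t\<bar> \<le> 3 * B + 18 * U * B * T + \<bar>P 0\<bar>" by linarith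
qed

lemma sup_deviation_measurable:
  assumes "N \<ge> 1"
  shows "(\<lambda>\<omega>. SUP t\<in>{0..T}. \<bar>F N (X N t \<omega>) - P t\<bar>) \<in> borel_measurable M"
proof -
  interpret finite_state_markov M "states N" "gen N" "X N" "4 * real N" by (rule process_finite_state_markov[OF assms(1)])
  let ?D = "insert T ({0..T} \<inter> \<rat>)"
  have D: "?D \<subseteq> {0..T}" using T by auto
  have "(\<lambda>\<omega>. SUP t\<in>?D. \<bar>F N (X N t \<omega>) - P t\<bar>) \<in> borel_measurable M"
  proof (rule borel_measurable_cSUP)
    show "countable ?D" using countable_rat by auto
    show "(\<lambda>\<omega>. \<bar>F N (X N t \<omega>) - P t\<bar>) \<in> borel_measurable M" if "t \<in> ?D" for t
      using borel_measurable_fun_X[of t "\<lambda>\<sigma>. \<bar>F N \<sigma> - P t\<bar>"] that D by auto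
    show "bdd_above ((\<lambda>t. \<bar>F N (X N t \<omega>) - P t\<bar>) ` ?D)" if "\<omega> \<in> space M" for \<omega>
      by (rule bdd_above_mono[OF deviation_bounded[OF assms that] image_mono[OF D]])
  qed
  moreover have "(SUP t\<in>{0..T}. \<bar>F N (X N t \<omega>) - P t\<bar>) = (SUP t\<in>?D. \<bar>F N (X N t \<omega>) - P t\<bar>)" if "\<omega> \<in> space M" for \<omega>
    using T deviation_right_continuous[OF assms that] deviation_bounded[OF assms that] by (intro SUP_right_continuous) auto
  ultimately show ?thesis by (rule measurable_cong[THEN iffD2, rotated])
qed

lemma F_avg_converges:
  assumes "\<rho> > 0"
  shows "\<exists>N0. \<forall>N\<ge>N0. \<forall>t\<in>{0..T}. \<bar>F_avg N t - P t\<bar> \<le> \<rho>"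
proof -
  have "\<rho> / 3 > 0" using assms by simp
  obtain N1 where N1: "\<forall>N\<ge>N1. \<forall>t\<in>{0..T}. \<bar>1 / real N * (\<Sum>x<N. u1 t (site N x) * G1 (site N x)) - torus_pairing (u1 t) G1\<bar> \<le> \<rho> / 3"
    using riemann_pairing[OF G(1) \<open>\<rho> / 3 > 0\<close>, of u1] by blast
  obtain N2 where N2: "\<forall>N\<ge>N2. \<forall>t\<in>{0..T}. \<bar>1 / real N * (\<Sum>x<N. u2 t (site N x) * G2 (site N x)) - torus_pairing (u2 t) G2\<bar> \<le> \<rho> / 3"
    using riemann_pairing[OF G(2) \<open>\<rho> / 3 > 0\<close>, of u2] by blast
  obtain N3 where N3: "\<forall>N\<ge>N3. \<forall>t\<in>{0..T}. \<bar>1 / real N * (\<Sum>x<N. v t (site N x) * G3 (site N x)) - torus_pairing (v t) G3\<bar> \<le> \<rho> / 3"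
    using riemann_pairing[OF G(3) \<open>\<rho> / 3 > 0\<close>, of v] by blast
  have "\<bar>F_avg N t - P t\<bar> \<le> \<rho>" if N: "N \<ge> max N1 (max N2 N3)" and t: "t \<in> {0..T}" for N t
  proof -
    have "F_avg N t = 1 / real N * (\<Sum>x<N. u1 t (site N x) * G1 (site N x))
        + 1 / real N * (\<Sum>x<N. u2 t (site N x) * G2 (site N x))
        + 1 / real N * (\<Sum>x<N. v t (site N x) * G3 (site N x))"
      unfolding limit_avg_def triple_avg_def distrib_left[symmetric] sum.distrib[symmetric] by (simp add: mult.commute)
    moreover have "\<bar>1 / real N * (\<Sum>x<N. u1 t (site N x) * G1 (site N x)) - torus_pairing (u1 t) G1\<bar> \<le> \<rho> / 3"
      "\<bar>1 / real N * (\<Sum>x<N. u2 t (site N x) * G2 (site N x)) - torus_pairing (u2 t) G2\<bar> \<le> \<rho> / 3"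
      "\<bar>1 / real N * (\<Sum>x<N. v t (site N x) * G3 (site N x)) - torus_pairing (v t) G3\<bar> \<le> \<rho> / 3"
      using N1 N2 N3 N t by auto
    ultimately show ?thesis unfolding limit_pairing_def by linarith
  qed
  then show ?thesis by blast
qed

text \<open>The interval is divided into \<open>m\<close> cells of length \<open>\<delta>\<close>. Let \<open>t\<close> be in the cell with left endpoint \<open>s\<close>. Unless one of
the events \<open>E1\<close> (a deviation at a grid point) or \<open>E2\<close> (an oscillation within a cell) occurs, the error at
time \<open>t\<close> is at most \<open>3/4 \<epsilon>\<close>: there is \<open>\<epsilon>/4\<close> for the statistic between \<open>s\<close> and \<open>t\<close>, \<open>\<epsilon>/8\<close> for the
deviation at \<open>s\<close>, \<open>\<epsilon>/8\<close> for the Riemann sum, and \<open>\<epsilon>/4\<close> for the limit between \<open>s\<close> and \<open>t\<close>.\<close>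

lemma prob_sup_deviation_le:
  assumes N: "N \<ge> 1" and m: "m > 0" and \<delta>: "\<delta> = T / real m" and "\<epsilon> > 0"
    and step: "18 * U * B * \<delta> \<le> \<epsilon> / 4"
    and avg: "\<And>t. t \<in> {0..T} \<Longrightarrow> \<bar>F_avg N t - P t\<bar> \<le> \<epsilon> / 8"
    and msd: "\<And>t g1 g2 g3. t \<in> {0..T} \<Longrightarrow> weights_le N 1 g1 g2 g3 \<Longrightarrow> mean_square_deviation N g1 g2 g3 t \<le> \<eta>"
  shows "prob {\<omega>\<in>space M. \<epsilon> < \<bar>(SUP t\<in>{0..T}. \<bar>F N (X N t \<omega>) - P t\<bar>) - 0\<bar>}
    \<le> real m * (B\<^sup>2 * \<eta> / (\<epsilon> / 8)\<^sup>2) + real m * (4 * \<delta> * ((8 * B)\<^sup>2 * \<delta> + 32 * B\<^sup>2 / real N) / (\<epsilon> / 8)\<^sup>2)"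
proof -
  interpret Y: finite_state_markov_increments M "states N" "gen N" "X N" "4 * real N" "F N" "8 * B" "32 * B\<^sup>2 / real N"
    by (rule statistic_increments[OF N G_weights_le]) (use B(1) in simp)
  have "\<delta> > 0" "\<epsilon> / 8 > 0" using m \<delta> T \<open>\<epsilon> > 0\<close> by auto
  have tk: "real k * \<delta> \<in> {0..T}" if "k < m" for k
  proof -
    have "real k * \<delta> \<le> real m * \<delta>" using that \<open>\<delta> > 0\<close> by (intro mult_right_mono) auto
    moreover have "real m * \<delta> = T" using \<delta> m by simp
    ultimately show ?thesis using \<open>\<delta> > 0\<close> by (simp only: atLeastAtMost_iff) simp
  qed
  define E1 where "E1 k = {\<omega>\<in>space M. \<epsilon> / 8 < \<bar>F N (X N (real k * \<delta>) \<omega>) - F_avg N (real k * \<delta>)\<bar>}" for k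
  define E2 where "E2 k = {\<omega>\<in>space M. \<exists>t\<in>{real k * \<delta>..real k * \<delta> + \<delta>}. 2 * (\<epsilon> / 8) < \<bar>F N (X N t \<omega>) - F N (X N (real k * \<delta>) \<omega>)\<bar>}" for k
  have rc: "continuous (at_right t) (\<lambda>t. F N (X N t \<omega>))" if "\<omega> \<in> space M" "0 \<le> t" for \<omega> t
    by (rule statistic_right_continuous[OF process_cadlag[OF N that(1)] that(2)])
  have E2: "E2 k \<in> sets M" "prob (E2 k) \<le> 4 * \<delta> * ((8 * B)\<^sup>2 * \<delta> + 32 * B\<^sup>2 / real N) / (\<epsilon> / 8)\<^sup>2" if "k < m" for k
    unfolding E2_def using Y.oscillation[OF _ \<open>\<delta> > 0\<close> \<open>\<epsilon> / 8 > 0\<close> rc] tk[OF that] by auto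
  have E1: "E1 k \<in> sets M" "prob (E1 k) \<le> B\<^sup>2 * \<eta> / (\<epsilon> / 8)\<^sup>2" if "k < m" for k
  proof -
    let ?s = "real k * \<delta>"
    have s: "0 \<le> ?s" using tk[OF that] by simp
    have m[measurable]: "(\<lambda>\<omega>. F N (X N ?s \<omega>) - F_avg N ?s) \<in> borel_measurable M"
      using Y.borel_measurable_fun_X[OF s, of "\<lambda>\<sigma>. F N \<sigma> - F_avg N ?s"] .
    show "E1 k \<in> sets M" unfolding E1_def by measurable
    have "prob (E1 k) \<le> expectation (\<lambda>\<omega>. (F N (X N ?s \<omega>) - F_avg N ?s)\<^sup>2) / (\<epsilon> / 8)\<^sup>2"
      unfolding E1_def
      by (rule prob_gt_le_second_moment[OF m Y.integrable_fun_X[OF s, of "\<lambda>\<sigma>. (F N \<sigma> - F_avg N ?s)\<^sup>2"] \<open>\<epsilon> / 8 > 0\<close>])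
    also have "\<dots> \<le> B\<^sup>2 * \<eta> / (\<epsilon> / 8)\<^sup>2"
    proof (rule divide_right_mono)
      show "expectation (\<lambda>\<omega>. (F N (X N ?s \<omega>) - F_avg N ?s)\<^sup>2) \<le> B\<^sup>2 * \<eta>"
        unfolding mean_square_deviation_def[symmetric]
        by (rule mean_square_deviation_scale[OF _ B(1) G_weights_le]) (use msd tk[OF that] in auto)
    qed simp
    finally show "prob (E1 k) \<le> B\<^sup>2 * \<eta> / (\<epsilon> / 8)\<^sup>2" .
  qed
  have sub: "{\<omega>\<in>space M. \<epsilon> < \<bar>(SUP t\<in>{0..T}. \<bar>F N (X N t \<omega>) - P t\<bar>) - 0\<bar>} \<subseteq> (\<Union>k<m. E1 k) \<union> (\<Union>k<m. E2 k)"
  proof (rule subsetI, rule ccontr)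
    fix \<omega> assume \<omega>: "\<omega> \<in> {\<omega>\<in>space M. \<epsilon> < \<bar>(SUP t\<in>{0..T}. \<bar>F N (X N t \<omega>) - P t\<bar>) - 0\<bar>}"
      and no: "\<omega> \<notin> (\<Union>k<m. E1 k) \<union> (\<Union>k<m. E2 k)"
    have sp: "\<omega> \<in> space M" using \<omega> by simp
    have "\<bar>F N (X N t \<omega>) - P t\<bar> \<le> 3 / 4 * \<epsilon>" if t: "t \<in> {0..T}" for t
    proof -
      obtain k where k: "k < m" "t \<in> {real k * \<delta>..real k * \<delta> + \<delta>}"
        using grid_cell[OF m t T \<delta>] by blast
      have "\<omega> \<notin> E1 k" "\<omega> \<notin> E2 k" using no k(1) by auto
      then have "\<bar>F N (X N (real k * \<delta>) \<omega>) - F_avg N (real k * \<delta>)\<bar> \<le> \<epsilon> / 8"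
        "\<bar>F N (X N t \<omega>) - F N (X N (real k * \<delta>) \<omega>)\<bar> \<le> 2 * (\<epsilon> / 8)"
        using sp k(2) unfolding E1_def E2_def by force+
      moreover have "\<bar>F_avg N (real k * \<delta>) - P (real k * \<delta>)\<bar> \<le> \<epsilon> / 8" by (rule avg[OF tk[OF k(1)]])
      moreover have "\<bar>P t - P (real k * \<delta>)\<bar> \<le> \<epsilon> / 4"
      proof -
        have "\<bar>P t - P (real k * \<delta>)\<bar> \<le> 18 * U * B * \<bar>t - real k * \<delta>\<bar>" by (rule P_lipschitz[OF t tk[OF k(1)]])
        also have "\<dots> \<le> 18 * U * B * \<delta>" using k(2) U_ge_1 B(1) by (intro mult_left_mono) auto
        finally show ?thesis using step by simp
      qed
      ultimately show ?thesis by linarith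
    qed
    then have "(SUP t\<in>{0..T}. \<bar>F N (X N t \<omega>) - P t\<bar>) \<le> 3 / 4 * \<epsilon>"
      using T by (intro cSUP_least) auto
    moreover have "0 \<le> (SUP t\<in>{0..T}. \<bar>F N (X N t \<omega>) - P t\<bar>)"
      by (rule cSUP_upper2[OF deviation_bounded[OF N sp], of 0]) (use T in auto)
    ultimately show False using \<omega> \<open>\<epsilon> > 0\<close> by simp
  qed
  have "prob {\<omega>\<in>space M. \<epsilon> < \<bar>(SUP t\<in>{0..T}. \<bar>F N (X N t \<omega>) - P t\<bar>) - 0\<bar>} \<le> prob ((\<Union>k<m. E1 k) \<union> (\<Union>k<m. E2 k))"
    using E1(1) E2(1) by (intro finite_measure_mono[OF sub] sets.Un sets.finite_UN) auto
  also have "\<dots> \<le> prob (\<Union>k<m. E1 k) + prob (\<Union>k<m. E2 k)"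
    using E1(1) E2(1) by (intro measure_Un_le sets.finite_UN) auto
  also have "\<dots> \<le> (\<Sum>k<m. prob (E1 k)) + (\<Sum>k<m. prob (E2 k))"
    using E1(1) E2(1) by (intro add_mono finite_measure_subadditive_finite) auto
  also have "\<dots> \<le> (\<Sum>k<m. B\<^sup>2 * \<eta> / (\<epsilon> / 8)\<^sup>2) + (\<Sum>k<m. 4 * \<delta> * ((8 * B)\<^sup>2 * \<delta> + 32 * B\<^sup>2 / real N) / (\<epsilon> / 8)\<^sup>2)"
    using E1(2) E2(2) by (intro add_mono sum_mono) auto
  finally show ?thesis by simp
qed

text \<open>The number \<open>m\<close> of cells is chosen first: it controls the part of the oscillations that comes from the drift
and persists as \<open>N\<close> grows. The remaining terms vanish with \<open>N\<close> for fixed \<open>m\<close>.\<close>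

lemma sup_deviation_tendsto_in_prob:
  "tendsto_in_prob M (\<lambda>N \<omega>. SUP t\<in>{0..T}. \<bar>F N (X N t \<omega>) - P t\<bar>) (\<lambda>_. 0) sequentially"
  unfolding tendsto_in_prob_def
proof (intro conjI allI impI)
  show "\<forall>\<^sub>F N in sequentially. (\<lambda>\<omega>. SUP t\<in>{0..T}. \<bar>F N (X N t \<omega>) - P t\<bar>) \<in> borel_measurable M"
    using eventually_ge_at_top[of 1] by (rule eventually_mono) (rule sup_deviation_measurable)
  fix \<epsilon> :: real assume "\<epsilon> > 0"
  let ?p = "\<lambda>N. prob {\<omega>\<in>space M. \<epsilon> < \<bar>(SUP t\<in>{0..T}. \<bar>F N (X N t \<omega>) - P t\<bar>) - 0\<bar>}"
  have "\<exists>N0. \<forall>N\<ge>N0. ?p N < \<kappa>" if "\<kappa> > 0" for \<kappa>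
  proof -
    define q where "q = (\<epsilon> / 8)\<^sup>2"
    have "q > 0" using \<open>\<epsilon> > 0\<close> by (simp add: q_def)
    have U: "U > 0" using U_ge_1 by simp
    \<comment> \<open>so many cells that the limit moves by at most \<open>\<epsilon> / 4\<close> within a cell, and that the drift part of the
      oscillations has probability at most \<open>\<kappa> / 4\<close>\<close>
    obtain m :: nat where m: "real m > max (72 * U * B * T / \<epsilon>) (4 * T * T * (8 * B)\<^sup>2 * 4 / (q * \<kappa>))"
      using reals_Archimedean2 by blast
    have "72 * U * B * T / \<epsilon> > 0" using U B(1) T \<open>\<epsilon> > 0\<close> by (intro divide_pos_pos mult_pos_pos) auto
    then have "m > 0" using m by (cases m) auto
    define \<delta> where "\<delta> = T / real m"
    have "\<delta> > 0" using T \<open>m > 0\<close> by (simp add: \<delta>_def)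
    have step: "18 * U * B * \<delta> \<le> \<epsilon> / 4"
    proof -
      have "72 * U * B * T / \<epsilon> \<le> real m" using m by simp
      then have "72 * U * B * T \<le> real m * \<epsilon>" using \<open>\<epsilon> > 0\<close> by (simp add: pos_divide_le_eq)
      then show ?thesis using \<open>m > 0\<close> by (simp add: \<delta>_def field_simps)
    qed
    have osc1: "real m * (4 * \<delta> * ((8 * B)\<^sup>2 * \<delta>) / q) \<le> \<kappa> / 4"
    proof -
      have "4 * T * T * (8 * B)\<^sup>2 * 4 / (q * \<kappa>) \<le> real m" using m by simp
      then have "4 * T * T * (8 * B)\<^sup>2 * 4 \<le> real m * (q * \<kappa>)" using \<open>q > 0\<close> that by (simp add: pos_divide_le_eq)
      then have "4 * T * T * (8 * B)\<^sup>2 / (real m * q) \<le> \<kappa> / 4" using \<open>m > 0\<close> \<open>q > 0\<close> by (simp add: field_simps)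
      moreover have "real m * (4 * \<delta> * ((8 * B)\<^sup>2 * \<delta>) / q) = 4 * T * T * (8 * B)\<^sup>2 / (real m * q)"
        using \<open>m > 0\<close> \<open>q > 0\<close> by (simp add: \<delta>_def field_simps)
      ultimately show ?thesis by simp
    qed
    define \<eta> where "\<eta> = q * \<kappa> / (4 * real m * B\<^sup>2)"
    have "\<eta> > 0" using \<open>q > 0\<close> that \<open>m > 0\<close> B(1) by (simp add: \<eta>_def)
    have fixed: "real m * (B\<^sup>2 * \<eta> / q) = \<kappa> / 4"
      using \<open>q > 0\<close> \<open>m > 0\<close> B(1) by (simp add: \<eta>_def)
    obtain N1 where N1: "N1 \<ge> 1" "\<forall>N\<ge>N1. \<forall>t\<in>{0..T}. \<forall>g1 g2 g3. weights_le N 1 g1 g2 g3 \<longrightarrow> mean_square_deviation N g1 g2 g3 t \<le> \<eta>"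
      using mean_square_convergence[OF \<open>\<eta> > 0\<close>] by blast
    obtain N2 where N2: "\<forall>N\<ge>N2. \<forall>t\<in>{0..T}. \<bar>F_avg N t - P t\<bar> \<le> \<epsilon> / 8"
      using F_avg_converges[of "\<epsilon> / 8"] \<open>\<epsilon> > 0\<close> by auto
    obtain N3 :: nat where N3: "real N3 > real m * (4 * \<delta> * (32 * B\<^sup>2) / q) * 4 / \<kappa>" using reals_Archimedean2 by blast
    have "?p N < \<kappa>" if N: "N \<ge> max N1 (max N2 N3)" for N
    proof -
      have N': "N \<ge> 1" "N \<ge> N1" "N \<ge> N2" "real N \<ge> real N3" using N N1(1) by auto
      have "?p N \<le> real m * (B\<^sup>2 * \<eta> / (\<epsilon> / 8)\<^sup>2) + real m * (4 * \<delta> * ((8 * B)\<^sup>2 * \<delta> + 32 * B\<^sup>2 / real N) / (\<epsilon> / 8)\<^sup>2)"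
        by (rule prob_sup_deviation_le[OF N'(1) \<open>m > 0\<close> \<delta>_def \<open>\<epsilon> > 0\<close> step]) (use N1(2) N2 N' in auto)
      also have "\<dots> = real m * (B\<^sup>2 * \<eta> / q) + real m * (4 * \<delta> * ((8 * B)\<^sup>2 * \<delta>) / q) + real m * (4 * \<delta> * (32 * B\<^sup>2) / q) / real N"
        unfolding q_def[symmetric] by (simp add: add_divide_distrib distrib_left)
      finally have bound: "?p N \<le> real m * (B\<^sup>2 * \<eta> / q) + real m * (4 * \<delta> * ((8 * B)\<^sup>2 * \<delta>) / q)
          + real m * (4 * \<delta> * (32 * B\<^sup>2) / q) / real N" .
      have "real m * (4 * \<delta> * (32 * B\<^sup>2) / q) / real N \<le> \<kappa> / 4"
      proof -
        have "real m * (4 * \<delta> * (32 * B\<^sup>2) / q) * 4 / \<kappa> \<le> real N" using N3 N'(4) by linarith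
        then have "real m * (4 * \<delta> * (32 * B\<^sup>2) / q) * 4 \<le> real N * \<kappa>" using \<open>\<kappa> > 0\<close> by (simp only: pos_divide_le_eq)
        then have "real m * (4 * \<delta> * (32 * B\<^sup>2) / q) \<le> \<kappa> / 4 * real N" by argo
        then show ?thesis using N'(1) by (subst pos_divide_le_eq) simp_all
      qed
      moreover have "p < \<kappa>" if "p \<le> a + b + c" "c \<le> \<kappa> / 4" "b \<le> \<kappa> / 4" "a = \<kappa> / 4" for p a b c
        using that \<open>\<kappa> > 0\<close> by linarith
      ultimately show "?p N < \<kappa>" using bound osc1 fixed by blast
    qed
    then show ?thesis by blast
  qed
  then show "?p \<longlonglongrightarrow> 0"
    unfolding LIMSEQ_iff by simp
qed simp

end

lemma statistic_tendsto_in_prob: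
  assumes G: "continuous_map torus.mtopology euclideanreal G1" "continuous_map torus.mtopology euclideanreal G2"
      "continuous_map torus.mtopology euclideanreal G3"
  shows "tendsto_in_prob M (\<lambda>N \<omega>. SUP t\<in>{0..T}.
      \<bar>statistic N (\<lambda>x. G1 (site N x)) (\<lambda>x. G2 (site N x)) (\<lambda>x. G3 (site N x)) (X N t \<omega>)
       - limit_pairing G1 G2 G3 t\<bar>) (\<lambda>_. 0) sequentially"
proof -
  obtain B1 B2 B3 where B: "\<forall>r\<in>{0..<1}. \<bar>G1 r\<bar> \<le> B1" "\<forall>r\<in>{0..<1}. \<bar>G2 r\<bar> \<le> B2" "\<forall>r\<in>{0..<1}. \<bar>G3 r\<bar> \<le> B3" "0 \<le> B1" "0 \<le> B2" "0 \<le> B3"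
    using torus_continuous_bounded[OF G(1)] torus_continuous_bounded[OF G(2)] torus_continuous_bounded[OF G(3)] by blast
  show ?thesis
    by (rule sup_deviation_tendsto_in_prob[OF G, of "B1 + B2 + B3 + 1"]) (use B in force)+
qed

end

theorem theorem2p1:
  fixes M :: "'w measure"
    and X :: "nat \<Rightarrow> real \<Rightarrow> 'w \<Rightarrow> config \<times> config"
    and \<beta>1 \<beta>2 lam T :: real
    and \<phi>1 \<phi>2 :: "real \<Rightarrow> real \<Rightarrow> real"
    and \<psi>1 \<psi>2 G :: "real \<Rightarrow> real"
    and u1 u2 v :: "real \<Rightarrow> real \<Rightarrow> real"
  assumes "prob_space M"
    and "\<beta>1 > 0" and "\<beta>2 > 0" and "lam > 0"
    and "interaction_kernel \<phi>1" and "interaction_kernel \<phi>2"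
    and "continuous_map torus.mtopology (top_of_set {-1..1}) \<psi>1"
    and "continuous_map torus.mtopology (top_of_set {-1..1}) \<psi>2"
    and "\<And>N. N \<ge> 1 \<Longrightarrow> markov_process_with_generator M (states N)
           (generator N \<beta>1 \<beta>2 lam \<phi>1 \<phi>2) (X N)"
    and "\<And>N. N \<ge> 1 \<Longrightarrow> product_initial M N \<psi>1 \<psi>2 (X N 0)"
    and "T > 0"
    and "continuous_map torus.mtopology euclideanreal G"
    and "solves_limit_system \<beta>1 \<beta>2 lam \<phi>1 \<phi>2 \<psi>1 \<psi>2 u1 u2 v"
  shows "tendsto_in_prob M
           (\<lambda>N \<omega>. SUP t\<in>{0..T}. \<bar>config_pairing N (fst (X N t \<omega>)) G - torus_pairing (u1 t) G\<bar>)
           (\<lambda>_. 0) sequentially \<and>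
         tendsto_in_prob M
           (\<lambda>N \<omega>. SUP t\<in>{0..T}. \<bar>config_pairing N (snd (X N t \<omega>)) G - torus_pairing (u2 t) G\<bar>)
           (\<lambda>_. 0) sequentially \<and>
         tendsto_in_prob M
           (\<lambda>N \<omega>. SUP t\<in>{0..T}. \<bar>config_pairing N (\<lambda>x. fst (X N t \<omega>) x * snd (X N t \<omega>) x) G
              - torus_pairing (v t) G\<bar>)
           (\<lambda>_. 0) sequentially"
proof -
  interpret M: prob_space M by (rule assms(1))
  interpret spin_process \<beta>1 \<beta>2 lam \<phi>1 \<phi>2 \<psi>1 \<psi>2 u1 u2 v T M X
    by unfold_locales (fact assms)+
  have zero: "continuous_map torus.mtopology euclideanreal (\<lambda>_. 0 :: real)" by simp
  note G = assms(12)
  have stat: "config_pairing N (fst \<sigma>) G = statistic N (\<lambda>x. G (site N x)) (\<lambda>_. 0) (\<lambda>_. 0) \<sigma>"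
    "config_pairing N (snd \<sigma>) G = statistic N (\<lambda>_. 0) (\<lambda>x. G (site N x)) (\<lambda>_. 0) \<sigma>"
    "config_pairing N (\<lambda>x. fst \<sigma> x * snd \<sigma> x) G = statistic N (\<lambda>_. 0) (\<lambda>_. 0) (\<lambda>x. G (site N x)) \<sigma>" for N \<sigma>
    by (simp_all add: config_pairing_def statistic_def triple_avg_def mult.commute)
  have lim: "torus_pairing (u1 t) G = limit_pairing G (\<lambda>_. 0) (\<lambda>_. 0) t" "torus_pairing (u2 t) G = limit_pairing (\<lambda>_. 0) G (\<lambda>_. 0) t"
    "torus_pairing (v t) G = limit_pairing (\<lambda>_. 0) (\<lambda>_. 0) G t" for t
    by (simp_all add: limit_pairing_def torus_pairing_def set_lebesgue_integral_def)
  show ?thesis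
    unfolding stat lim
    using statistic_tendsto_in_prob[OF G zero zero] statistic_tendsto_in_prob[OF zero G zero] statistic_tendsto_in_prob[OF zero zero G]
    by blast
qed

end
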